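(* Let $(K,\mathcal{L})$ be a $C$-minimal valued field with characteristic exponent $p$, let $W$ be a definable set and let $f\colon X\subseteq W\times K\rightarrow K^\times$ be a definable family of functions defined at a neighborhood of infinity. Let $h\colon Y\subseteq W\times \Gamma_K\to \Gamma_K$ be a definable $\Gamma$-factorization of $f$ at infinity, namely, for every $w\in W$, $f_w$ factorizes at infinity over $\Gamma$ through $h_w$. If $h$ is eventually $\mathbb{Q}$-linear, then there are a finite definable partition of $W$ into sets $W_1\cup\dots\cup W_\ell$, integers $n_1,\ldots,n_\ell,m_1,\ldots,m_\ell \in \mathbb{Z}$ and a definable function $c\colon W\to \mathrm{RV}^*$, such that for every $i$ and all $w\in W_i$, for all $x$ in a neighborhood of infinity, \[ \mathrm{rv}(f_w(x)) = \mathrm{rv}(x)^{n_i/p^{m_i}}\, c(w). \] If in addition $(K,\mathcal{L})$ is definably complete and all definable unary $\Gamma$-functions are eventually linear, then for every $i$ and all $w\in W_i$ the limit \[ a(w):=\lim_{x\to \infty} \frac{f_w(x)}{x^{n_i/p^{m_i}}} \] exists in $K$ and $c(w)=\mathrm{rv}(a(w))$.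
   Context: Valued fields $(K,v)$ are non-trivially valued; $\Gamma_K$ is the value group, $\mathcal{M}_K$ the maximal ideal of the valuation ring. Closed balls are $B(a,\gamma)=\{x\in K: v(x-a)\geq\gamma\}$ for $a \in K$, $\gamma\in\Gamma_K\cup\{+\infty\}$; open balls are $B^\circ(a,\gamma)=\{x\in K: v(x-a)>\gamma\}$ for $a\in K$, $\gamma\in\Gamma_K\cup\{-\infty\}$ (so points are closed balls and $K$ is an open ball). A ball is a closed or an open ball. $\mathcal{L}_{div}=(+,-,\cdot,0,1,\mathrm{div})$ is the language of valued fields, with $\mathrm{div}(x,y)$ interpreted as $v(x)\leq v(y)$. Let $K$ be an algebraically closed valued field and $(K,\mathcal{L})$ an expansion of $(K,\mathcal{L}_{div})$ ($\mathcal{L}\supseteq\mathcal{L}_{div}$). $(K,\mathcal{L})$ is $C$-minimal (a "$C$-minimal valued field") if for every structure $(K',\mathcal{L})$ elementarily equivalent to it, every $\mathcal{L}$-definable subset of $K'$ is a boolean combination of balls. "Definable" means $\mathcal{L}$-definable with parameters; for sets involving $\Gamma_K$ or $\mathrm{RV}$ it means interpretable. The characteristic exponent $p$ of $K$ is $1$ if $\mathrm{char}(K)=0$ and $\mathrm{char}(K)$ otherwise. $\mathrm{RV}^*=K^\times/(1+\mathcal{M}_K)$, $\mathrm{RV}=\mathrm{RV}^*\cup\{0\}$, and $\mathrm{rv}\colon K\to\mathrm{RV}$ is the quotient map with $\mathrm{rv}(0)=0$. When $p>1$, the $p$-th power map is bijective on $K^\times$ and on $\mathrm{RV}^*$, so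 $x^{n/p^m}$ is well defined in both; when $p=1$, $x^{n/p^m}=x^n$. A definable family $X\subseteq W\times K$ is a definable set whose projection to $W$ is all of $W$; $X_w=\{x: (w,x)\in X\}$. A definable family of functions is a definable function $f\colon X\subseteq W\times K\to K$, with fibers $f_w\colon X_w\to K$, $f_w(x)=f(w,x)$; similarly with $\Gamma_K$ in place of $K$. A neighborhood of infinity is a set $K\setminus B(0,\gamma)$ with $\gamma\in\Gamma_K$. The family $f$ is defined at a neighborhood of infinity if for every $w\in W$ the set $X_w$ contains a neighborhood of infinity. A function $g\colon Z\subseteq K\to K$ defined at a neighborhood of infinity factorizes at infinity over $\Gamma$ through a (possibly partial) function $h\colon\Gamma_K\to\Gamma_K$ if there is $\gamma_0\in\Gamma_K$ such that $v(g(x))=h(v(x))$ for all $x\in Z\setminus B(0,\gamma_0)$. A unary $\Gamma$-function is a function $g\colon\Gamma_K\to\Gamma_K$. It is eventually linear if there are $\delta,\alpha\in\Gamma_K$ and an endomorphism $\lambda$ of $(\Gamma_K,+)$ such that $g(\gamma)=\lambda(\gamma)+\alpha$ for all $\gamma\in\Gamma_K$ with $\gamma>\delta$; it is eventually $\mathbb{Q}$-linear if moreover $\lambda$ can be taken of the form $\lambda(\gamma)=r\gamma$ with $r\in\mathbb{Q}$ (the slope). A definable family $h$ of functions from $\Gamma_K$ to $\Gamma_K$ parametrized by $W$ is eventually $\mathbb{Q}$-linear if there is a finite set $Z_h\subseteq\mathbb{Q}$ such that for every $w\in W$ the function $h_w$ is eventually $\mathbb{Q}$-linear with slope $r\in Z_h$.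 $\lim_{x\to\infty}g(x)=b$ with $b\in K$ means: for every $\gamma\in\Gamma_K$ there is $\delta\in\Gamma_K$ such that $v(g(x)-b)>\gamma$ for all $x$ with $v(x)<\delta$. $(K,\mathcal{L})$ is definably complete if every definable family of nested balls whose set of radii tends to $+\infty$ has non-empty intersection.
   Formalization: "h is eventually Q-linear" is read for all sufficiently small γ (γ < δ), the end of the value group matching x→∞, not for γ > δ as defined: the partial h need not be defined there, and its values there are unrelated to f. The conclusion itself forces this linearity. *)

theory Defs
  imports
    "HOL-Library.Extended"
    "HOL-Library.Disjoint_Sets"
    "HOL-Computational_Algebra.Polynomial"
    "HOL-Algebra.Coset"
begin

section \<open>First-order logic\<close>

text \<open>A language is a set of function symbols and a set of relation symbols, each with its arity.\<close>

record ('f, 'r) language =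
  Funs :: "('f \<times> nat) set"
  Rels :: "('r \<times> nat) set"

datatype 'f tm = Var nat | Fn 'f "'f tm list"

datatype ('f, 'r) fm =
    Eq "'f tm" "'f tm"
  | Rel 'r "'f tm list"
  | Neg "('f, 'r) fm"
  | Conj "('f, 'r) fm" "('f, 'r) fm"
  | Exi nat "('f, 'r) fm"

fun wf_tm :: "('f, 'r) language \<Rightarrow> 'f tm \<Rightarrow> bool" where
  "wf_tm L (Var i) \<longleftrightarrow> True"
| "wf_tm L (Fn f ts) \<longleftrightarrow> (f, length ts) \<in> Funs L \<and> (\<forall>t\<in>set ts. wf_tm L t)"

fun wf_fm :: "('f, 'r) language \<Rightarrow> ('f, 'r) fm \<Rightarrow> bool" where
  "wf_fm L (Eq s t) \<longleftrightarrow> wf_tm L s \<and> wf_tm L t"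
| "wf_fm L (Rel r ts) \<longleftrightarrow> (r, length ts) \<in> Rels L \<and> (\<forall>t\<in>set ts. wf_tm L t)"
| "wf_fm L (Neg \<phi>) \<longleftrightarrow> wf_fm L \<phi>"
| "wf_fm L (Conj \<phi> \<psi>) \<longleftrightarrow> wf_fm L \<phi> \<and> wf_fm L \<psi>"
| "wf_fm L (Exi i \<phi>) \<longleftrightarrow> wf_fm L \<phi>"

fun fv_tm :: "'f tm \<Rightarrow> nat set" where
  "fv_tm (Var i) = {i}"
| "fv_tm (Fn f ts) = (\<Union>t\<in>set ts. fv_tm t)"

fun fv_fm :: "('f, 'r) fm \<Rightarrow> nat set" where
  "fv_fm (Eq s t) = fv_tm s \<union> fv_tm t"
| "fv_fm (Rel r ts) = (\<Union>t\<in>set ts. fv_tm t)"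
| "fv_fm (Neg \<phi>) = fv_fm \<phi>"
| "fv_fm (Conj \<phi> \<psi>) = fv_fm \<phi> \<union> fv_fm \<psi>"
| "fv_fm (Exi i \<phi>) = fv_fm \<phi> - {i}"

record ('f, 'r, 'a) fo_struct =
  Dom :: "'a set"
  fint :: "'f \<Rightarrow> 'a list \<Rightarrow> 'a"
  rint :: "'r \<Rightarrow> 'a list \<Rightarrow> bool"

definition is_struct :: "('f, 'r) language \<Rightarrow> ('f, 'r, 'a) fo_struct \<Rightarrow> bool" where
  "is_struct L S \<longleftrightarrow> Dom S \<noteq> {} \<and>
     (\<forall>f k xs. (f, k) \<in> Funs L \<and> length xs = k \<and> set xs \<subseteq> Dom S \<longrightarrow> fint S f xs \<in> Dom S)"

fun eval_tm :: "('f, 'r, 'a) fo_struct \<Rightarrow> (nat \<Rightarrow> 'a) \<Rightarrow> 'f tm \<Rightarrow> 'a" where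
  "eval_tm S e (Var i) = e i"
| "eval_tm S e (Fn f ts) = fint S f (map (eval_tm S e) ts)"

fun sat :: "('f, 'r, 'a) fo_struct \<Rightarrow> (nat \<Rightarrow> 'a) \<Rightarrow> ('f, 'r) fm \<Rightarrow> bool" where
  "sat S e (Eq s t) \<longleftrightarrow> eval_tm S e s = eval_tm S e t"
| "sat S e (Rel r ts) \<longleftrightarrow> rint S r (map (eval_tm S e) ts)"
| "sat S e (Neg \<phi>) \<longleftrightarrow> \<not> sat S e \<phi>"
| "sat S e (Conj \<phi> \<psi>) \<longleftrightarrow> sat S e \<phi> \<and> sat S e \<psi>"
| "sat S e (Exi i \<phi>) \<longleftrightarrow> (\<exists>a\<in>Dom S. sat S (e(i := a)) \<phi>)"

definition models :: "('f, 'r, 'a) fo_struct \<Rightarrow> ('f, 'r) fm \<Rightarrow> bool" where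
  "models S \<phi> \<longleftrightarrow> (\<forall>e. range e \<subseteq> Dom S \<longrightarrow> sat S e \<phi>)"

definition elem_equiv ::
    "('f, 'r) language \<Rightarrow> ('f, 'r, 'a) fo_struct \<Rightarrow> ('f, 'r, 'b) fo_struct \<Rightarrow> bool" where
  "elem_equiv L S T \<longleftrightarrow>
     (\<forall>\<phi>. wf_fm L \<phi> \<and> fv_fm \<phi> = {} \<longrightarrow> (models S \<phi> \<longleftrightarrow> models T \<phi>))"

text \<open>
  Subsets of the \<open>n\<close>-th cartesian power are sets of lists of length \<open>n\<close>. The list interprets the
  variables below \<open>n\<close>; the other variables occurring in the formula carry the parameters \<open>e\<close>.
\<close>

definition definable ::
    "('f, 'r) language \<Rightarrow> ('f, 'r, 'a) fo_struct \<Rightarrow> nat \<Rightarrow> 'a list set \<Rightarrow> bool" where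
  "definable L S n X \<longleftrightarrow>
     (\<exists>\<phi> e. wf_fm L \<phi> \<and> range e \<subseteq> Dom S \<and>
        X = {xs. length xs = n \<and> set xs \<subseteq> Dom S \<and> sat S (\<lambda>i. if i < n then xs ! i else e i) \<phi>})"


section \<open>Valued fields\<close>

text \<open>
  The value group is the whole type \<open>'g\<close>; the valuation takes the value \<open>Pinf\<close> exactly at \<open>0\<close>.
  The last conjunct is non-triviality.
\<close>

definition valued_field :: "('k::field \<Rightarrow> 'g::linordered_ab_group_add extended) \<Rightarrow> bool" where
  "valued_field v \<longleftrightarrow>
     v 0 = Pinf \<and> v ` (- {0}) = range Fin \<and>
     (\<forall>x y. v (x * y) = v x + v y) \<and>
     (\<forall>x y. min (v x) (v y) \<le> v (x + y)) \<and>
     (\<exists>x. x \<noteq> 0 \<and> v x \<noteq> 0)"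

definition cball :: "('k::field \<Rightarrow> 'g::linordered_ab_group_add extended) \<Rightarrow> 'k \<Rightarrow> 'g extended \<Rightarrow> 'k set"
  where "cball v a \<gamma> = {x. \<gamma> \<le> v (x - a)}"

definition oball :: "('k::field \<Rightarrow> 'g::linordered_ab_group_add extended) \<Rightarrow> 'k \<Rightarrow> 'g extended \<Rightarrow> 'k set"
  where "oball v a \<gamma> = {x. \<gamma> < v (x - a)}"

definition is_ball_of_radius ::
    "('k::field \<Rightarrow> 'g::linordered_ab_group_add extended) \<Rightarrow> 'g extended \<Rightarrow> 'k set \<Rightarrow> bool" where
  "is_ball_of_radius v \<gamma> B \<longleftrightarrow>
     (\<exists>a. (\<gamma> \<noteq> Minf \<and> B = cball v a \<gamma>) \<or> (\<gamma> \<noteq> Pinf \<and> B = oball v a \<gamma>))"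

definition nbhd_inf :: "('k::field \<Rightarrow> 'g::linordered_ab_group_add extended) \<Rightarrow> 'k set \<Rightarrow> bool" where
  "nbhd_inf v N \<longleftrightarrow> (\<exists>\<gamma>. N = - cball v 0 (Fin \<gamma>))"

definition lim_inf ::
    "('k::field \<Rightarrow> 'g::linordered_ab_group_add extended) \<Rightarrow> ('k \<Rightarrow> 'k) \<Rightarrow> 'k \<Rightarrow> bool" where
  "lim_inf v g b \<longleftrightarrow> (\<forall>\<gamma>. \<exists>\<delta>. \<forall>x. v x < Fin \<delta> \<longrightarrow> Fin \<gamma> < v (g x - b))"

definition char_exp :: "'k::field itself \<Rightarrow> nat" where
  "char_exp _ = (if CHAR('k) = 0 then 1 else CHAR('k))"

definition mult_grp :: "'k::field monoid" where
  "mult_grp = \<lparr>carrier = - {0}, monoid.mult = (*), one = 1\<rparr>"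

definition one_units :: "('k::field \<Rightarrow> 'g::linordered_ab_group_add extended) \<Rightarrow> 'k set" where
  "one_units v = {1 + u |u. 0 < v u}"

definition RVs :: "('k::field \<Rightarrow> 'g::linordered_ab_group_add extended) \<Rightarrow> 'k set monoid" where
  "RVs v = mult_grp Mod one_units v"

text \<open>The element \<open>0\<close> of \<open>RV\<close> is encoded as \<open>{0}\<close>, which is not a coset.\<close>

definition rv :: "('k::field \<Rightarrow> 'g::linordered_ab_group_add extended) \<Rightarrow> 'k \<Rightarrow> 'k set" where
  "rv v x = (if x = 0 then {0} else one_units v #>\<^bsub>mult_grp\<^esub> x)"

text \<open>
  \<open>frac_pow G p x n m\<close> is the power of \<open>x\<close> with exponent \<open>n / p ^ m\<close>, where \<open>m\<close> may be negative:
  the unique \<open>y\<close> with \<open>y ^ (p ^ m) = x ^ n\<close> if \<open>m \<ge> 0\<close>, and \<open>x ^ (n * p ^ (- m))\<close> otherwise.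
  It is well defined when the \<open>p\<close>-th power map is bijective on \<open>G\<close>, and equals \<open>x ^ n\<close> if \<open>p = 1\<close>.
\<close>

definition frac_pow :: "('a, 'b) monoid_scheme \<Rightarrow> nat \<Rightarrow> 'a \<Rightarrow> int \<Rightarrow> int \<Rightarrow> 'a" where
  "frac_pow G p x n m =
     (THE y. y \<in> carrier G \<and> y [^]\<^bsub>G\<^esub> (p ^ nat m) = x [^]\<^bsub>G\<^esub> (n * int (p ^ nat (- m))))"


section \<open>C-minimality\<close>

text \<open>Every language containing that of valued fields is, up to renaming symbols, of this form.\<close>

datatype 'f vfun = Plus | Minus | Times | Zero | One | Ext_fun 'f

datatype 'r vrel = Div | Ext_rel 'r

definition expands_Ldiv :: "('f vfun, 'r vrel) language \<Rightarrow> bool" where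
  "expands_Ldiv L \<longleftrightarrow>
     {(Plus, 2), (Minus, 2), (Times, 2), (Zero, 0), (One, 0)} \<subseteq> Funs L \<and> (Div, 2) \<in> Rels L"

definition expands_valued_field ::
    "('k::field \<Rightarrow> 'g::linordered_ab_group_add extended) \<Rightarrow> ('f vfun, 'r vrel) language
      \<Rightarrow> ('f vfun, 'r vrel, 'k) fo_struct \<Rightarrow> bool" where
  "expands_valued_field v L K \<longleftrightarrow>
     expands_Ldiv L \<and> is_struct L K \<and> Dom K = UNIV \<and>
     fint K Zero [] = 0 \<and> fint K One [] = 1 \<and>
     (\<forall>x y. fint K Plus [x, y] = x + y \<and> fint K Minus [x, y] = x - y \<and>
            fint K Times [x, y] = x * y \<and> (rint K Div [x, y] \<longleftrightarrow> v x \<le> v y))"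

text \<open>
  A structure elementarily equivalent to a valued field is a valued field with \<open>Div x y\<close> meaning
  that the value of \<open>x\<close> is at most that of \<open>y\<close>. Its balls are expressed here through \<open>Div\<close>: the
  radius is the value of an element \<open>c\<close>, with \<open>c = 0\<close> giving the radius \<open>+\<infinity>\<close> (allowed for
  closed balls only); the open ball of radius \<open>-\<infinity>\<close> is the whole field.
\<close>

definition struct_ball :: "('f vfun, 'r vrel, 'a) fo_struct \<Rightarrow> 'a set \<Rightarrow> bool" where
  "struct_ball S B \<longleftrightarrow> B = Dom S \<or>
     (\<exists>a\<in>Dom S. \<exists>c\<in>Dom S.
        B = {x \<in> Dom S. rint S Div [c, fint S Minus [x, a]]} \<or>
        (c \<noteq> fint S Zero [] \<and> B = {x \<in> Dom S. \<not> rint S Div [fint S Minus [x, a], c]}))"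

inductive_set bool_comb :: "'a set \<Rightarrow> 'a set set \<Rightarrow> 'a set set" for \<Omega> G where
  base: "A \<in> G \<Longrightarrow> A \<in> bool_comb \<Omega> G"
| compl: "A \<in> bool_comb \<Omega> G \<Longrightarrow> \<Omega> - A \<in> bool_comb \<Omega> G"
| union: "A \<in> bool_comb \<Omega> G \<Longrightarrow> B \<in> bool_comb \<Omega> G \<Longrightarrow> A \<union> B \<in> bool_comb \<Omega> G"

text \<open>
  HOL cannot quantify over all types in which an elementarily equivalent structure may live, so
  these structures are taken inside a fixed type of cardinality at least that of the language, of
  \<open>K\<close> and of every countable ultrapower of \<open>K\<close>. This loses nothing: if a definable subset of some
  elementarily equivalent structure is not a boolean combination of balls, then, by the downward
  Loewenheim-Skolem theorem, the same happens in an elementary substructure that contains the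
  parameters and has cardinality at most that of the language plus aleph zero.
\<close>

type_synonym ('f, 'r, 'k) univ = "nat \<Rightarrow> 'k + 'f + 'r"

definition C_minimal ::
    "('f vfun, 'r vrel) language \<Rightarrow> ('f vfun, 'r vrel, 'k) fo_struct \<Rightarrow> bool" where
  "C_minimal L K \<longleftrightarrow>
     (\<forall>K' :: ('f vfun, 'r vrel, ('f, 'r, 'k) univ) fo_struct.
        is_struct L K' \<and> elem_equiv L K K' \<longrightarrow>
        (\<forall>D. definable L K' 1 ((\<lambda>x. [x]) ` D) \<longrightarrow>
              D \<in> bool_comb (Dom K') (Collect (struct_ball K'))))"


section \<open>Definable families and functions\<close>

text \<open>
  A subset of (the \<open>n\<close>-th power of \<open>K\<close>) \<open>\<times> K\<close> is a set of pairs of a list and an element.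
  Sets involving the value group or \<open>RV\<close> are definable (interpretable) if their preimages
  in the powers of \<open>K\<close> under the valuation or \<open>rv\<close> are definable.
\<close>

definition definable_family ::
    "('f, 'r) language \<Rightarrow> ('f, 'r, 'k) fo_struct \<Rightarrow> nat \<Rightarrow> 'k list set
      \<Rightarrow> ('k list \<times> 'k) set \<Rightarrow> bool" where
  "definable_family L K n W X \<longleftrightarrow>
     definable L K n W \<and> fst ` X = W \<and> definable L K (n + 1) {w @ [x] |w x. (w, x) \<in> X}"

definition definable_fun_family ::
    "('f, 'r) language \<Rightarrow> ('f, 'r, 'k) fo_struct \<Rightarrow> nat \<Rightarrow> 'k list set
      \<Rightarrow> ('k list \<times> 'k) set \<Rightarrow> ('k list \<Rightarrow> 'k \<Rightarrow> 'k) \<Rightarrow> bool" where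
  "definable_fun_family L K n W X f \<longleftrightarrow>
     definable_family L K n W X \<and>
     definable L K (n + 2) {w @ [x, f w x] |w x. (w, x) \<in> X}"

definition definable_\<Gamma>_fun_family ::
    "('k::field \<Rightarrow> 'g::linordered_ab_group_add extended) \<Rightarrow> ('f, 'r) language
      \<Rightarrow> ('f, 'r, 'k) fo_struct \<Rightarrow> nat \<Rightarrow> 'k list set
      \<Rightarrow> ('k list \<times> 'g) set \<Rightarrow> ('k list \<Rightarrow> 'g \<Rightarrow> 'g) \<Rightarrow> bool" where
  "definable_\<Gamma>_fun_family v L K n W Y h \<longleftrightarrow>
     definable L K n W \<and> fst ` Y = W \<and>
     definable L K (n + 1) {w @ [x] |w x \<gamma>. (w, \<gamma>) \<in> Y \<and> v x = Fin \<gamma>} \<and>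
     definable L K (n + 2)
       {w @ [x, y] |w x y \<gamma>. (w, \<gamma>) \<in> Y \<and> v x = Fin \<gamma> \<and> v y = Fin (h w \<gamma>)}"

definition definable_unary_\<Gamma>_fun ::
    "('k::field \<Rightarrow> 'g::linordered_ab_group_add extended) \<Rightarrow> ('f, 'r) language
      \<Rightarrow> ('f, 'r, 'k) fo_struct \<Rightarrow> ('g \<Rightarrow> 'g) \<Rightarrow> bool" where
  "definable_unary_\<Gamma>_fun v L K g \<longleftrightarrow>
     definable L K 2 {[x, y] |x y \<gamma>. v x = Fin \<gamma> \<and> v y = Fin (g \<gamma>)}"

definition definable_RVs_fun ::
    "('k::field \<Rightarrow> 'g::linordered_ab_group_add extended) \<Rightarrow> ('f, 'r) language
      \<Rightarrow> ('f, 'r, 'k) fo_struct \<Rightarrow> nat \<Rightarrow> 'k list set \<Rightarrow> ('k list \<Rightarrow> 'k set) \<Rightarrow> bool" where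
  "definable_RVs_fun v L K n W c \<longleftrightarrow>
     c \<in> W \<rightarrow> carrier (RVs v) \<and>
     definable L K (n + 1) {w @ [x] |w x. w \<in> W \<and> x \<noteq> 0 \<and> rv v x = c w}"

text \<open>\<open>f\<close> with domain \<open>Z\<close> factorizes at infinity through the partial function \<open>h\<close> with domain \<open>D\<close>.\<close>

definition factorizes_at_inf ::
    "('k::field \<Rightarrow> 'g::linordered_ab_group_add extended) \<Rightarrow> 'k set \<Rightarrow> ('k \<Rightarrow> 'k)
      \<Rightarrow> 'g set \<Rightarrow> ('g \<Rightarrow> 'g) \<Rightarrow> bool" where
  "factorizes_at_inf v Z f D h \<longleftrightarrow>
     (\<exists>\<gamma>\<^sub>0. \<forall>x\<in>Z - cball v 0 (Fin \<gamma>\<^sub>0). \<exists>\<gamma>\<in>D. v x = Fin \<gamma> \<and> v (f x) = Fin (h \<gamma>))"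

definition zmult :: "int \<Rightarrow> 'g::ab_group_add \<Rightarrow> 'g" where
  "zmult k \<gamma> = (if 0 \<le> k then \<Sum>i<nat k. \<gamma> else - (\<Sum>i<nat (- k). \<gamma>))"

text \<open>
  The filter \<open>F\<close> fixes the end of the value group at which linearity holds. For a unary function
  on the value group it is \<open>at_top\<close> (all \<open>\<gamma> > \<delta>\<close>). For a function through which some \<open>f\<close>
  factorizes at infinity it is \<open>at_bot\<close> (all \<open>\<gamma> < \<delta>\<close>), since \<open>x \<rightarrow> \<infinity>\<close> means that the value
  of \<open>x\<close> tends to \<open>-\<infinity>\<close>; at the other end such a function is unrelated to \<open>f\<close>.
\<close>

definition eventually_linear ::
    "'g::linordered_ab_group_add filter \<Rightarrow> ('g \<Rightarrow> 'g) \<Rightarrow> bool" where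
  "eventually_linear F g \<longleftrightarrow>
     (\<exists>lam \<alpha>. Modules.additive lam \<and> (\<forall>\<^sub>F \<gamma> in F. g \<gamma> = lam \<gamma> + \<alpha>))"

definition is_rat_mult :: "rat \<Rightarrow> ('g::ab_group_add \<Rightarrow> 'g) \<Rightarrow> bool" where
  "is_rat_mult r lam \<longleftrightarrow>
     (\<forall>\<gamma>. zmult (snd (quotient_of r)) (lam \<gamma>) = zmult (fst (quotient_of r)) \<gamma>)"

definition eventually_Q_linear_on ::
    "'g::linordered_ab_group_add filter \<Rightarrow> 'g set \<Rightarrow> ('g \<Rightarrow> 'g) \<Rightarrow> rat \<Rightarrow> bool" where
  "eventually_Q_linear_on F D g r \<longleftrightarrow>
     (\<exists>lam \<alpha>. Modules.additive lam \<and> is_rat_mult r lam \<and>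
        (\<forall>\<^sub>F \<gamma> in F. \<gamma> \<in> D \<and> g \<gamma> = lam \<gamma> + \<alpha>))"

definition eventually_Q_linear_family ::
    "'g::linordered_ab_group_add filter \<Rightarrow> 'k list set \<Rightarrow> ('k list \<times> 'g) set
      \<Rightarrow> ('k list \<Rightarrow> 'g \<Rightarrow> 'g) \<Rightarrow> bool" where
  "eventually_Q_linear_family F W Y h \<longleftrightarrow>
     (\<exists>Z. finite Z \<and> (\<forall>w\<in>W. \<exists>r\<in>Z. eventually_Q_linear_on F (Y `` {w}) (h w) r))"

definition definably_complete ::
    "('k::field \<Rightarrow> 'g::linordered_ab_group_add extended) \<Rightarrow> ('f, 'r) language
      \<Rightarrow> ('f, 'r, 'k) fo_struct \<Rightarrow> bool" where
  "definably_complete v L K \<longleftrightarrow>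
     (\<forall>n W X. definable_family L K n W X \<and>
        (\<forall>w\<in>W. \<exists>\<rho>. is_ball_of_radius v \<rho> (X `` {w})) \<and>
        (\<forall>w\<in>W. \<forall>w'\<in>W. X `` {w} \<subseteq> X `` {w'} \<or> X `` {w'} \<subseteq> X `` {w}) \<and>
        (\<forall>\<gamma>. \<exists>w\<in>W. \<exists>\<rho>. Fin \<gamma> < \<rho> \<and> is_ball_of_radius v \<rho> (X `` {w}))
        \<longrightarrow> (\<Inter>w\<in>W. X `` {w}) \<noteq> {})"

end

theory Submission
  imports Defs
begin

text \<open>
  Suppose that \<open>v (g x) = (a / b) v x + const\<close> near infinity, in lowest terms. Then
  \<open>G y = g (y\<^sup>b) / y\<^sup>a\<close> has constant value near infinity, and the point is that a definable function
  with bounded value at infinity is Cauchy there: it ends up in a ball of any prescribed radius.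
  If \<open>\<zeta>\<close> is a root of unity of prime order \<open>q\<close> dividing \<open>b\<close>, then \<open>G (\<zeta> y) = G y / \<zeta>\<^sup>a\<close> with
  \<open>\<zeta>\<^sup>a \<noteq> 1\<close>, so \<open>G\<close> is not Cauchy; hence \<open>b\<close> is a power of \<open>p\<close>. The common class of the values of \<open>G\<close>
  near infinity is \<open>c\<close>, and definable completeness provides the limit of \<open>G\<close>.

  By C-minimality, transferred to countable ultrapowers, definable families of sets depend on
  uniformly few balls. So the residue field is uniformly strongly minimal, definable cuts of the
  value group have endpoints, and the two are orthogonal. For a definable \<open>k\<close> and a unit \<open>t\<close>, the
  class of \<open>k (t x) / k x\<close> in \<open>RV\<close> is constant near infinity and multiplicative in \<open>t\<close>. It therefore
  cancels in \<open>u x = k (x\<^sup>2) / k (x)\<^sup>2\<close>: near infinity \<open>rv (u x)\<close> depends on \<open>v x\<close> only, hence is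
  constant by orthogonality. Thus \<open>v (k (x\<^sup>2)) = 2 v (k x) + const\<close>, which forces \<open>v (k x)\<close> to be
  constant if it is bounded. Applied to \<open>g x - b\<close> and \<open>g (x\<^sup>2) - g x\<close>, this shows that \<open>g\<close> is Cauchy.
\<close>

section \<open>Definable predicates\<close>

text \<open>The substitution of \<open>y^b\<close> is there because \<open>x^(a/b)\<close> is
  multivalued until \<open>b\<close> is known to be a power of \<open>p\<close>, whereas
  \<open>G\<close> is definable from the start; conclusions return to \<open>g\<close> since the
  power map carries neighborhoods of infinity onto such neighborhoods. The class of \<open>G\<close>
  in RV alone could not exclude roots of unity congruent to 1, whence the need for every radius.
  Without completeness no limit need exist, so the Cauchy property is the strongest form available
  in the first half. The uniform bound \<open>N\<close> exchanges quantifiers. If a property holds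
  near infinity for each unit, on a neighborhood depending on the unit, then \<open>N + 1\<close>
  inequivalent units share a neighborhood, and one of them is far from all \<open>N\<close> centers;
  so on that neighborhood the property holds for every unit far from the centers. Such units
  generate all units, which settles the exceptional classes. Squaring is chosen as a definable map
  that moves points towards infinity and doubles values: a definable cut that is stable under
  doubling cannot have an endpoint of positive or negative value.\<close>

primrec ren_tm :: "(nat \<Rightarrow> nat) \<Rightarrow> 'f tm \<Rightarrow> 'f tm" where
  "ren_tm \<sigma> (Var i) = Var (\<sigma> i)"
| "ren_tm \<sigma> (Fn f ts) = Fn f (map (ren_tm \<sigma>) ts)"

text \<open>Bound variables are renamed together with the free ones. An injective renaming then
  cannot capture, and no fresh variables have to be chosen.\<close>

primrec ren_fm :: "(nat \<Rightarrow> nat) \<Rightarrow> ('f, 'r) fm \<Rightarrow> ('f, 'r) fm" where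
  "ren_fm \<sigma> (Eq s t) = Eq (ren_tm \<sigma> s) (ren_tm \<sigma> t)"
| "ren_fm \<sigma> (Rel r ts) = Rel r (map (ren_tm \<sigma>) ts)"
| "ren_fm \<sigma> (Neg \<phi>) = Neg (ren_fm \<sigma> \<phi>)"
| "ren_fm \<sigma> (Conj \<phi> \<psi>) = Conj (ren_fm \<sigma> \<phi>) (ren_fm \<sigma> \<psi>)"
| "ren_fm \<sigma> (Exi i \<phi>) = Exi (\<sigma> i) (ren_fm \<sigma> \<phi>)"

lemma eval_ren_tm: "eval_tm S e (ren_tm \<sigma> t) = eval_tm S (\<lambda>i. e (\<sigma> i)) t"
proof (induction t)
  case (Fn f ts)
  then have "map (eval_tm S e) (map (ren_tm \<sigma>) ts) = map (eval_tm S (\<lambda>i. e (\<sigma> i))) ts" by auto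
  then show ?case by (simp only: eval_tm.simps ren_tm.simps)
qed simp

lemma wf_ren_tm: "wf_tm L t \<Longrightarrow> wf_tm L (ren_tm \<sigma> t)"
  by (induction t) auto

lemma wf_ren_fm: "wf_fm L \<phi> \<Longrightarrow> wf_fm L (ren_fm \<sigma> \<phi>)"
  by (induction \<phi>) (auto simp: wf_ren_tm)

lemma sat_ren_fm:
  assumes "inj \<sigma>"
  shows "sat S e (ren_fm \<sigma> \<phi>) = sat S (\<lambda>i. e (\<sigma> i)) \<phi>"
proof (induction \<phi> arbitrary: e)
  case (Exi i \<phi>)
  have "(\<lambda>j. (e(\<sigma> i := a)) (\<sigma> j)) = (\<lambda>j. e (\<sigma> j))(i := a)" for a
    using assms by (simp add: fun_eq_iff inj_eq[OF assms])
  then show ?case using Exi by simp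
next
  case (Rel r ts)
  have "map (eval_tm S e) (map (ren_tm \<sigma>) ts) = map (eval_tm S (\<lambda>i. e (\<sigma> i))) ts"
    by (simp add: eval_ren_tm)
  then show ?case by (simp only: sat.simps ren_fm.simps)
qed (simp_all add: eval_ren_tm)

lemma eval_tm_cong: "(\<And>i. i \<in> fv_tm t \<Longrightarrow> e i = e' i) \<Longrightarrow> eval_tm S e t = eval_tm S e' t"
proof (induction t)
  case (Fn f ts)
  then have "map (eval_tm S e) ts = map (eval_tm S e') ts" by auto
  then show ?case by (simp only: eval_tm.simps)
qed auto

lemma sat_cong: "(\<And>i. i \<in> fv_fm \<phi> \<Longrightarrow> e i = e' i) \<Longrightarrow> sat S e \<phi> = sat S e' \<phi>"
proof (induction \<phi> arbitrary: e e')
  case (Eq s t)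
  have "eval_tm S e s = eval_tm S e' s" "eval_tm S e t = eval_tm S e' t"
    by (auto intro!: eval_tm_cong Eq)
  then show ?case by simp
next
  case (Rel r ts)
  then have "map (eval_tm S e) ts = map (eval_tm S e') ts" by (auto intro: eval_tm_cong)
  then show ?case by (simp only: sat.simps)
next
  case (Neg \<phi>)
  have "sat S e \<phi> = sat S e' \<phi>" by (rule Neg(1)) (use Neg(2) in simp)
  then show ?case by simp
next
  case (Conj \<phi> \<psi>)
  have "sat S e \<phi> = sat S e' \<phi>" by (rule Conj(1)) (use Conj(3) in simp)
  moreover have "sat S e \<psi> = sat S e' \<psi>" by (rule Conj(2)) (use Conj(3) in simp)
  ultimately show ?case by simp
next
  case (Exi i \<phi>)
  have "sat S (e(i := a)) \<phi> = sat S (e'(i := a)) \<phi>" for a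
    by (rule Exi(1)) (use Exi(2) in auto)
  then show ?case by simp
qed

lemma finite_fv_tm: "finite (fv_tm t)"
  by (induction t) auto

lemma finite_fv_fm: "finite (fv_fm \<phi>)"
  by (induction \<phi>) (auto simp: finite_fv_tm)

text \<open>The even variables of a formula are the free variables, the odd ones carry the parameters.\<close>

definition mix :: "(nat \<Rightarrow> 'k) \<Rightarrow> (nat \<Rightarrow> 'k) \<Rightarrow> nat \<Rightarrow> 'k" where
  "mix e p i = (if even i then e (i div 2) else p (i div 2))"

lemma mix_simps [simp]: "mix e p (2 * i) = e i" "mix e p (Suc (2 * i)) = p i"
  by (simp_all add: mix_def)

lemma mix_simps' [simp]:
  "mix e p 0 = e 0" "mix e p (Suc 0) = p 0" "mix e p (Suc (Suc (2 * i))) = e (Suc i)"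
  "mix e p (Suc (Suc (Suc (2 * i)))) = p (Suc i)"
  "mix e p (Suc (4 * i)) = p (2 * i)" "mix e p (Suc (Suc (Suc (4 * i)))) = p (Suc (2 * i))"
  by (simp_all add: mix_def)

lemma nat_parity_cases: obtains j where "(i::nat) = 2 * j" | j where "i = Suc (2 * j)"
  by (metis evenE oddE Suc_eq_plus1)

lemma mix_eqI: "(\<And>i. f (2 * i) = e i) \<Longrightarrow> (\<And>i. f (Suc (2 * i)) = p i) \<Longrightarrow> mix e p = f"
  by (rule ext) (metis mix_simps nat_parity_cases)

lemma inj_mixI:
  assumes "\<And>i j. ev i = ev j \<Longrightarrow> i = j" "\<And>i j. od i = od j \<Longrightarrow> i = j" "\<And>i j. ev i \<noteq> od j"
  shows "inj (mix ev od)"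
proof (rule injI)
  fix x y assume *: "mix ev od x = mix ev od y"
  obtain i where x: "x = 2 * i \<or> x = Suc (2 * i)" by (metis nat_parity_cases)
  obtain j where y: "y = 2 * j \<or> y = Suc (2 * j)" by (metis nat_parity_cases)
  from x y * show "x = y"
    by (elim disjE) (use assms(1)[of i j] assms(2)[of i j] assms(3)[of i j] assms(3)[of j i] in simp_all)
qed

lemma even_neq_odd: "2 * i \<noteq> Suc (2 * j)" "Suc (2 * j) \<noteq> 2 * (i::nat)"
  "2 * i \<noteq> Suc (4 * j)" "Suc (4 * j) \<noteq> 2 * (i::nat)"
  "2 * i \<noteq> Suc (Suc (Suc (4 * j)))" "Suc (Suc (Suc (4 * j))) \<noteq> 2 * (i::nat)"
  by presburger+

locale fo_univ =
  fixes L :: "('f, 'r) language" and K :: "('f, 'r, 'k) fo_struct"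
  assumes Dom_K: "Dom K = UNIV"
begin

text \<open>Definability is a property of predicates on environments, so it can be derived from the
  shape of a HOL term by closure rules and formulas need not be written out. Environments are
  infinite: fresh entries are always available and arities are not tracked.\<close>

definition Dp :: "((nat \<Rightarrow> 'k) \<Rightarrow> bool) \<Rightarrow> bool" where
  "Dp P \<longleftrightarrow> (\<exists>\<phi> p. wf_fm L \<phi> \<and> (\<forall>e. P e = sat K (mix e p) \<phi>))"

lemma DpI: "wf_fm L \<phi> \<Longrightarrow> (\<And>e. P e = sat K (mix e p) \<phi>) \<Longrightarrow> Dp P"
  unfolding Dp_def by blast

lemma DpE:
  assumes "Dp P"
  obtains \<phi> p where "wf_fm L \<phi>" "\<And>e. P e = sat K (mix e p) \<phi>"
  using assms unfolding Dp_def by blast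

lemma Dp_not [intro]: "Dp P \<Longrightarrow> Dp (\<lambda>e. \<not> P e)"
  by (elim DpE, rule_tac \<phi> = "Neg \<phi>" and p = p in DpI) simp_all

lemma Dp_conj [intro]:
  assumes "Dp P" "Dp Q"
  shows "Dp (\<lambda>e. P e \<and> Q e)"
proof -
  obtain \<phi> p where \<phi>: "wf_fm L \<phi>" "\<And>e. P e = sat K (mix e p) \<phi>"
    using assms(1) by (elim DpE) blast
  obtain \<psi> q where \<psi>: "wf_fm L \<psi>" "\<And>e. Q e = sat K (mix e q) \<psi>"
    using assms(2) by (elim DpE) blast
  \<comment> \<open>The two parameter sequences are interleaved as \<open>mix p q\<close>; the
    parameter slots of one formula move to the even places among the odd variables, those of the
    other to the odd places.\<close>
  define \<sigma> where "\<sigma> = mix (\<lambda>i. 2 * i) (\<lambda>i. Suc (2 * (2 * i)))"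
  define \<tau> where "\<tau> = mix (\<lambda>i. 2 * i) (\<lambda>i. Suc (2 * (Suc (2 * i))))"
  have inj: "inj \<sigma>" "inj \<tau>"
    unfolding \<sigma>_def \<tau>_def by (rule inj_mixI; use even_neq_odd in simp)+
  have 1: "mix e p = (\<lambda>i. mix e (mix p q) (\<sigma> i))" for e
    by (rule mix_eqI) (simp_all add: \<sigma>_def)
  have 2: "mix e q = (\<lambda>i. mix e (mix p q) (\<tau> i))" for e
    by (rule mix_eqI) (simp_all add: \<tau>_def del: mult_Suc_right)
  have "(P e \<and> Q e) = sat K (mix e (mix p q)) (Conj (ren_fm \<sigma> \<phi>) (ren_fm \<tau> \<psi>))" for e
    unfolding \<phi>(2) \<psi>(2) sat.simps sat_ren_fm[OF inj(1)] sat_ren_fm[OF inj(2)]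
      1[symmetric] 2[symmetric] by (rule refl)
  moreover have "wf_fm L (Conj (ren_fm \<sigma> \<phi>) (ren_fm \<tau> \<psi>))"
    using \<phi>(1) \<psi>(1) by (simp add: wf_ren_fm)
  ultimately show ?thesis by (intro DpI)
qed

lemma Dp_disj [intro]: "Dp P \<Longrightarrow> Dp Q \<Longrightarrow> Dp (\<lambda>e. P e \<or> Q e)"
  using Dp_not[OF Dp_conj[OF Dp_not Dp_not]] by simp

lemma Dp_imp [intro]: "Dp P \<Longrightarrow> Dp Q \<Longrightarrow> Dp (\<lambda>e. P e \<longrightarrow> Q e)"
  unfolding imp_conv_disj by (rule Dp_disj[OF Dp_not])

lemma Dp_True: "Dp (\<lambda>e. True)"
  unfolding Dp_def by (rule exI[of _ "Eq (Var 0) (Var 0)"]) simp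

lemma Dp_const [intro]: "Dp (\<lambda>e. b)"
  using Dp_True Dp_not[OF Dp_True] by (cases b) simp_all

lemma Dp_rename:
  assumes "Dp P" "inj \<sigma>"
  shows "Dp (\<lambda>e. P (\<lambda>i. e (\<sigma> i)))"
proof -
  obtain \<phi> p where \<phi>: "wf_fm L \<phi>" "\<And>e. P e = sat K (mix e p) \<phi>"
    using assms(1) by (elim DpE) blast
  let ?\<tau> = "mix (\<lambda>i. 2 * \<sigma> i) (\<lambda>i. Suc (2 * i))"
  have inj: "inj ?\<tau>"
    by (rule inj_mixI) (use even_neq_odd in \<open>auto simp: inj_eq[OF assms(2)]\<close>)
  have eq: "mix (\<lambda>i. e (\<sigma> i)) p = (\<lambda>i. mix e p (?\<tau> i))" for e
    by (rule mix_eqI) simp_all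
  have "P (\<lambda>i. e (\<sigma> i)) = sat K (mix e p) (ren_fm ?\<tau> \<phi>)" for e
    unfolding \<phi>(2) sat_ren_fm[OF inj] eq by (rule refl)
  then show ?thesis by (rule DpI[OF wf_ren_fm[OF \<phi>(1)]])
qed

text \<open>The premise is in de Bruijn form: the bound element becomes entry 0 and the environment
  is shifted.\<close>

lemma Dp_ex [intro]:
  assumes "Dp (\<lambda>e. Q (e 0) (\<lambda>i. e (Suc i)))"
  shows "Dp (\<lambda>e. \<exists>x. Q x e)"
proof -
  obtain \<phi> p where \<phi>: "wf_fm L \<phi>" "\<And>e. Q (e 0) (\<lambda>i. e (Suc i)) = sat K (mix e p) \<phi>"
    using assms by (elim DpE) blast
  \<comment> \<open>Variable 1, the slot of the first parameter, is vacated to become the bound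
    variable; all parameters move up by one slot, and the free variables after the bound one move
    down.\<close>
  let ?ev = "\<lambda>i. if i = 0 then 1 else 2 * (i - 1)" and ?od = "\<lambda>i. Suc (2 * Suc i)"
  define \<tau> where "\<tau> = mix ?ev ?od"
  have inj: "inj \<tau>"
    unfolding \<tau>_def
    by (rule inj_mixI) (use even_neq_odd in \<open>auto split: if_splits simp del: mult_Suc_right\<close>)
  define q where "q = case_nat undefined p"
  have "mix (case_nat a e) p = (\<lambda>i. ((mix e q)(1 := a)) (\<tau> i))" for a e
  proof (rule mix_eqI)
    show "((mix e q)(1 := a)) (\<tau> (2 * i)) = case_nat a e i" for i
      using even_neq_odd(1)[of "i - 1" 0] by (cases i) (simp_all add: \<tau>_def)
    show "((mix e q)(1 := a)) (\<tau> (Suc (2 * i))) = p i" for i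
      by (simp add: \<tau>_def q_def del: mult_Suc_right)
  qed
  note 1 = this
  have "(\<exists>x. Q x e) = sat K (mix e q) (Exi 1 (ren_fm \<tau> \<phi>))" for e
  proof -
    have "Q x e = sat K (mix (case_nat x e) p) \<phi>" for x
      using \<phi>(2)[of "case_nat x e"] by simp
    then show ?thesis using inj Dom_K 1 by (simp add: sat_ren_fm)
  qed
  moreover have "wf_fm L (Exi 1 (ren_fm \<tau> \<phi>))" using \<phi>(1) by (simp add: wf_ren_fm)
  ultimately show ?thesis by (intro DpI)
qed

lemma Dp_all [intro]: "Dp (\<lambda>e. Q (e 0) (\<lambda>i. e (Suc i))) \<Longrightarrow> Dp (\<lambda>e. \<forall>x. Q x e)"
  using Dp_not[OF Dp_ex[of "\<lambda>x e. \<not> Q x e"]] Dp_not by simp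

lemma Dp_shift: "Dp P \<Longrightarrow> Dp (\<lambda>e. P (\<lambda>i. e (Suc i)))"
  by (rule Dp_rename) auto

section \<open>Definable functions and substitution\<close>

text \<open>Through the graph, functions that no term denotes, such as division, are covered as
  well.\<close>

definition Df :: "((nat \<Rightarrow> 'k) \<Rightarrow> 'k) \<Rightarrow> bool" where
  "Df T \<longleftrightarrow> Dp (\<lambda>e. e 0 = T (\<lambda>i. e (Suc i)))"

lemma Df_shift: "Df T \<Longrightarrow> Df (\<lambda>e. T (\<lambda>i. e (Suc i)))"
  unfolding Df_def
  by (drule Dp_rename[of _ "\<lambda>i. if i = 0 then 0 else Suc i"]) (auto simp: inj_def)

text \<open>The substituted value is named by an existential quantifier over the graph of
  \<open>A\<close>.\<close>

lemma Dp_app1: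
  assumes "Dp (\<lambda>e. R (e 0))" "Df A"
  shows "Dp (\<lambda>e. R (A e))"
proof -
  have "Dp (\<lambda>e. \<exists>x. x = A e \<and> R x)"
    using assms by (intro Dp_ex Dp_conj) (simp_all add: Df_def)
  then show ?thesis by simp
qed

lemma Dp_app2:
  assumes "Dp (\<lambda>e. R (e 0) (e 1))" "Df A" "Df B"
  shows "Dp (\<lambda>e. R (A e) (B e))"
proof -
  \<comment> \<open>The inner quantifier takes entry 0, so the arguments arrive in reverse
    order.\<close>
  have 1: "Dp (\<lambda>e. R (e 1) (e 0))"
    using Dp_rename[OF assms(1), of "\<lambda>i. if i = 0 then 1 else if i = 1 then 0 else i"]
    by (simp add: inj_def)
  have "Dp (\<lambda>e. \<exists>x. x = A e \<and> (\<exists>y. y = B e \<and> R x y))"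
    using assms(2,3) Df_shift[OF assms(3)] 1
    by (intro Dp_ex Dp_conj) (simp_all add: Df_def)
  then show ?thesis by simp
qed

lemma Dp_app3:
  assumes "Dp (\<lambda>e. R (e 0) (e 1) (e 2))" "Df A" "Df B" "Df C"
  shows "Dp (\<lambda>e. R (A e) (B e) (C e))"
proof -
  have 1: "Dp (\<lambda>e. R (e 2) (e 1) (e 0))"
    using Dp_rename[OF assms(1), of "\<lambda>i. if i = 0 then 2 else if i = 2 then 0 else i"]
    by (simp add: inj_def)
  have "Dp (\<lambda>e. \<exists>x. x = A e \<and> (\<exists>y. y = B e \<and> (\<exists>z. z = C e \<and> R x y z)))"
    using assms(2,3) Df_shift[OF assms(3)] Df_shift[OF Df_shift[OF assms(4)]] 1
    by (intro Dp_ex Dp_conj) (simp_all add: Df_def numeral_2_eq_2)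
  then show ?thesis by simp
qed

lemma Dp_var_eq: "Dp (\<lambda>e. e i = e j)"
  unfolding Dp_def by (rule exI[of _ "Eq (Var (2 * i)) (Var (2 * j))"]) simp

lemma Df_var [intro]: "Df (\<lambda>e. e i)"
  unfolding Df_def by (rule Dp_var_eq)

lemma Df_const [intro]: "Df (\<lambda>e. c)"
  unfolding Df_def Dp_def
  by (rule exI[of _ "Eq (Var (2 * 0)) (Var (Suc (2 * 0)))"], rule exI[of _ "\<lambda>_. c"])
     (simp del: mult_0_right)

lemma Dp_eq [intro]: "Df A \<Longrightarrow> Df B \<Longrightarrow> Dp (\<lambda>e. A e = B e)"
  by (rule Dp_app2[of "(=)"]) (rule Dp_var_eq)

lemma Df_if [intro]:
  assumes "Dp P" "Df A" "Df B"
  shows "Df (\<lambda>e. if P e then A e else B e)"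
proof -
  have "Dp (\<lambda>e. (P (\<lambda>i. e (Suc i)) \<and> e 0 = A (\<lambda>i. e (Suc i))) \<or>
                (\<not> P (\<lambda>i. e (Suc i)) \<and> e 0 = B (\<lambda>i. e (Suc i))))"
    using assms Dp_shift[OF assms(1)] unfolding Df_def by (intro Dp_disj Dp_conj Dp_not)
  then show ?thesis unfolding Df_def by (rule back_subst[of Dp]) auto
qed

lemma Df_app1:
  assumes "Dp (\<lambda>e. e 0 = F (e 1))" "Df A"
  shows "Df (\<lambda>e. F (A e))"
  unfolding Df_def by (rule Dp_app2[of "\<lambda>y x. y = F x"]) (use assms Df_shift in auto)

lemma Df_app2:
  assumes "Dp (\<lambda>e. e 0 = F (e 1) (e 2))" "Df A" "Df B"
  shows "Df (\<lambda>e. F (A e) (B e))"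
  unfolding Df_def by (rule Dp_app3[of "\<lambda>z x y. z = F x y"]) (use assms Df_shift in auto)

lemma Df_fun: "Df (\<lambda>e. F (e 0)) \<Longrightarrow> Df A \<Longrightarrow> Df (\<lambda>e. F (A e))"
  by (rule Df_app1) (simp add: Df_def)

lemma Dp_of_definable:
  assumes "definable L K n S"
  shows "Dp (\<lambda>e. map e [0..<n] \<in> S)"
proof -
  obtain \<phi> c where \<phi>: "wf_fm L \<phi>"
    "S = {xs. length xs = n \<and> set xs \<subseteq> Dom K \<and> sat K (\<lambda>i. if i < n then xs ! i else c i) \<phi>}"
    using assms unfolding definable_def by blast
  define \<sigma> where "\<sigma> i = (if i < n then 2 * i else Suc (2 * i))" for i
  have inj: "inj \<sigma>"
    by (rule injI) (use even_neq_odd in \<open>auto simp: \<sigma>_def split: if_splits\<close>)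
  have "map e [0..<n] \<in> S \<longleftrightarrow> sat K (mix e c) (ren_fm \<sigma> \<phi>)" for e
  proof -
    have "(\<lambda>i. if i < n then map e [0..<n] ! i else c i) = (\<lambda>i. mix e c (\<sigma> i))"
      by (auto simp: \<sigma>_def fun_eq_iff)
    then show ?thesis using \<phi>(2) Dom_K inj by (simp add: sat_ren_fm)
  qed
  then show ?thesis by (rule DpI[OF wf_ren_fm[OF \<phi>(1)]])
qed

lemma definable_of_Dp:
  assumes "Dp P" "\<And>e e'. (\<And>i. i < n \<Longrightarrow> e i = e' i) \<Longrightarrow> P e = P e'"
  shows "definable L K n {xs. length xs = n \<and> P (\<lambda>i. xs ! i)}"
proof -
  obtain \<phi> p where \<phi>: "wf_fm L \<phi>" "\<And>e. P e = sat K (mix e p) \<phi>"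
    using assms(1) by (elim DpE) blast
  define \<sigma> where "\<sigma> = mix (\<lambda>i. if i < n then i else n + 2 * i) (\<lambda>i. n + Suc (2 * i))"
  have inj: "inj \<sigma>"
    unfolding \<sigma>_def by (rule inj_mixI) (use even_neq_odd in \<open>auto split: if_splits\<close>)
  \<comment> \<open>Variable \<open>n + 2 i + 1\<close> carries parameter \<open>i\<close>. The
    places \<open>n + 2 i\<close> stand for entries beyond the list, on which \<open>P\<close> does
    not depend; they receive \<open>p i\<close> too, in accordance with the choice of
    \<open>e\<close> below.\<close>
  define c where "c i = p ((i - n) div 2)" for i
  have "P (\<lambda>i. xs ! i) = sat K (\<lambda>i. if i < n then xs ! i else c i) (ren_fm \<sigma> \<phi>)" for xs
  proof -
    define e where "e i = (if i < n then xs ! i else p i)" for i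
    have "mix e p = (\<lambda>i. (\<lambda>i. if i < n then xs ! i else c i) (\<sigma> i))"
      by (rule mix_eqI) (simp_all add: \<sigma>_def c_def e_def)
    moreover have "P (\<lambda>i. xs ! i) = P e" by (rule assms(2)) (simp add: e_def)
    ultimately show ?thesis using \<phi>(2)[of e] inj by (simp add: sat_ren_fm)
  qed
  then show ?thesis unfolding definable_def using wf_ren_fm[OF \<phi>(1)] Dom_K
    by (intro exI[of _ "ren_fm \<sigma> \<phi>"] exI[of _ c]) auto
qed

lemma Dp_subst:
  assumes "Dp P" "\<And>i. i < n \<Longrightarrow> Df (T i)"
  shows "Dp (\<lambda>e. P (\<lambda>i. if i < n then T i e else e (i - n)))"
  using assms
proof (induction n arbitrary: P)
  case 0
  then show ?case by simp
next
  case (Suc n)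
  \<comment> \<open>\<open>P'\<close> has the last substituted entry filled in. \<open>T n\<close>
    reads the environment from entry \<open>n\<close> on, because the other \<open>n\<close>
    substitutions will be put in front of it.\<close>
  define P' where
    "P' e = P (\<lambda>i. if i < n then e i else if i = n then T n (\<lambda>j. e (n + j)) else e (i - 1))" for e
  let ?\<sigma> = "\<lambda>i. if i < n then Suc i else if i = n then 0 else i"
    and ?\<tau> = "\<lambda>i. if i = 0 then 0 else Suc n + (i - 1)"
  have "inj ?\<sigma>" by (rule injI) (auto split: if_splits)
  from Dp_rename[OF Suc.prems(1) this] have P: "Dp (\<lambda>e. P (\<lambda>i. e (?\<sigma> i)))" .
  have "inj ?\<tau>" by (rule injI) (auto split: if_splits)
  from Dp_rename[OF Suc.prems(2)[of n, unfolded Df_def] this]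
  have T: "Dp (\<lambda>e. e 0 = T n (\<lambda>j. e (Suc (n + j))))" by simp
  have eq: "(\<lambda>i. e (?\<sigma> i)) =
      (\<lambda>i. if i < n then e (Suc i) else if i = n then e 0 else e (Suc (i - 1)))" for e :: "nat \<Rightarrow> 'k"
    by (auto simp: fun_eq_iff)
  have "Dp (\<lambda>e. \<exists>x. x = T n (\<lambda>j. e (n + j)) \<and>
      P (\<lambda>i. if i < n then e i else if i = n then x else e (i - 1)))"
    by (intro Dp_ex Dp_conj T) (use P eq in simp)
  then have "Dp P'" unfolding P'_def by simp
  from Suc.IH[OF this] Suc.prems(2)
  have "Dp (\<lambda>e. P' (\<lambda>i. if i < n then T i e else e (i - n)))" by simp
  moreover have "P' (\<lambda>i. if i < n then T i e else e (i - n)) =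
      P (\<lambda>i. if i < Suc n then T i e else e (i - Suc n))" for e
    unfolding P'_def by (rule arg_cong[of _ _ P]) (auto simp: fun_eq_iff less_Suc_eq)
  ultimately show ?case by simp
qed

lemma Dp_bex_finite: "finite R \<Longrightarrow> (\<And>r. r \<in> R \<Longrightarrow> Dp (P r)) \<Longrightarrow> Dp (\<lambda>e. \<exists>r\<in>R. P r e)"
proof (induction R rule: finite_induct)
  case (insert r R)
  then have "Dp (\<lambda>e. P r e \<or> (\<exists>r\<in>R. P r e))" by (intro Dp_disj) auto
  then show ?case by simp
qed (simp add: Dp_const)

end

section \<open>Ultrapowers\<close>

text \<open>A maximal family all of whose finite intersections are infinite contains every set or
  its complement. It contains no finite set, hence every cofinite one.\<close>

lemma free_ultrafilter_nat:
  obtains F :: "nat filter" where "F \<noteq> bot" "F \<le> sequentially"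
    "\<And>P. eventually P F \<or> eventually (\<lambda>n. \<not> P n) F"
proof -
  define good where "good M \<longleftrightarrow> (\<forall>X\<subseteq>M. finite X \<longrightarrow> infinite (\<Inter>X))" for M :: "nat set set"
  have "\<exists>M\<in>Collect good. \<forall>X\<in>Collect good. M \<subseteq> X \<longrightarrow> X = M"
  proof (rule subset_Zorn')
    fix C assume C: "subset.chain (Collect good) C"
    have "infinite (\<Inter>X)" if X: "X \<subseteq> \<Union>C" "finite X" for X
    proof (cases "X = {}")
      case False
      then have "C \<noteq> {}" using X by auto
      then obtain M where "M \<in> C" "X \<subseteq> M"
        using finite_subset_Union_chain[OF X(2) X(1) _ C] by metis
      then show ?thesis using C X(2) unfolding subset.chain_def good_def by blast
    qed simp
    then show "\<Union>C \<in> Collect good" by (simp add: good_def)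
  qed
  then obtain M where M: "good M" "\<And>X. good X \<Longrightarrow> M \<subseteq> X \<Longrightarrow> X = M" by blast
  have ultra: "A \<in> M \<or> - A \<in> M" for A
  proof (rule ccontr)
    assume "\<not> (A \<in> M \<or> - A \<in> M)"
    then have "\<not> good (insert A M)" "\<not> good (insert (- A) M)"
      using M(2)[of "insert A M"] M(2)[of "insert (- A) M"] by auto
    obtain X where X: "X \<subseteq> insert A M" "finite X" "finite (\<Inter>X)"
      using \<open>\<not> good (insert A M)\<close> unfolding good_def not_all not_imp not_not
      by (elim exE conjE) (rule that)
    obtain Y where Y: "Y \<subseteq> insert (- A) M" "finite Y" "finite (\<Inter>Y)"
      using \<open>\<not> good (insert (- A) M)\<close> unfolding good_def not_all not_imp not_not
      by (elim exE conjE) (rule that)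
    \<comment> \<open>A point of the intersection of \<open>?Z\<close> lies in \<open>A\<close> or
      in its complement, so it lies in the intersection of \<open>X\<close> or of \<open>Y\<close>;
      both are finite.\<close>
    let ?Z = "(X - {A}) \<union> (Y - {- A})"
    have "\<Inter>?Z \<subseteq> \<Inter>X \<union> \<Inter>Y"
    proof
      fix x assume x: "x \<in> \<Inter>?Z"
      show "x \<in> \<Inter>X \<union> \<Inter>Y"
      proof (cases "x \<in> A")
        case True
        then have "x \<in> B" if "B \<in> X" for B using x that by (cases "B = A") auto
        then show ?thesis by blast
      next
        case False
        then have "x \<in> B" if "B \<in> Y" for B using x that by (cases "B = - A") auto
        then show ?thesis by blast
      qed
    qed
    then have "finite (\<Inter>?Z)" by (rule finite_subset) (use X Y in simp)
    moreover have "?Z \<subseteq> M" using X(1) Y(1) by blast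
    moreover have "finite ?Z" using X(2) Y(2) by simp
    ultimately show False using M(1) unfolding good_def by metis
  qed
  define F where "F = (INF A\<in>M. principal A)"
  have F: "eventually P F" if "{n. P n} \<in> M" for P
    unfolding F_def by (rule eventually_INF1[OF that]) (simp add: eventually_principal)
  have "F \<noteq> bot"
  proof
    assume "F = bot"
    then have "eventually (\<lambda>_. False) (INF A\<in>M. principal A)" unfolding F_def by simp
    then have "\<exists>X\<subseteq>M. finite X \<and> eventually (\<lambda>_. False) (INF A\<in>X. principal A)"
      by (subst (asm) eventually_INF)
    then obtain X where X: "X \<subseteq> M" "finite X" "eventually (\<lambda>_. False) (INF A\<in>X. principal A)"
      by (elim exE conjE) (rule that)
    have "\<Inter>X = {}" using X(3) INF_principal_finite[OF X(2), of "\<lambda>x. x"]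
      by (auto simp: eventually_principal)
    then have "finite (\<Inter>X)" by simp
    then show False using M(1) X(1,2) unfolding good_def by blast
  qed
  moreover have "F \<le> sequentially"
  proof (rule filter_leI)
    fix P assume "eventually P sequentially"
    then have "finite (- {n. P n})" unfolding cofinite_eq_sequentially[symmetric]
      by (simp add: eventually_cofinite Collect_neg_eq)
    then have "finite (\<Inter>{- {n. P n}})" by simp
    then have "\<not> {- {n. P n}} \<subseteq> M" using M(1) unfolding good_def by blast
    then show "eventually P F" using ultra F by blast
  qed
  moreover have "eventually P F \<or> eventually (\<lambda>n. \<not> P n) F" for P
    using ultra[of "{n. P n}"] F[of P] F[of "\<lambda>n. \<not> P n"] by (auto simp: Collect_neg_eq)
  ultimately show ?thesis using that by blast
qed

locale ultrapower =
  fixes F :: "nat filter" and L :: "('f, 'r) language" and K :: "('f, 'r, 'k) fo_struct"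
  assumes F_proper: "F \<noteq> bot" and F_ultra: "\<And>P. eventually P F \<or> eventually (\<lambda>n. \<not> P n) F"
    and F_free: "F \<le> sequentially" and Dom_K: "Dom K = UNIV"
begin

lemma ev_not: "eventually (\<lambda>n. \<not> P n) F \<longleftrightarrow> \<not> eventually P F"
proof -
  have False if "eventually P F" "eventually (\<lambda>n. \<not> P n) F"
  proof -
    have "eventually (\<lambda>_. False) F" using that by eventually_elim simp
    then show False using F_proper by simp
  qed
  then show ?thesis using F_ultra[of P] by blast
qed

text \<open>
  Elements of the ultrapower are chosen representatives of classes of sequences, so that the
  ultrapower lives in the type over which \<open>C_minimal\<close> quantifies.
\<close>

definition rep :: "(nat \<Rightarrow> 'k) \<Rightarrow> nat \<Rightarrow> 'k + 'a + 'b" where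
  "rep s = (\<lambda>n. Inl ((SOME t. \<forall>\<^sub>F m in F. t m = s m) n))"

definition pr :: "(nat \<Rightarrow> 'k + 'a + 'b) \<Rightarrow> nat \<Rightarrow> 'k" where
  "pr x n = projl (x n)"

lemma pr_rep: "\<forall>\<^sub>F n in F. pr (rep s) n = s n"
proof -
  have "\<forall>\<^sub>F n in F. (SOME t. \<forall>\<^sub>F m in F. t m = s m) n = s n"
    by (rule someI[of _ s]) simp
  then show ?thesis by (simp add: pr_def rep_def)
qed

lemma rep_eqI:
  assumes "\<forall>\<^sub>F n in F. s n = t n"
  shows "rep s = rep t"
proof -
  have "(\<forall>\<^sub>F m in F. u m = s m) = (\<forall>\<^sub>F m in F. u m = t m)" for u
    using assms by (intro iffI; elim eventually_rev_mp) (auto elim: eventually_mono)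
  then show ?thesis unfolding rep_def by presburger
qed

lemma rep_eq_iff: "rep s = (rep t :: nat \<Rightarrow> 'k + 'a + 'b) \<longleftrightarrow> (\<forall>\<^sub>F n in F. s n = t n)"
proof
  assume *: "rep s = (rep t :: nat \<Rightarrow> 'k + 'a + 'b)"
  show "\<forall>\<^sub>F n in F. s n = t n"
    using pr_rep[of s, where 'a='a and 'b='b] pr_rep[of t, where 'a='a and 'b='b] unfolding *
    by eventually_elim simp
qed (rule rep_eqI)

definition UP :: "('f, 'r, nat \<Rightarrow> 'k + 'a + 'b) fo_struct" where
  "UP = \<lparr>Dom = range rep,
         fint = (\<lambda>f xs. rep (\<lambda>n. fint K f (map (\<lambda>x. pr x n) xs))),
         rint = (\<lambda>r xs. \<forall>\<^sub>F n in F. rint K r (map (\<lambda>x. pr x n) xs))\<rparr>"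

lemma rep_pr: "x \<in> Dom UP \<Longrightarrow> rep (pr x) = x"
  unfolding UP_def by (auto intro: rep_eqI pr_rep)

lemma is_struct_UP: "is_struct L UP"
  by (auto simp: is_struct_def UP_def)

lemma eval_tm_UP:
  "\<forall>\<^sub>F n in F. pr (eval_tm UP e t) n = eval_tm K (\<lambda>i. pr (e i) n) t"
proof (induction t)
  case (Fn f ts)
  have "\<forall>\<^sub>F n in F. \<forall>t\<in>set ts. pr (eval_tm UP e t) n = eval_tm K (\<lambda>i. pr (e i) n) t"
    using Fn by (intro eventually_ball_finite) auto
  moreover have "\<forall>\<^sub>F n in F. pr (eval_tm UP e (Fn f ts)) n =
      fint K f (map (\<lambda>x. pr x n) (map (eval_tm UP e) ts))"
    by (simp add: UP_def del: map_map) (rule pr_rep)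
  ultimately show ?case
  proof eventually_elim
    case (elim n)
    have "map (\<lambda>x. pr x n) (map (eval_tm UP e) ts) = map (eval_tm K (\<lambda>i. pr (e i) n)) ts"
      using elim(1) by auto
    then show ?case using elim(2) by (simp only: eval_tm.simps)
  qed
qed simp

text \<open>The ultrafilter property is what carries negation; for the existential quantifier a
  witness is chosen in each coordinate.\<close>

theorem los:
  assumes "range e \<subseteq> Dom UP"
  shows "sat UP e \<phi> \<longleftrightarrow> (\<forall>\<^sub>F n in F. sat K (\<lambda>i. pr (e i) n) \<phi>)"
  using assms
proof (induction \<phi> arbitrary: e)
  case (Eq s t)
  have D: "eval_tm UP e u \<in> Dom UP" for u
    using Eq by (cases u) (auto simp: UP_def)
  have "eval_tm UP e s = eval_tm UP e t \<longleftrightarrow>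
      rep (pr (eval_tm UP e s)) = (rep (pr (eval_tm UP e t)) :: nat \<Rightarrow> 'k + 'a + 'b)"
    by (simp add: rep_pr D)
  also have "\<dots> \<longleftrightarrow> (\<forall>\<^sub>F n in F. pr (eval_tm UP e s) n = pr (eval_tm UP e t) n)"
    by (rule rep_eq_iff)
  also have "\<dots> \<longleftrightarrow> (\<forall>\<^sub>F n in F. eval_tm K (\<lambda>i. pr (e i) n) s = eval_tm K (\<lambda>i. pr (e i) n) t)"
  proof (rule eventually_subst)
    show "\<forall>\<^sub>F n in F. (pr (eval_tm UP e s) n = pr (eval_tm UP e t) n) =
        (eval_tm K (\<lambda>i. pr (e i) n) s = eval_tm K (\<lambda>i. pr (e i) n) t)"
      using eval_tm_UP[of e s] eval_tm_UP[of e t] by eventually_elim simp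
  qed
  finally show ?case by simp
next
  case (Rel r ts)
  have "\<forall>\<^sub>F n in F. \<forall>t\<in>set ts. pr (eval_tm UP e t) n = eval_tm K (\<lambda>i. pr (e i) n) t"
    by (intro eventually_ball_finite) (auto intro: eval_tm_UP)
  then have "\<forall>\<^sub>F n in F. rint K r (map (\<lambda>x. pr x n) (map (eval_tm UP e) ts)) =
      rint K r (map (eval_tm K (\<lambda>i. pr (e i) n)) ts)"
  proof eventually_elim
    case (elim n)
    have "map (\<lambda>x. pr x n) (map (eval_tm UP e) ts) = map (eval_tm K (\<lambda>i. pr (e i) n)) ts"
      using elim by auto
    then show ?case by (simp only:)
  qed
  from eventually_subst[OF this] show ?case by (simp add: UP_def)
next
  case (Neg \<phi>)
  then show ?case by (simp add: ev_not)
next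
  case (Conj \<phi> \<psi>)
  then show ?case by (simp add: eventually_conj_iff)
next
  case (Exi i \<phi>)
  have 1: "sat UP (e(i := rep s)) \<phi> \<longleftrightarrow> (\<forall>\<^sub>F n in F. sat K ((\<lambda>j. pr (e j) n)(i := s n)) \<phi>)" for s
  proof -
    have "range (e(i := rep s)) \<subseteq> Dom UP" using Exi(2) by (auto simp: UP_def)
    then have "sat UP (e(i := rep s)) \<phi> \<longleftrightarrow>
        (\<forall>\<^sub>F n in F. sat K (\<lambda>j. pr ((e(i := rep s)) j) n) \<phi>)" by (rule Exi)
    moreover have "\<forall>\<^sub>F n in F. sat K (\<lambda>j. pr ((e(i := rep s)) j) n) \<phi> =
        sat K ((\<lambda>j. pr (e j) n)(i := s n)) \<phi>"
      using pr_rep[of s, where 'a='a and 'b='b]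
    proof eventually_elim
      case (elim n)
      then have "(\<lambda>j. pr ((e(i := rep s)) j) n) = (\<lambda>j. pr (e j) n)(i := s n)"
        by (simp add: fun_eq_iff)
      then show ?case by (simp only:)
    qed
    ultimately show ?thesis using eventually_subst[of "\<lambda>n. sat K (\<lambda>j. pr ((e(i := rep s)) j) n) \<phi>"
        "\<lambda>n. sat K ((\<lambda>j. pr (e j) n)(i := s n)) \<phi>" F] by simp
  qed
  have "sat UP e (Exi i \<phi>) \<longleftrightarrow> (\<exists>s. \<forall>\<^sub>F n in F. sat K ((\<lambda>j. pr (e j) n)(i := s n)) \<phi>)"
    by (simp add: 1[symmetric]) (auto simp: UP_def)
  also have "\<dots> \<longleftrightarrow> (\<forall>\<^sub>F n in F. \<exists>a. sat K ((\<lambda>j. pr (e j) n)(i := a)) \<phi>)"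
  proof
    assume *: "\<forall>\<^sub>F n in F. \<exists>a. sat K ((\<lambda>j. pr (e j) n)(i := a)) \<phi>"
    show "\<exists>s. \<forall>\<^sub>F n in F. sat K ((\<lambda>j. pr (e j) n)(i := s n)) \<phi>"
      by (rule exI[of _ "\<lambda>n. SOME a. sat K ((\<lambda>j. pr (e j) n)(i := a)) \<phi>"])
         (use * in eventually_elim, rule someI_ex)
  qed (auto elim: eventually_mono)
  finally show ?case by (simp add: Dom_K)
qed

lemma elem_equiv_UP: "elem_equiv L K UP"
  unfolding elem_equiv_def
proof (intro allI impI)
  fix \<phi> assume \<phi>: "wf_fm L \<phi> \<and> fv_fm \<phi> = {}"
  have K: "sat K e \<phi> = sat K e' \<phi>" for e e' by (rule sat_cong) (use \<phi> in simp)
  have "models K \<phi> \<longleftrightarrow> sat K (\<lambda>_. undefined) \<phi>"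
    unfolding models_def Dom_K using K by blast
  moreover have "sat UP e \<phi> \<longleftrightarrow> sat K (\<lambda>_. undefined) \<phi>" if "range e \<subseteq> Dom UP" for e
    using los[OF that, of \<phi>] K[of "\<lambda>i. pr (e i) _" "\<lambda>_. undefined"] F_proper by simp
  moreover have "range (\<lambda>_. rep (\<lambda>_. undefined)) \<subseteq> Dom UP" by (auto simp: UP_def)
  ultimately show "models K \<phi> \<longleftrightarrow> models UP \<phi>" unfolding models_def by blast
qed

lemma sat_UP_pr:
  assumes "range e \<subseteq> Dom UP" "\<And>i. \<forall>\<^sub>F n in F. pr (e i) n = s n i"
  shows "sat UP e \<phi> \<longleftrightarrow> (\<forall>\<^sub>F n in F. sat K (s n) \<phi>)"
proof -
  have "\<forall>\<^sub>F n in F. \<forall>i\<in>fv_fm \<phi>. pr (e i) n = s n i"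
    using assms(2) by (intro eventually_ball_finite finite_fv_fm) auto
  then have "\<forall>\<^sub>F n in F. sat K (\<lambda>i. pr (e i) n) \<phi> = sat K (s n) \<phi>"
    by eventually_elim (rule sat_cong, auto)
  then show ?thesis unfolding los[OF assms(1)] by (rule eventually_subst)
qed

end

section \<open>Counting in finite chains, roots of unity, prime powers\<close>

text \<open>A finite set covered by a chain is covered by a single member of it.\<close>

lemma chain_card:
  assumes "finite Z"
    and tot: "\<And>b b'. (\<forall>z. H b z \<longrightarrow> H b' z) \<or> (\<forall>z. H b' z \<longrightarrow> H b z)"
    and le: "\<And>b. P b \<Longrightarrow> card {z \<in> Z. H b z} \<le> N"
  shows "card {z \<in> Z. \<exists>b. P b \<and> H b z} \<le> N"
proof -
  have cover: "\<exists>b. P b \<and> (\<forall>z\<in>S. H b z)"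
    if "finite S" "S \<noteq> {}" "S \<subseteq> {z \<in> Z. \<exists>b. P b \<and> H b z}" for S
    using that
  proof (induction S rule: finite_ne_induct)
    case (insert x S)
    then obtain b b' where b: "P b" "\<forall>z\<in>S. H b z" "P b'" "H b' x" by auto
    from tot[of b b'] show ?case
    proof
      assume "\<forall>z. H b z \<longrightarrow> H b' z"
      then show ?thesis using b by (intro exI[of _ b']) simp
    next
      assume "\<forall>z. H b' z \<longrightarrow> H b z"
      then show ?thesis using b by (intro exI[of _ b]) simp
    qed
  qed auto
  show ?thesis
  proof (cases "{z \<in> Z. \<exists>b. P b \<and> H b z} = {}")
    case False
    then obtain b where b: "P b" "\<forall>z\<in>{z \<in> Z. \<exists>b. P b \<and> H b z}. H b z"
      using cover[OF _ False] assms(1) by auto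
    then have "card {z \<in> Z. \<exists>b. P b \<and> H b z} \<le> card {z \<in> Z. H b z}"
      using assms(1) by (intro card_mono) auto
    then show ?thesis using le[OF b(1)] by simp
  next
    case True
    show ?thesis unfolding True by simp
  qed
qed

text \<open>At most \<open>N\<close> points ever belong to a small member of the chain, and at most
  \<open>N\<close> are ever missed by a large one. On the remaining points all members are constant.
  Three of them are kept because the application discards one and compares the other two.\<close>

lemma chain_middle:
  assumes Z: "finite Z" "card Z = 2 * N + 3"
    and tot: "\<And>b b'. (\<forall>z. H b z \<longrightarrow> H b' z) \<or> (\<forall>z. H b' z \<longrightarrow> H b z)"
    and dich: "\<And>b. card {z \<in> Z. H b z} \<le> N \<or> card {z \<in> Z. \<not> H b z} \<le> N"
  shows "\<exists>T\<subseteq>Z. card T = 3 \<and> (\<forall>z\<in>T. \<forall>z'\<in>T. \<forall>b. H b z \<longleftrightarrow> H b z')"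
proof -
  define P where "P b \<longleftrightarrow> card {z \<in> Z. H b z} \<le> N" for b
  define S1 where "S1 = {z \<in> Z. \<exists>b. P b \<and> H b z}"
  define S2 where "S2 = {z \<in> Z. \<exists>b. \<not> P b \<and> \<not> H b z}"
  have "card S1 \<le> N"
    unfolding S1_def by (rule chain_card[OF Z(1) tot]) (simp add: P_def)
  moreover have "card S2 \<le> N"
    unfolding S2_def
  proof (rule chain_card[OF Z(1)])
    show "(\<forall>z. \<not> H b z \<longrightarrow> \<not> H b' z) \<or> (\<forall>z. \<not> H b' z \<longrightarrow> \<not> H b z)" for b b'
      using tot[of b b'] by auto
    show "card {z \<in> Z. \<not> H b z} \<le> N" if "\<not> P b" for b
      using dich[of b] that by (simp add: P_def)
  qed
  moreover have "card Z \<le> card (Z - (S1 \<union> S2)) + card S1 + card S2"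
  proof -
    have "Z = (Z - (S1 \<union> S2)) \<union> (S1 \<union> S2)" by (auto simp: S1_def S2_def)
    then have "card Z \<le> card (Z - (S1 \<union> S2)) + card (S1 \<union> S2)" using card_Un_le by metis
    also have "card (S1 \<union> S2) \<le> card S1 + card S2" by (rule card_Un_le)
    finally show ?thesis by simp
  qed
  ultimately have "3 \<le> card (Z - (S1 \<union> S2))" using Z(2) by linarith
  then obtain T where T: "T \<subseteq> Z - (S1 \<union> S2)" "card T = 3" "finite T"
    by (rule obtain_subset_with_card_n)
  have "H b z \<longleftrightarrow> \<not> P b" if "z \<in> T" for z b
    using T(1) that unfolding S1_def S2_def by blast
  then have "\<forall>z\<in>T. \<forall>z'\<in>T. \<forall>b. H b z \<longleftrightarrow> H b z'" by simp
  moreover have "T \<subseteq> Z" using T(1) by blast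
  ultimately show ?thesis using T(2) by (intro exI[of _ T] conjI)
qed

text \<open>A root of \<open>1 + X + ... + X^(q-1)\<close> is different from 1 because
  \<open>q\<close> is non-zero in the field.\<close>

lemma nontrivial_root_of_unity:
  assumes "prime q" "q \<noteq> CHAR('k::alg_closed_field)"
  shows "\<exists>\<zeta> :: 'k. \<zeta> ^ q = 1 \<and> \<zeta> \<noteq> 1"
proof -
  obtain m where m: "q = Suc m" "0 < m"
    using prime_gt_1_nat[OF assms(1)] by (cases q) auto
  obtain \<zeta> :: 'k where z: "(\<Sum>k\<le>m. 1 * \<zeta> ^ k) = 0"
    using alg_closed[of m "\<lambda>_. 1 :: 'k"] m(2) by auto
  have "\<zeta> \<noteq> 1"
  proof
    assume "\<zeta> = 1"
    then have "(of_nat q :: 'k) = 0" using z m(1) by simp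
    then have "CHAR('k) dvd q" by (simp add: of_nat_eq_0_iff_char_dvd)
    then show False using assms CHAR_not_1'[where 'a='k] prime_nat_iff by auto
  qed
  moreover have "1 - \<zeta> ^ Suc m = (1 - \<zeta>) * (\<Sum>k\<le>m. \<zeta> ^ k)"
    unfolding lessThan_Suc_atMost[symmetric] by (rule one_diff_power_eq)
  ultimately show ?thesis using z m(1) by auto
qed

lemma prime_power_if_unique_prime:
  assumes "0 < (b::nat)" "prime p" "\<And>q. prime q \<Longrightarrow> q dvd b \<Longrightarrow> q = p"
  shows "\<exists>m. b = p ^ m"
proof -
  obtain y where y: "b = p ^ multiplicity p b * y" "\<not> p dvd y"
    using multiplicity_decompose'[of b p] assms(1,2) by (metis not_prime_unit less_not_refl)
  have "y = 1"
  proof (rule ccontr)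
    assume "y \<noteq> 1"
    then obtain q where "prime q" "q dvd y" using prime_factor_nat by blast
    then show False using assms(3)[of q] y by (metis dvd_mult)
  qed
  then show ?thesis using y by auto
qed

section \<open>Algebraically closed valued fields\<close>

locale acvf =
  fixes v :: "'k::alg_closed_field \<Rightarrow> 'g::linordered_ab_group_add extended"
  assumes vf: "valued_field v"
begin

lemma v_0 [simp]: "v 0 = Pinf" and v_mult: "v (x * y) = v x + v y"
  and v_add_min: "min (v x) (v y) \<le> v (x + y)"
  using vf by (simp_all add: valued_field_def)

lemma v_fin: "x \<noteq> 0 \<Longrightarrow> \<exists>g. v x = Fin g"
proof -
  assume "x \<noteq> 0"
  then have "v x \<in> v ` (- {0})" by simp
  then show ?thesis using vf unfolding valued_field_def by auto
qed

lemma v_surj: "\<exists>x. x \<noteq> 0 \<and> v x = Fin g"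
proof -
  have "Fin g \<in> v ` (- {0})" using vf unfolding valued_field_def by simp
  then obtain x where "x \<in> - {0}" "v x = Fin g" by (metis imageE)
  then show ?thesis by auto
qed

lemma v_eq_Pinf [simp]: "v x = Pinf \<longleftrightarrow> x = 0"
  using v_fin[of x] by (cases "x = 0") auto

lemma v_less_nonzero: "v x < v y \<Longrightarrow> x \<noteq> 0"
  by auto

lemma v_1: "v 1 = Fin 0"
proof -
  obtain g where g: "v 1 = Fin g" using v_fin[of 1] by auto
  have "v 1 = v 1 + v 1" using v_mult[of 1 1] by simp
  then show ?thesis using g by simp
qed

lemma v_minus [simp]: "v (- x) = v x"
proof -
  obtain g where g: "v (- 1) = Fin g" using v_fin[of "- 1"] by auto
  have "v 1 = v (- 1) + v (- 1)" using v_mult[of "- 1" "- 1"] by simp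
  then have "g + g = 0" using g v_1 by simp
  then have "g = 0" by simp
  then have "v (- 1) = v 1" using g v_1 by simp
  then have "v (- 1 * x) = v (1 * x)" by (simp only: v_mult)
  then show ?thesis by simp
qed

lemma v_diff_commute: "v (x - y) = v (y - x)"
  using v_minus[of "x - y"] by simp

lemma v_mult_le_iff:
  assumes "z \<noteq> 0"
  shows "v (z * x) \<le> v (z * y) \<longleftrightarrow> v x \<le> v y"
proof -
  obtain g where g: "v z = Fin g" using v_fin[OF assms] by blast
  show ?thesis
  proof (cases "x = 0 \<or> y = 0")
    case True
    then show ?thesis using assms by auto
  next
    case False
    then obtain a b where "v x = Fin a" "v y = Fin b" using v_fin by blast
    then show ?thesis using g by (simp add: v_mult)
  qed
qed

lemma v_mult_less_iff: "z \<noteq> 0 \<Longrightarrow> v (z * x) < v (z * y) \<longleftrightarrow> v x < v y"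
  using v_mult_le_iff[of z y x] by (simp add: not_le[symmetric])

lemma v_mult_eq_iff: "z \<noteq> 0 \<Longrightarrow> v (z * x) = v (z * y) \<longleftrightarrow> v x = v y"
  using v_mult_le_iff[of z x y] v_mult_le_iff[of z y x] by (auto intro: antisym)

lemma v_mult_mono: "v x \<le> v x' \<Longrightarrow> v y \<le> v y' \<Longrightarrow> v (x * y) \<le> v (x' * y')"
  unfolding v_mult by (rule add_mono)

lemma v_mult_strict_mono:
  assumes "v x < v x'" "v y \<le> v y'" "y \<noteq> 0"
  shows "v (x * y) < v (x' * y')"
proof -
  have "v (x * y) < v (x' * y)" using v_mult_less_iff[OF assms(3)] assms(1) by (simp add: mult.commute)
  also have "\<dots> \<le> v (x' * y')" by (rule v_mult_mono) (use assms in auto)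
  finally show ?thesis .
qed

lemma v_power_mono: "v x \<le> v y \<Longrightarrow> v (x ^ n) \<le> v (y ^ n)"
  by (induction n) (auto intro: v_mult_mono)

lemma v_power_strict_mono:
  assumes "v x < v y" "0 < n"
  shows "v (x ^ n) < v (y ^ n)"
proof -
  obtain m where n: "n = Suc m" using assms(2) gr0_conv_Suc by blast
  show ?thesis unfolding n power_Suc
    by (rule v_mult_strict_mono) (use assms v_power_mono[of x y] v_less_nonzero in auto)
qed

lemma v_power_less_iff: "0 < n \<Longrightarrow> v (x ^ n) < v (y ^ n) \<longleftrightarrow> v x < v y"
  using v_power_strict_mono v_power_mono[of y x n] by (meson not_le)

lemma v_power_le_iff: "0 < n \<Longrightarrow> v (x ^ n) \<le> v (y ^ n) \<longleftrightarrow> v x \<le> v y"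
  using v_power_less_iff[of n y x] by (simp add: not_less[symmetric])

lemma v_power_eq_iff: "0 < n \<Longrightarrow> v (x ^ n) = v (y ^ n) \<longleftrightarrow> v x = v y"
  using v_power_le_iff[of n x y] v_power_le_iff[of n y x] by (auto intro: antisym)

lemma v_inverse_le_iff:
  assumes "x \<noteq> 0" "y \<noteq> 0"
  shows "v (inverse x) \<le> v (inverse y) \<longleftrightarrow> v y \<le> v x"
  using v_mult_le_iff[of "x * y" "inverse x" "inverse y"] assms by (simp add: field_simps)

lemma v_inverse_less_iff: "x \<noteq> 0 \<Longrightarrow> y \<noteq> 0 \<Longrightarrow> v (inverse x) < v (inverse y) \<longleftrightarrow> v y < v x"
  using v_inverse_le_iff[of y x] by (simp add: not_le[symmetric])

lemma v_divide_eq_iff: "y \<noteq> 0 \<Longrightarrow> v (x / y) = v z \<longleftrightarrow> v x = v (z * y)"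
  using v_mult_eq_iff[of y "x / y" z] by (simp add: mult.commute)

lemma v_divide_le_iff: "y \<noteq> 0 \<Longrightarrow> v (x / y) \<le> v z \<longleftrightarrow> v x \<le> v (z * y)"
  using v_mult_le_iff[of y "x / y" z] by (simp add: mult.commute)

lemma v_le_divide_iff: "y \<noteq> 0 \<Longrightarrow> v z \<le> v (x / y) \<longleftrightarrow> v (z * y) \<le> v x"
  using v_mult_le_iff[of y z "x / y"] by (simp add: mult.commute)

lemma v_diff_ge: "c \<le> v x \<Longrightarrow> c \<le> v y \<Longrightarrow> c \<le> v (x - y)"
  using v_add_min[of x "- y"] by (auto simp: min_def split: if_splits)

lemma v_diff_gt: "c < v x \<Longrightarrow> c < v y \<Longrightarrow> c < v (x - y)"
  using v_add_min[of x "- y"] by (auto simp: min_def split: if_splits)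

lemma v_diff_left:
  assumes "v x < v y"
  shows "v (x - y) = v x"
proof (rule antisym)
  show "v x \<le> v (x - y)" by (rule v_diff_ge) (use assms in auto)
  show "v (x - y) \<le> v x"
  proof (rule ccontr)
    assume "\<not> v (x - y) \<le> v x"
    then have "v x < v (x - y - (- y))" by (intro v_diff_gt[of _ "x - y" "- y"]) (use assms in simp_all)
    then show False by simp
  qed
qed

lemma v_diff_right: "v y < v x \<Longrightarrow> v (x - y) = v y"
  using v_diff_left[of y x] by (simp add: v_diff_commute)

lemma v_triangle: "c \<le> v (x - y) \<Longrightarrow> c \<le> v (y - z) \<Longrightarrow> c \<le> v (x - z)"
  using v_diff_ge[of c "x - y" "z - y"] by (simp add: v_diff_commute)

lemma v_triangle_less: "c < v (x - y) \<Longrightarrow> c < v (y - z) \<Longrightarrow> c < v (x - z)"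
  using v_diff_gt[of c "x - y" "z - y"] by (simp add: v_diff_commute)

lemma nth_root: "0 < n \<Longrightarrow> \<exists>y. y ^ n = (x::'k)"
  using nth_root_exists[of n x] by auto

lemma v_unbounded_below: obtains x where "x \<noteq> 0" "v x < v c"
proof -
  obtain t where t: "t \<noteq> 0" "v t \<noteq> v 1"
    using vf v_1 unfolding valued_field_def zero_extended_def by auto
  define s where "s = (if v t < v 1 then t else inverse t)"
  have s: "s \<noteq> 0" "v s < v 1"
    using t v_inverse_less_iff[of t 1] by (auto simp: s_def)
  show thesis
  proof (cases "c = 0")
    case True
    then show thesis using that[of 1] v_1 by simp
  next
    case False
    have "v (c * s) < v (c * 1)" using v_mult_less_iff[OF False] s(2) by blast
    then show thesis using that[of "c * s"] s False by simp
  qed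
qed

lemma v_unbounded_above:
  assumes "c \<noteq> 0"
  obtains x where "x \<noteq> 0" "v c < v x"
proof -
  obtain y where "y \<noteq> 0" "v y < v (inverse c)" by (rule v_unbounded_below)
  then show thesis using that[of "inverse y"] v_inverse_less_iff[of "inverse y" c] assms by simp
qed

text \<open>The midpoint of two values is the value of a square root of the product.\<close>

lemma v_dense:
  assumes "v a < v b"
  obtains c where "c \<noteq> 0" "v a < v c" "v c < v b"
proof (cases "b = 0")
  case True
  obtain x where "x \<noteq> 0" "v a < v x" using v_unbounded_above v_less_nonzero[OF assms] by blast
  moreover have "v x < v b" using \<open>x \<noteq> 0\<close> v_fin[of x] True by auto
  ultimately show thesis by (rule that)
next
  case False
  note a = v_less_nonzero[OF assms]
  obtain c where c: "c ^ 2 = a * b" using nth_root[of 2 "a * b"] by auto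
  have "v (a ^ 2) < v (c ^ 2)" "v (c ^ 2) < v (b ^ 2)"
    unfolding c using v_mult_less_iff[OF a, of a b] v_mult_less_iff[OF False, of a b] assms
    by (simp_all add: mult.commute power2_eq_square)
  then have "v a < v c" "v c < v b" by (simp_all add: v_power_less_iff)
  then show thesis using that v_less_nonzero by blast
qed

text \<open>\<open>\<Prod>(X - a) + 1\<close> has a root, and no integral \<open>a\<close> is congruent to it.\<close>

lemma fresh_residue:
  assumes "finite A"
  obtains z where "v z = v 1" "\<And>a. a \<in> A \<Longrightarrow> v (z - a) \<le> v 1"
proof -
  \<comment> \<open>The element 0 forces the root to be a unit. Non-integral elements of
    \<open>A\<close> are left out: they are far from every integral element anyway.\<close>
  define B where "B = insert 0 {a \<in> A. v 1 \<le> v a}"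
  have B: "finite B" "0 \<in> B" "\<And>b. b \<in> B \<Longrightarrow> v 1 \<le> v b"
    using assms by (auto simp: B_def)
  define q where "q = (\<Prod>b\<in>B. [:- b, 1:]) + 1"
  have deg: "degree (\<Prod>b\<in>B. [:- b, 1:]) = card B"
    by (subst degree_prod_eq_sum_degree) simp_all
  moreover have "card B > 0" using B by (auto simp: card_gt_0_iff)
  ultimately have "degree q > 0" unfolding q_def by (simp add: degree_add_eq_left)
  then obtain z where "poly q z = 0" using alg_closed_imp_poly_has_root by blast
  then have z: "(\<Prod>b\<in>B. z - b) = - 1"
    by (simp add: q_def poly_prod algebra_simps eq_neg_iff_add_eq_0)
  have int: "v 1 \<le> v z"
  proof (rule ccontr)
    assume *: "\<not> v 1 \<le> v z"
    have zb: "v (z - b) < v 1" if "b \<in> B" for b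
    proof -
      have "v z < v b" using * B(3)[OF that] by auto
      then show ?thesis using v_diff_left[of z b] * by simp
    qed
    have "v (\<Prod>b\<in>C. z - b) < v 1" if "finite C" "C \<noteq> {}" "C \<subseteq> B" for C
      using that
    proof (induction C rule: finite_ne_induct)
      case (singleton x)
      then show ?case using zb by simp
    next
      case (insert x C)
      then have "v ((z - x) * (\<Prod>b\<in>C. z - b)) < v (1 * 1)"
        by (intro v_mult_strict_mono) (use insert zb v_less_nonzero in \<open>auto intro: less_imp_le\<close>)
      then show ?case using insert by simp
    qed
    from this[of B] B z show False by auto
  qed
  \<comment> \<open>All factors are integral and their product is a unit, so each factor is a
    unit.\<close>
  have zb: "v (z - b) = v 1" if b: "b \<in> B" for b
  proof (rule antisym)
    have int': "v 1 \<le> v (z - c)" if "c \<in> B" for c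
      by (rule v_diff_ge[OF int B(3)[OF that]])
    show "v 1 \<le> v (z - b)" by (rule int'[OF b])
    show "v (z - b) \<le> v 1"
    proof (rule ccontr)
      assume *: "\<not> v (z - b) \<le> v 1"
      have "v 1 \<le> v (\<Prod>c\<in>C. z - c)" if "finite C" "C \<subseteq> B" for C
        using that
      proof (induction C rule: finite_induct)
        case (insert x C)
        then have "v (1 * 1) \<le> v ((z - x) * (\<Prod>c\<in>C. z - c))"
          by (intro v_mult_mono int') auto
        then show ?case using insert by simp
      qed simp
      then have "v 1 \<le> v (\<Prod>c\<in>B - {b}. z - c)" using B by simp
      then have "v (1 * 1) < v ((z - b) * (\<Prod>c\<in>B - {b}. z - c))"
        by (intro v_mult_strict_mono) (use * in auto)
      also have "(z - b) * (\<Prod>c\<in>B - {b}. z - c) = - 1"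
        using z B b by (simp add: prod.remove[of B b])
      finally show False by simp
    qed
  qed
  show thesis
  proof (rule that[of z])
    show "v z = v 1" using zb[OF B(2)] by simp
    fix a assume "a \<in> A"
    show "v (z - a) \<le> v 1"
    proof (cases "v 1 \<le> v a")
      case True
      then show ?thesis using zb[of a] \<open>a \<in> A\<close> by (simp add: B_def)
    next
      case False
      then have "v (z - a) = v a" using int by (intro v_diff_right) auto
      then show ?thesis using False by simp
    qed
  qed
qed

text \<open>\<open>req x y\<close> says that \<open>x\<close> and \<open>y\<close> are non-zero with the same class in \<open>RV\<close>.\<close>

definition req :: "'k \<Rightarrow> 'k \<Rightarrow> bool" where
  "req x y \<longleftrightarrow> v y < v (x - y)"

lemma req_v: "req x y \<Longrightarrow> v x = v y"
  unfolding req_def using v_diff_left[of y "y - x"] by (simp add: v_diff_commute)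

lemma req_nonzero: "req x y \<Longrightarrow> x \<noteq> 0 \<and> y \<noteq> 0"
  using req_v[of x y] v_less_nonzero[of y "x - y"] by (auto simp: req_def)

lemma req_refl: "x \<noteq> 0 \<Longrightarrow> req x x"
  unfolding req_def using v_fin[of x] by auto

lemma req_sym: "req x y \<Longrightarrow> req y x"
  using req_v[of x y] unfolding req_def by (simp add: v_diff_commute)

lemma req_trans: "req x y \<Longrightarrow> req y z \<Longrightarrow> req x z"
  using req_v[of y z] v_triangle_less[of "v z" x y z] unfolding req_def by simp

lemma req_mult_left: "z \<noteq> 0 \<Longrightarrow> req (z * x) (z * y) \<longleftrightarrow> req x y"
  unfolding req_def using v_mult_less_iff[of z y "x - y"] by (simp add: algebra_simps)

lemma req_mult:
  assumes "req x y" "req x' y'"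
  shows "req (x * x') (y * y')"
proof (rule req_trans)
  show "req (x * x') (x * y')" using assms req_nonzero req_mult_left by blast
  show "req (x * y') (y * y')"
    using req_mult_left[of y' x y] assms req_nonzero by (simp add: mult.commute)
qed

lemma req_power: "req x y \<Longrightarrow> req (x ^ n) (y ^ n)"
  by (induction n) (auto intro: req_mult req_refl)

lemma req_inverse:
  assumes "req x y"
  shows "req (inverse x) (inverse y)"
  using req_mult_left[of "x * y" "inverse x" "inverse y"] req_sym[OF assms] req_nonzero[OF assms]
  by (simp add: field_simps)

lemma req_divide: "req x y \<Longrightarrow> req x' y' \<Longrightarrow> req (x / x') (y / y')"
  unfolding divide_inverse by (intro req_mult req_inverse)

section \<open>Neighborhoods of infinity\<close>

text \<open>Thresholds are values of non-zero field elements, so that quantifying over neighborhoods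
  of infinity stays definable.\<close>

definition at_inf :: "'k filter" where
  "at_inf = (INF c\<in>- {0}. principal {x. v x < v c})"

lemma eventually_at_inf: "eventually P at_inf \<longleftrightarrow> (\<exists>c. c \<noteq> 0 \<and> (\<forall>x. v x < v c \<longrightarrow> P x))"
proof -
  have "eventually P at_inf \<longleftrightarrow> (\<exists>c\<in>- {0}. eventually P (principal {x. v x < v c}))"
    unfolding at_inf_def
  proof (rule eventually_INF_base)
    fix a b :: 'k assume "a \<in> - {0}" "b \<in> - {0}"
    then show "\<exists>x\<in>- {0}. principal {y. v y < v x}
        \<le> inf (principal {x. v x < v a}) (principal {x. v x < v b})"
      by (intro bexI[of _ "if v a \<le> v b then a else b"]) auto
  next
    have "1 \<in> - {0 :: 'k}" by simp
    then show "- {0 :: 'k} \<noteq> {}" by blast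
  qed
  then show ?thesis by (simp add: eventually_principal Bex_def)
qed

lemma at_inf_neq_bot: "at_inf \<noteq> bot"
  unfolding trivial_limit_def eventually_at_inf using v_unbounded_below by blast

lemma at_inf_ex: "eventually P at_inf \<Longrightarrow> \<exists>x. P x"
  using at_inf_neq_bot eventually_happens by blast

lemma eventually_at_infI: "c \<noteq> 0 \<Longrightarrow> (\<And>x. v x < v c \<Longrightarrow> P x) \<Longrightarrow> eventually P at_inf"
  unfolding eventually_at_inf by blast

lemma eventually_at_inf_less: "c \<noteq> 0 \<Longrightarrow> \<forall>\<^sub>F x in at_inf. v x < v c"
  by (rule eventually_at_infI)

lemma eventually_at_inf_nonzero: "\<forall>\<^sub>F x in at_inf. x \<noteq> 0"
  by (rule eventually_at_infI[of 1]) (auto dest: v_less_nonzero)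

lemma at_inf_scale:
  assumes "eventually P at_inf" "t \<noteq> 0"
  shows "\<forall>\<^sub>F x in at_inf. P (t * x)"
proof -
  obtain c where c: "c \<noteq> 0" "\<And>x. v x < v c \<Longrightarrow> P x" using assms unfolding eventually_at_inf by blast
  show ?thesis
  proof (rule eventually_at_infI[of "c / t"])
    fix x assume "v x < v (c / t)"
    then have "v (t * x) < v (t * (c / t))" using v_mult_less_iff[OF assms(2)] by blast
    then show "P (t * x)" using c(2) assms(2) by simp
  qed (use c assms in simp)
qed

text \<open>The field is algebraically closed, so the power map is onto, and it is strictly monotone
  in the value. This is how statements about \<open>y^n\<close> and about \<open>x\<close> are
  exchanged.\<close>

lemma at_inf_power_iff:
  assumes "0 < n"
  shows "(\<forall>\<^sub>F x in at_inf. P (x ^ n)) \<longleftrightarrow> eventually P at_inf"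
proof
  assume "eventually P at_inf"
  then obtain c where c: "c \<noteq> 0" "\<And>x. v x < v c \<Longrightarrow> P x" unfolding eventually_at_inf by blast
  obtain b where b: "b ^ n = c" using nth_root[OF assms] by blast
  show "\<forall>\<^sub>F x in at_inf. P (x ^ n)"
  proof (rule eventually_at_infI[of b])
    show "b \<noteq> 0" using b c(1) assms by auto
    show "v x < v b \<Longrightarrow> P (x ^ n)" for x
      using c(2)[of "x ^ n"] v_power_less_iff[OF assms, of x b] b by simp
  qed
next
  assume "\<forall>\<^sub>F x in at_inf. P (x ^ n)"
  then obtain c where c: "c \<noteq> 0" "\<And>x. v x < v c \<Longrightarrow> P (x ^ n)" unfolding eventually_at_inf by blast
  show "eventually P at_inf"
  proof (rule eventually_at_infI[of "c ^ n"])
    fix x assume "v x < v (c ^ n)"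
    moreover obtain y where "y ^ n = x" using nth_root[OF assms] by blast
    ultimately show "P x" using c(2)[of y] v_power_less_iff[OF assms, of y c] by auto
  qed (use c in simp)
qed

section \<open>Residue classes and units\<close>

text \<open>The residue field is infinite: after division by \<open>d\<close>, a residue class
  different from those already chosen always exists.\<close>

lemma ex_inequivalent:
  assumes "d \<noteq> 0"
  shows "\<exists>Z. finite Z \<and> card Z = M \<and> (\<forall>z\<in>Z. v z = v d) \<and>
    (\<forall>z\<in>Z. \<forall>z'\<in>Z. z \<noteq> z' \<longrightarrow> v (z - z') \<le> v d)"
proof (induction M)
  case 0
  show ?case by (rule exI[of _ "{}"]) simp
next
  case (Suc M)
  then obtain Z where Z: "finite Z" "card Z = M" "\<forall>z\<in>Z. v z = v d"
    "\<forall>z\<in>Z. \<forall>z'\<in>Z. z \<noteq> z' \<longrightarrow> v (z - z') \<le> v d" by blast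
  obtain t where t: "v t = v 1" "\<And>a. a \<in> (\<lambda>z. z / d) ` Z \<Longrightarrow> v (t - a) \<le> v 1"
    using fresh_residue[of "(\<lambda>z. z / d) ` Z"] Z(1) by blast
  have far: "v (d * t - z) \<le> v d" if "z \<in> Z" for z
  proof -
    have "v (d * (t - z / d)) \<le> v (d * 1)"
      using v_mult_le_iff[OF assms] t(2) that by blast
    then show ?thesis using assms by (simp add: algebra_simps)
  qed
  have new: "d * t \<notin> Z" using far[of "d * t"] v_fin[OF assms] by auto
  have vt: "v (d * t) = v d" using v_mult_eq_iff[OF assms, of t 1] t(1) by simp
  have far': "v (z - d * t) \<le> v d" if "z \<in> Z" for z
    using far[OF that] by (simp add: v_diff_commute)
  show ?case
    by (rule exI[of _ "insert (d * t) Z"]) (use Z new vt far far' in auto)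
qed

text \<open>An open ball of radius \<open>v d\<close> contains at most one element of
  \<open>Z\<close>, so assigning to each hit point a nearby center is injective.\<close>

lemma card_hits:
  assumes "finite A" "finite Z" "\<And>z z'. z \<in> Z \<Longrightarrow> z' \<in> Z \<Longrightarrow> z \<noteq> z' \<Longrightarrow> v (z - z') \<le> v d"
  shows "card {z \<in> Z. \<exists>a\<in>A. v d < v (z - a)} \<le> card A"
proof -
  define g where "g z = (SOME a. a \<in> A \<and> v d < v (z - a))" for z
  have g: "g z \<in> A \<and> v d < v (z - g z)" if "\<exists>a\<in>A. v d < v (z - a)" for z
    unfolding g_def by (rule someI_ex) (use that in blast)
  show ?thesis
  proof (rule card_inj_on_le[of g])
    show "g ` {z \<in> Z. \<exists>a\<in>A. v d < v (z - a)} \<subseteq> A" using g by blast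
    show "inj_on g {z \<in> Z. \<exists>a\<in>A. v d < v (z - a)}"
    proof (rule inj_onI)
      fix z z'
      assume z: "z \<in> {z \<in> Z. \<exists>a\<in>A. v d < v (z - a)}" "z' \<in> {z \<in> Z. \<exists>a\<in>A. v d < v (z - a)}"
        and eq: "g z = g z'"
      have "v d < v (z - g z)" "v d < v (g z - z')"
        using g[of z] g[of z'] z eq by (auto simp: v_diff_commute)
      then have "v d < v (z - z')" by (rule v_triangle_less)
      then show "z = z'" using assms(3)[of z z'] z by force
    qed
  qed (use assms in simp)
qed

lemma ex_unhit:
  assumes "finite A" "finite Z" "\<And>z z'. z \<in> Z \<Longrightarrow> z' \<in> Z \<Longrightarrow> z \<noteq> z' \<Longrightarrow> v (z - z') \<le> v d"
    and "card A < card Z"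
  shows "\<exists>z\<in>Z. \<forall>a\<in>A. v (z - a) \<le> v d"
proof (rule ccontr)
  assume "\<not> ?thesis"
  then have "{z \<in> Z. \<exists>a\<in>A. v d < v (z - a)} = Z" by (auto simp: not_le)
  then show False using card_hits[OF assms(1-3)] assms(4) by simp
qed

text \<open>For units, \<open>t / s\<close> is congruent to \<open>a\<close> exactly if
  \<open>s\<close> is congruent to \<open>t / a\<close>. So it suffices that \<open>s\<close> avoids
  both \<open>A\<close> and the quotients \<open>t / a\<close>.\<close>

lemma unit_factor:
  assumes "finite A" "v t = v 1"
  obtains s where "v s = v 1" "v (t / s) = v 1" "\<And>a. a \<in> A \<Longrightarrow> v (s - a) \<le> v 1"
    "\<And>a. a \<in> A \<Longrightarrow> v (t / s - a) \<le> v 1"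
proof -
  obtain s where s: "v s = v 1" "\<And>a. a \<in> A \<union> (\<lambda>a. t / a) ` A \<Longrightarrow> v (s - a) \<le> v 1"
    using fresh_residue[of "A \<union> (\<lambda>a. t / a) ` A"] assms(1) by blast
  have s0: "s \<noteq> 0" using s(1) v_eq_Pinf[of s] v_1 by auto
  have ts: "v (t / s) = v 1" using v_divide_eq_iff[OF s0, of t 1] s(1) assms(2) by simp
  have "v (t / s - a) \<le> v 1" if a: "a \<in> A" for a
  proof (rule ccontr)
    assume *: "\<not> v (t / s - a) \<le> v 1"
    then have "req (t / s) a \<or> v a = v 1"
      using ts v_diff_left[of "t / s" a] v_diff_right[of a "t / s"]
      by (metis linorder_neqE not_le order.irrefl)
    then have va: "v a = v 1" using req_v ts by auto
    then have a0: "a \<noteq> 0" using v_eq_Pinf[of a] v_1 by auto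
    have "s * (t / s - a) = a * (t / a - s)" using s0 a0 by (simp add: field_simps)
    moreover have "v (a * (t / a - s)) = v (s * (t / a - s))" using va s(1) by (simp add: v_mult)
    ultimately have "v (s * (t / s - a)) = v (s * (t / a - s))" by simp
    then have "v (t / s - a) = v (t / a - s)" unfolding v_mult_eq_iff[OF s0] .
    moreover have "v (s - t / a) \<le> v 1" by (rule s(2)) (use a in blast)
    ultimately show False using * by (simp add: v_diff_commute)
  qed
  then show thesis using that[of s] s ts by blast
qed

text \<open>Being far from the finitely many points of \<open>A\<close> is a generic condition on
  units, and every unit is a product of two generic ones.\<close>

lemma units_generate:
  assumes "finite A" "\<And>t. v t = v 1 \<Longrightarrow> (\<And>a. a \<in> A \<Longrightarrow> v (t - a) \<le> v 1) \<Longrightarrow> P t"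
    and "\<And>s t. v s = v 1 \<Longrightarrow> v t = v 1 \<Longrightarrow> P s \<Longrightarrow> P t \<Longrightarrow> P (s * t)" and "v t = v 1"
  shows "P t"
proof -
  obtain s where s: "v s = v 1" "v (t / s) = v 1" "\<And>a. a \<in> A \<Longrightarrow> v (s - a) \<le> v 1"
    "\<And>a. a \<in> A \<Longrightarrow> v (t / s - a) \<le> v 1"
    using unit_factor[OF assms(1,4)] by blast
  have "P (s * (t / s))" by (intro assms(3) assms(2) s)
  moreover have "s \<noteq> 0" using s(1) v_eq_Pinf[of s] v_1 by auto
  ultimately show ?thesis by simp
qed

lemma ex_min_v:
  assumes "finite S" "S \<noteq> {}"
  obtains s where "s \<in> S" "\<And>t. t \<in> S \<Longrightarrow> v s \<le> v t"
proof -
  have "Min (v ` S) \<in> v ` S" using assms by simp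
  then obtain s where "s \<in> S" "v s = Min (v ` S)" by (metis imageE)
  then show thesis using that[of s] assms by simp
qed

lemma ex_max_v:
  assumes "finite S" "S \<noteq> {}"
  obtains s where "s \<in> S" "\<And>t. t \<in> S \<Longrightarrow> v t \<le> v s"
proof -
  have "Max (v ` S) \<in> v ` S" using assms by simp
  then obtain s where "s \<in> S" "v s = Max (v ` S)" by (metis imageE)
  then show thesis using that[of s] assms by simp
qed

lemma at_inf_powerI: "0 < n \<Longrightarrow> eventually P at_inf \<Longrightarrow> \<forall>\<^sub>F x in at_inf. P (x ^ n)"
  by (simp only: at_inf_power_iff)

lemma at_inf_powerD: "0 < n \<Longrightarrow> \<forall>\<^sub>F x in at_inf. P (x ^ n) \<Longrightarrow> eventually P at_inf"
  by (simp only: at_inf_power_iff)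

lemma v_powi:
  assumes "x \<noteq> 0" "v x = Fin \<gamma>"
  shows "v (x powi k) = Fin (zmult k \<gamma>)"
proof -
  have pow: "v (x ^ n) = Fin (\<Sum>i<n. \<gamma>)" for n
    by (induction n) (use assms in \<open>simp_all add: v_1 v_mult add.commute\<close>)
  show ?thesis
  proof (cases "0 \<le> k")
    case True
    then show ?thesis using pow by (simp add: power_int_def zmult_def)
  next
    case False
    let ?n = "nat (- k)"
    have "v (inverse x ^ ?n) + v (x ^ ?n) = Fin 0"
      unfolding v_mult[symmetric] using assms(1) v_1 by (simp add: power_mult_distrib[symmetric])
    moreover obtain g where g: "v (inverse x ^ ?n) = Fin g" using v_fin[of "inverse x ^ ?n"] assms(1) by auto
    ultimately have "g = - (\<Sum>i<?n. \<gamma>)" using pow[of ?n] by (simp add: eq_neg_iff_add_eq_0)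
    then show ?thesis using False g by (simp add: power_int_def zmult_def)
  qed
qed

section \<open>The group RV and powers with exponent \<open>n / p^m\<close>\<close>

lemma one_units_eq: "one_units v = {s. req s 1}"
proof -
  have "s = 1 + (s - 1)" for s :: 'k by simp
  then show ?thesis unfolding one_units_def req_def v_1 zero_extended_def by (auto intro: exI[of _ "_ - 1"])
qed

lemma req_1_divide: "y \<noteq> 0 \<Longrightarrow> req (x / y) 1 \<longleftrightarrow> req x y"
  using req_mult_left[of y "x / y" 1] by simp

lemma rv_eq: "x \<noteq> 0 \<Longrightarrow> rv v x = {y. req y x}"
proof -
  assume x: "x \<noteq> 0"
  have "{y. req y x} = (\<Union>h\<in>{s. req s 1}. {h * x})"
  proof (intro equalityI subsetI)
    fix y assume "y \<in> {y. req y x}"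
    then have "req (y / x) 1" "y = y / x * x" using req_1_divide[OF x] x by simp_all
    then show "y \<in> (\<Union>h\<in>{s. req s 1}. {h * x})" by blast
  next
    fix y assume "y \<in> (\<Union>h\<in>{s. req s 1}. {h * x})"
    then obtain h where "req h 1" "y = h * x" by blast
    then show "y \<in> {y. req y x}" using req_1_divide[OF x, of y] x by simp
  qed
  then show ?thesis using x by (simp add: rv_def r_coset_def one_units_eq mult_grp_def)
qed

lemma rv_eq_iff:
  assumes "x \<noteq> 0" "y \<noteq> 0"
  shows "rv v x = rv v y \<longleftrightarrow> req x y"
proof
  assume "rv v x = rv v y"
  then show "req x y" using assms req_refl[of x] by (auto simp: rv_eq)
next
  assume xy: "req x y"
  have "req s x \<longleftrightarrow> req s y" for s
    using req_trans[of s x y] req_trans[of s y x] xy req_sym[OF xy] by blast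
  then show "rv v x = rv v y" using assms by (simp add: rv_eq)
qed

lemma comm_group_mult_grp: "comm_group (mult_grp :: 'k monoid)"
  by (rule comm_groupI) (auto simp: mult_grp_def mult_ac intro!: bexI[of _ "inverse _"])

lemma normal_one_units: "one_units v \<lhd> mult_grp"
proof -
  interpret comm_group "mult_grp :: 'k monoid" by (rule comm_group_mult_grp)
  have inv: "inv\<^bsub>mult_grp\<^esub> x = inverse x" if "x \<noteq> 0" for x :: 'k
    using inv_equality[of "inverse x" x] that by (simp add: mult_grp_def)
  have "subgroup (one_units v) mult_grp"
  proof (rule subgroupI)
    show "one_units v \<subseteq> carrier mult_grp"
      using req_nonzero by (auto simp: one_units_eq mult_grp_def)
    show "one_units v \<noteq> {}" using req_refl[of 1] by (auto simp: one_units_eq)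
    show "inv\<^bsub>mult_grp\<^esub> a \<in> one_units v" if "a \<in> one_units v" for a
      using that req_nonzero[of a 1] req_inverse[of a 1] by (simp add: one_units_eq inv)
    show "a \<otimes>\<^bsub>mult_grp\<^esub> b \<in> one_units v" if "a \<in> one_units v" "b \<in> one_units v" for a b
      using that req_mult[of a 1 b 1] by (simp add: one_units_eq mult_grp_def)
  qed
  then show ?thesis by (simp add: normal_iff_subgroup)
qed

lemma group_hom_rv: "group_hom mult_grp (RVs v) (rv v)"
proof -
  interpret normal "one_units v" "mult_grp :: 'k monoid" by (rule normal_one_units)
  have grp: "group (RVs v)" unfolding RVs_def by (rule factorgroup_is_group)
  have h: "(\<lambda>a. one_units v #>\<^bsub>mult_grp\<^esub> a) \<in> hom mult_grp (RVs v)"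
    unfolding RVs_def by (rule r_coset_hom_Mod)
  have eq: "rv v a = one_units v #>\<^bsub>mult_grp\<^esub> a" if "a \<in> carrier mult_grp" for a
    using that by (simp add: rv_def mult_grp_def)
  have "rv v \<in> hom mult_grp (RVs v)"
    by (rule homI) (simp_all add: eq hom_in_carrier[OF h] hom_mult[OF h])
  then show ?thesis using grp is_group by (simp add: group_hom_def group_hom_axioms_def)
qed

lemma mult_grp_nat_pow: "x [^]\<^bsub>mult_grp\<^esub> (n::nat) = (x::'k) ^ n"
proof -
  interpret comm_group "mult_grp :: 'k monoid" by (rule comm_group_mult_grp)
  show ?thesis
    by (induction n) (simp_all add: nat_pow_Suc mult_grp_def mult.commute)
qed

lemma mult_grp_int_pow:
  assumes "x \<noteq> (0::'k)"
  shows "x [^]\<^bsub>mult_grp\<^esub> (k::int) = x powi k"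
proof -
  interpret comm_group "mult_grp :: 'k monoid" by (rule comm_group_mult_grp)
  have "inv\<^bsub>mult_grp\<^esub> y = inverse y" if "y \<noteq> 0" for y :: 'k
    using inv_equality[of "inverse y" y] that by (simp add: mult_grp_def)
  then show ?thesis
    using assms by (simp add: int_pow_def2 power_int_def mult_grp_nat_pow power_inverse)
qed

lemma carrier_RVs: "carrier (RVs v) = rv v ` (- {0})"
  by (auto simp: RVs_def FactGroup_def RCOSETS_def mult_grp_def rv_def)

lemma RVs_mult: "x \<noteq> 0 \<Longrightarrow> y \<noteq> 0 \<Longrightarrow> rv v x \<otimes>\<^bsub>RVs v\<^esub> rv v y = rv v (x * y)"
  using group_hom.hom_mult[OF group_hom_rv, of x y] by (simp add: mult_grp_def)

lemma RVs_nat_pow: "x \<noteq> 0 \<Longrightarrow> rv v x [^]\<^bsub>RVs v\<^esub> (n::nat) = rv v (x ^ n)"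
  using group_hom.hom_nat_pow[OF group_hom_rv, of x n] mult_grp_nat_pow[of x n]
  by (simp add: mult_grp_def)

lemma RVs_int_pow: "x \<noteq> 0 \<Longrightarrow> rv v x [^]\<^bsub>RVs v\<^esub> (n::int) = rv v (x powi n)"
  using group_hom.hom_int_pow[OF group_hom_rv, of x n] mult_grp_int_pow[of x n]
  by (simp add: mult_grp_def)

lemma diff_power_char_exp: "(x - y :: 'k) ^ (char_exp TYPE('k) ^ m) =
    x ^ (char_exp TYPE('k) ^ m) - y ^ (char_exp TYPE('k) ^ m)"
proof (cases "CHAR('k) = 0")
  case True
  then show ?thesis by (simp add: char_exp_def)
next
  case False
  then have "prime CHAR('k)" by (intro prime_CHAR_semidom) simp
  from freshmans_dream'[OF this refl, of "x - y" y m] False show ?thesis by (simp add: char_exp_def)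
qed

lemma char_exp_pos: "0 < char_exp TYPE('k)"
  by (simp add: char_exp_def)

text \<open>In an algebraically closed field every base has the form \<open>y ^ (p ^ m)\<close>,
  which makes the fractional power explicit. Uniqueness is the additivity of the Frobenius
  map.\<close>

lemma frac_pow_mult_grp:
  assumes "y \<noteq> (0::'k)"
  shows "frac_pow mult_grp (char_exp TYPE('k)) (y ^ (char_exp TYPE('k) ^ m)) n (int m) = y powi n"
  unfolding frac_pow_def
proof (rule the_equality)
  let ?b = "char_exp TYPE('k) ^ m"
  have pow: "(y ^ ?b) powi n = (y powi n) ^ ?b" by (simp add: power_int_power power_int_power' mult.commute)
  show "y powi n \<in> carrier mult_grp \<and>
      y powi n [^]\<^bsub>mult_grp\<^esub> char_exp TYPE('k) ^ nat (int m) =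
      y ^ ?b [^]\<^bsub>mult_grp\<^esub> (n * int (char_exp TYPE('k) ^ nat (- int m)))"
    using assms by (simp add: mult_grp_nat_pow mult_grp_int_pow pow) (simp add: mult_grp_def)
  fix t
  assume "t \<in> carrier mult_grp \<and>
      t [^]\<^bsub>mult_grp\<^esub> char_exp TYPE('k) ^ nat (int m) =
      y ^ ?b [^]\<^bsub>mult_grp\<^esub> (n * int (char_exp TYPE('k) ^ nat (- int m)))"
  then have "t ^ ?b = (y powi n) ^ ?b"
    using assms by (simp add: mult_grp_nat_pow mult_grp_int_pow pow)
  then have "(t - y powi n) ^ ?b = 0" by (simp add: diff_power_char_exp)
  then show "t = y powi n" by simp
qed

text \<open>Uniqueness again comes from Frobenius: if the \<open>p^m\<close>-th powers of
  \<open>s\<close> and \<open>w\<close> are congruent, then \<open>(s - w) ^ (p ^ m)\<close> has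
  larger value than \<open>w ^ (p ^ m)\<close>, and roots preserve the inequality.\<close>

lemma frac_pow_RVs:
  assumes "y \<noteq> 0"
  shows "frac_pow (RVs v) (char_exp TYPE('k)) (rv v (y ^ (char_exp TYPE('k) ^ m))) n (int m) =
    rv v (y powi n)"
  unfolding frac_pow_def
proof (rule the_equality)
  let ?b = "char_exp TYPE('k) ^ m"
  have pow: "(y ^ ?b) powi n = (y powi n) ^ ?b" by (simp add: power_int_power power_int_power' mult.commute)
  show "rv v (y powi n) \<in> carrier (RVs v) \<and>
      rv v (y powi n) [^]\<^bsub>RVs v\<^esub> char_exp TYPE('k) ^ nat (int m) =
      rv v (y ^ ?b) [^]\<^bsub>RVs v\<^esub> (n * int (char_exp TYPE('k) ^ nat (- int m)))"
    using assms by (simp add: RVs_nat_pow RVs_int_pow pow carrier_RVs)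
  fix t
  assume t: "t \<in> carrier (RVs v) \<and>
      t [^]\<^bsub>RVs v\<^esub> char_exp TYPE('k) ^ nat (int m) =
      rv v (y ^ ?b) [^]\<^bsub>RVs v\<^esub> (n * int (char_exp TYPE('k) ^ nat (- int m)))"
  then obtain s where s: "s \<noteq> 0" "t = rv v s" by (auto simp: carrier_RVs)
  define w where "w = y powi n"
  have w: "w \<noteq> 0" using assms by (simp add: w_def)
  have "rv v (s ^ ?b) = rv v (w ^ ?b)"
    using t s assms by (simp add: RVs_nat_pow RVs_int_pow pow w_def)
  then have "req (s ^ ?b) (w ^ ?b)" using s(1) w by (simp add: rv_eq_iff)
  then have "v (w ^ ?b) < v ((s - w) ^ ?b)" by (simp add: req_def diff_power_char_exp)
  then have "req s w" using char_exp_pos by (simp add: req_def v_power_less_iff)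
  then show "t = rv v (y powi n)" using s w by (simp add: rv_eq_iff w_def)
qed

text \<open>The value of a non-trivial power is strictly monotone in the value of \<open>x\<close>,
  and every neighborhood of infinity contains points of different values.\<close>

lemma powi_not_const:
  assumes "\<forall>\<^sub>F x in at_inf. v (x powi m) = v t"
  shows "m = 0"
proof (rule ccontr)
  assume m: "m \<noteq> 0"
  define n where "n = nat \<bar>m\<bar>"
  have n: "0 < n" using m by (simp add: n_def)
  have "\<exists>s. \<forall>\<^sub>F x in at_inf. v (x ^ n) = v s"
  proof (cases "0 < m")
    case True
    then have "x powi m = x ^ n" for x :: 'k by (simp add: n_def power_int_def)
    then show ?thesis using assms by auto
  next
    case False
    then have pw: "x powi m = inverse (x ^ n)" for x :: 'k
      using m by (simp add: n_def power_int_def power_inverse)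
    have "\<forall>\<^sub>F x in at_inf. v (x ^ n) = v (inverse t)"
      using assms eventually_at_inf_nonzero
    proof eventually_elim
      case (elim x)
      have "v (inverse (x ^ n)) = v t" using elim(1) pw by simp
      then have "t \<noteq> 0" using elim(2) v_eq_Pinf[of "inverse (x ^ n)"] by auto
      then show ?case
        using v_inverse_le_iff[of "inverse (x ^ n)" t] v_inverse_le_iff[of t "inverse (x ^ n)"]
          elim(2) \<open>v (inverse (x ^ n)) = v t\<close> by (simp add: antisym)
    qed
    then show ?thesis by blast
  qed
  then obtain s c where c: "c \<noteq> 0" "\<And>x. v x < v c \<Longrightarrow> v (x ^ n) = v s"
    unfolding eventually_at_inf by blast
  obtain x where x: "v x < v c" using v_unbounded_below by blast
  obtain y where y: "v y < v x" using v_unbounded_below by blast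
  then have "v (y ^ n) < v (x ^ n)" using n by (simp add: v_power_less_iff)
  then show False using c(2)[OF x] c(2)[of y] x y by auto
qed

end

section \<open>Uniformly definable families in a C-minimal valued field\<close>

text \<open>The two truth values record whether \<open>v (x - a)\<close> is below, equal to or above
  \<open>v r\<close>, which decides membership in the closed and in the open ball at once.\<close>

definition ball_type ::
    "('f vfun, 'r vrel, 'a) fo_struct \<Rightarrow> 'a \<Rightarrow> 'a \<Rightarrow> 'a \<Rightarrow> bool \<times> bool" where
  "ball_type S a r x = (rint S Div [r, fint S Minus [x, a]], rint S Div [fint S Minus [x, a], r])"

text \<open>
  This says that \<open>D\<close> is a boolean combination of at most \<open>N\<close> balls of each kind without naming the
  combination, which makes it easy to transfer between the ultrapower and its factors.
\<close>

definition dep :: "('f vfun, 'r vrel, 'a) fo_struct \<Rightarrow> nat \<Rightarrow> 'a set \<Rightarrow> bool" where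
  "dep S N D \<longleftrightarrow> (\<exists>a r. range a \<subseteq> Dom S \<and> range r \<subseteq> Dom S \<and>
     (\<forall>x\<in>Dom S. \<forall>y\<in>Dom S.
        (\<forall>i<N. ball_type S (a i) (r i) x = ball_type S (a i) (r i) y) \<longrightarrow> (x \<in> D \<longleftrightarrow> y \<in> D)))"

lemma depI:
  assumes "range a \<subseteq> Dom S" "range r \<subseteq> Dom S"
    "\<And>x y. x \<in> Dom S \<Longrightarrow> y \<in> Dom S \<Longrightarrow>
       (\<And>i. i < N \<Longrightarrow> ball_type S (a i) (r i) x = ball_type S (a i) (r i) y) \<Longrightarrow> x \<in> D \<Longrightarrow> y \<in> D"
  shows "dep S N D"
proof -
  have "x \<in> D \<longleftrightarrow> y \<in> D" if "x \<in> Dom S" "y \<in> Dom S"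
    "\<forall>i<N. ball_type S (a i) (r i) x = ball_type S (a i) (r i) y" for x y
  proof
    show "x \<in> D \<Longrightarrow> y \<in> D" by (rule assms(3)[OF that(1,2)]) (use that(3) in blast)+
    show "y \<in> D \<Longrightarrow> x \<in> D" by (rule assms(3)[OF that(2,1)]) (use that(3) in metis)+
  qed
  then show ?thesis unfolding dep_def using assms(1,2) by blast
qed

lemma depE:
  assumes "dep S N D"
  obtains a r where "range a \<subseteq> Dom S" "range r \<subseteq> Dom S"
    "\<And>x y. x \<in> Dom S \<Longrightarrow> y \<in> Dom S \<Longrightarrow>
       (\<And>i. i < N \<Longrightarrow> ball_type S (a i) (r i) x = ball_type S (a i) (r i) y) \<Longrightarrow>
       x \<in> D \<longleftrightarrow> y \<in> D"
proof -
  obtain a r where ar: "range a \<subseteq> Dom S" "range r \<subseteq> Dom S"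
    and *: "\<forall>x\<in>Dom S. \<forall>y\<in>Dom S.
      (\<forall>i<N. ball_type S (a i) (r i) x = ball_type S (a i) (r i) y) \<longrightarrow> (x \<in> D \<longleftrightarrow> y \<in> D)"
    using assms unfolding dep_def by (elim exE conjE) (rule that)
  show thesis
  proof (rule that[OF ar])
    fix x y assume "x \<in> Dom S" "y \<in> Dom S"
      and "\<And>i. i < N \<Longrightarrow> ball_type S (a i) (r i) x = ball_type S (a i) (r i) y"
    then show "x \<in> D \<longleftrightarrow> y \<in> D" by (intro *[rule_format])
  qed
qed

lemma dep_mono:
  assumes "dep S M D" "M \<le> N"
  shows "dep S N D"
  using assms(1)
proof (rule depE)
  fix a r
  assume ar: "range a \<subseteq> Dom S" "range r \<subseteq> Dom S"
    and *: "\<And>x y. x \<in> Dom S \<Longrightarrow> y \<in> Dom S \<Longrightarrow>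
       (\<And>i. i < M \<Longrightarrow> ball_type S (a i) (r i) x = ball_type S (a i) (r i) y) \<Longrightarrow>
       x \<in> D \<longleftrightarrow> y \<in> D"
  show ?thesis
  proof (rule depI[OF ar])
    fix x y assume xy: "x \<in> Dom S" "y \<in> Dom S" "x \<in> D"
      and t: "\<And>i. i < N \<Longrightarrow> ball_type S (a i) (r i) x = ball_type S (a i) (r i) y"
    have "x \<in> D \<longleftrightarrow> y \<in> D" by (rule *[OF xy(1,2) t]) (use assms(2) in simp)
    then show "y \<in> D" using xy(3) by simp
  qed
qed

lemma dep_bool_comb:
  assumes "D \<in> bool_comb (Dom S) (Collect (struct_ball S))" "is_struct L S"
  shows "\<exists>N. dep S N D"
  using assms(1)
proof induction
  obtain d where d: "d \<in> Dom S" using assms(2) unfolding is_struct_def by blast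
  case (base B)
  consider "B = Dom S" | a c where "a \<in> Dom S" "c \<in> Dom S"
      "B = {x \<in> Dom S. rint S Div [c, fint S Minus [x, a]]} \<or>
       B = {x \<in> Dom S. \<not> rint S Div [fint S Minus [x, a], c]}"
    using base unfolding struct_ball_def by blast
  then show ?case
  proof cases
    case 1
    have "dep S 0 B" by (rule depI[of "\<lambda>_. d" _ "\<lambda>_. d"]) (use 1 d in auto)
    then show ?thesis ..
  next
    case 2
    have "dep S 1 B"
      by (rule depI[of "\<lambda>_. a" _ "\<lambda>_. c"]) (use 2 in \<open>auto simp: ball_type_def\<close>)
    then show ?thesis ..
  qed
next
  case (compl A)
  then obtain N where "dep S N A" by blast
  then show ?case
  proof (rule depE)
    fix a r
    assume ar: "range a \<subseteq> Dom S" "range r \<subseteq> Dom S"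
      and *: "\<And>x y. x \<in> Dom S \<Longrightarrow> y \<in> Dom S \<Longrightarrow>
         (\<And>i. i < N \<Longrightarrow> ball_type S (a i) (r i) x = ball_type S (a i) (r i) y) \<Longrightarrow>
         x \<in> A \<longleftrightarrow> y \<in> A"
    have "dep S N (Dom S - A)"
    proof (rule depI[OF ar])
      fix x y assume xy: "x \<in> Dom S" "y \<in> Dom S" "x \<in> Dom S - A"
        and t: "\<And>i. i < N \<Longrightarrow> ball_type S (a i) (r i) x = ball_type S (a i) (r i) y"
      have "x \<in> A \<longleftrightarrow> y \<in> A" by (rule *[OF xy(1,2) t])
      then show "y \<in> Dom S - A" using xy by blast
    qed
    then show ?thesis ..
  qed
next
  case (union A B)
  then obtain M N where "dep S M A" "dep S N B" by blast
  from this(1) show ?case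
  proof (rule depE)
    fix a r
    assume ar: "range a \<subseteq> Dom S" "range r \<subseteq> Dom S"
      and *: "\<And>x y. x \<in> Dom S \<Longrightarrow> y \<in> Dom S \<Longrightarrow>
         (\<And>i. i < M \<Longrightarrow> ball_type S (a i) (r i) x = ball_type S (a i) (r i) y) \<Longrightarrow>
         x \<in> A \<longleftrightarrow> y \<in> A"
    show ?thesis
      using \<open>dep S N B\<close>
    proof (rule depE)
      fix b s
      assume bs: "range b \<subseteq> Dom S" "range s \<subseteq> Dom S"
        and **: "\<And>x y. x \<in> Dom S \<Longrightarrow> y \<in> Dom S \<Longrightarrow>
           (\<And>i. i < N \<Longrightarrow> ball_type S (b i) (s i) x = ball_type S (b i) (s i) y) \<Longrightarrow>
           x \<in> B \<longleftrightarrow> y \<in> B"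
      \<comment> \<open>The two lists of balls are concatenated.\<close>
      let ?a = "\<lambda>i. if i < M then a i else b (i - M)" and ?r = "\<lambda>i. if i < M then r i else s (i - M)"
      have "dep S (M + N) (A \<union> B)"
      proof (rule depI[of ?a _ ?r])
        fix x y assume xy: "x \<in> Dom S" "y \<in> Dom S" "x \<in> A \<union> B"
          and t: "\<And>i. i < M + N \<Longrightarrow> ball_type S (?a i) (?r i) x = ball_type S (?a i) (?r i) y"
        have "x \<in> A \<longleftrightarrow> y \<in> A"
        proof (rule *[OF xy(1,2)])
          fix i assume "i < M"
          then show "ball_type S (a i) (r i) x = ball_type S (a i) (r i) y"
            using t[of i] by simp
        qed
        moreover have "x \<in> B \<longleftrightarrow> y \<in> B"
        proof (rule **[OF xy(1,2)])
          fix i assume "i < N"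
          then show "ball_type S (b i) (s i) x = ball_type S (b i) (s i) y"
            using t[of "M + i"] by simp
        qed
        ultimately show "y \<in> A \<union> B" using xy(3) by blast
      qed (use ar bs in auto)
      then show ?thesis ..
    qed
  qed
qed

locale C_min_vf = acvf v
  for v :: "'k::alg_closed_field \<Rightarrow> 'g::linordered_ab_group_add extended" +
  fixes L :: "('f vfun, 'r vrel) language" and K :: "('f vfun, 'r vrel, 'k) fo_struct"
  assumes expands: "expands_valued_field v L K" and Cmin: "C_minimal L K"
begin

lemma Dom_K: "Dom K = UNIV"
  using expands by (simp add: expands_valued_field_def)

sublocale fo_univ L K
  by unfold_locales (rule Dom_K)

lemma K_simps: "fint K Plus [x, y] = x + y" "fint K Minus [x, y] = x - y"
  "fint K Times [x, y] = x * y" "rint K Div [x, y] \<longleftrightarrow> v x \<le> v y"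
  using expands by (simp_all add: expands_valued_field_def)

lemma Dp_le_var: "Dp (\<lambda>e. v (e i) \<le> v (e j))"
proof (rule DpI)
  show "wf_fm L (Rel Div [Var (2 * i), Var (2 * j)])"
    using expands by (auto simp: expands_valued_field_def expands_Ldiv_def numeral_2_eq_2)
  show "(v (e i) \<le> v (e j)) = sat K (mix e undefined) (Rel Div [Var (2 * i), Var (2 * j)])" for e
    by (simp add: K_simps)
qed

lemma Dp_op_var:
  "Dp (\<lambda>e. e i = e j + e k)" "Dp (\<lambda>e. e i = e j - e k)" "Dp (\<lambda>e. e i = e j * e k)"
proof -
  have wf: "wf_fm L (Eq (Var (2 * i)) (Fn f [Var (2 * j), Var (2 * k)]))"
    if "f \<in> {Plus, Minus, Times}" for f
    using that expands by (auto simp: expands_valued_field_def expands_Ldiv_def numeral_2_eq_2)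
  show "Dp (\<lambda>e. e i = e j + e k)" by (rule DpI[OF wf[of Plus]]) (simp_all add: K_simps)
  show "Dp (\<lambda>e. e i = e j - e k)" by (rule DpI[OF wf[of Minus]]) (simp_all add: K_simps)
  show "Dp (\<lambda>e. e i = e j * e k)" by (rule DpI[OF wf[of Times]]) (simp_all add: K_simps)
qed

lemma Dp_le [intro]: "Df A \<Longrightarrow> Df B \<Longrightarrow> Dp (\<lambda>e. v (A e) \<le> v (B e))"
  by (rule Dp_app2[of "\<lambda>x y. v x \<le> v y"]) (rule Dp_le_var)

lemma Dp_less [intro]: "Df A \<Longrightarrow> Df B \<Longrightarrow> Dp (\<lambda>e. v (A e) < v (B e))"
  unfolding not_le[symmetric] by (intro Dp_not Dp_le)

lemma Dp_veq [intro]: "Df A \<Longrightarrow> Df B \<Longrightarrow> Dp (\<lambda>e. v (A e) = v (B e))"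
  unfolding order_eq_iff[of "v _"] by (intro Dp_conj Dp_le)

lemma Df_add [intro]: "Df A \<Longrightarrow> Df B \<Longrightarrow> Df (\<lambda>e. A e + B e)"
  by (rule Df_app2[of "(+)"]) (rule Dp_op_var)

lemma Df_diff [intro]: "Df A \<Longrightarrow> Df B \<Longrightarrow> Df (\<lambda>e. A e - B e)"
  by (rule Df_app2[of "(-)"]) (rule Dp_op_var)

lemma Df_mult [intro]: "Df A \<Longrightarrow> Df B \<Longrightarrow> Df (\<lambda>e. A e * B e)"
  by (rule Df_app2[of "(*)"]) (rule Dp_op_var)

lemma Df_power [intro]: "Df A \<Longrightarrow> Df (\<lambda>e. A e ^ n)"
  by (induction n) auto

lemma Df_divide [intro]:
  assumes "Df A" "Df B"
  shows "Df (\<lambda>e. A e / B e)"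
proof (rule Df_app2[of "(/)", OF _ assms])
  have "Dp (\<lambda>e. (e 2 = 0 \<and> e 0 = 0) \<or> (\<not> e 2 = 0 \<and> e 0 * e 2 = e 1))"
    by (intro Dp_disj Dp_conj Dp_not Dp_eq Df_mult Df_var Df_const)
  then show "Dp (\<lambda>e. e 0 = e 1 / e 2)"
  proof (rule back_subst[of Dp], intro ext)
    show "((e 2 = 0 \<and> e 0 = 0) \<or> (\<not> e 2 = 0 \<and> e 0 * e 2 = e 1)) = (e 0 = e 1 / e 2)" for e :: "nat \<Rightarrow> 'k"
      by (cases "e 2 = 0") (auto simp: field_simps)
  qed
qed

lemmas Dp_rules = Dp_not Dp_conj Dp_disj Dp_imp Dp_ex Dp_all Dp_const Dp_eq Dp_le Dp_less Dp_veq
  Df_if Df_var Df_const Df_add Df_diff Df_mult Df_power Df_divide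

lemma dep_K_iff:
  "dep K N D \<longleftrightarrow> (\<exists>a r. \<forall>x y. (\<forall>i<N. ball_type K (a i) (r i) x = ball_type K (a i) (r i) y) \<longrightarrow>
      (x \<in> D \<longleftrightarrow> y \<in> D))"
  unfolding dep_def by (simp add: Dom_K)

lemma ball_type_K: "ball_type K a r x = (v r \<le> v (x - a), v (x - a) \<le> v r)"
  by (simp add: ball_type_def K_simps)

text \<open>Compactness by means of an ultrapower. If \<open>n\<close> balls do not suffice for the
  parameters \<open>E n\<close>, the class of the sequence \<open>E\<close> defines a set in the
  ultrapower, where C-minimality yields some number \<open>N\<close> of balls. Their coordinates
  would then have to work for some \<open>n\<close> with \<open>N <= n\<close>.\<close>

theorem uniform_dep:
  assumes "Dp (\<lambda>e. Q (e 0) (\<lambda>i. e (Suc i)))"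
  shows "\<exists>N. \<forall>e. dep K N {x. Q x e}"
proof (rule ccontr)
  assume "\<not> ?thesis"
  then have "\<forall>n. \<exists>e. \<not> dep K n {x. Q x e}" by blast
  then obtain E where E: "\<And>n. \<not> dep K n {x. Q x (E n)}" by metis
  obtain \<phi> p where \<phi>: "wf_fm L \<phi>" "\<And>e. Q (e 0) (\<lambda>i. e (Suc i)) = sat K (mix e p) \<phi>"
    using assms by (elim DpE) blast
  have Q: "Q x e = sat K (mix (case_nat x e) p) \<phi>" for x e
    using \<phi>(2)[of "case_nat x e"] by simp
  obtain F :: "nat filter" where F: "F \<noteq> bot" "F \<le> sequentially"
      "\<And>P. eventually P F \<or> eventually (\<lambda>n. \<not> P n) F"
    by (rule free_ultrafilter_nat) blast
  interpret U: ultrapower F L K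
    by unfold_locales (use F Dom_K in auto)
  let ?U = "U.UP :: ('f vfun, 'r vrel, ('f, 'r, 'k) univ) fo_struct"
  \<comment> \<open>Variable 0 is overwritten by the element to be tested, so the
    \<open>undefined\<close> at entry 0 is never read.\<close>
  define es :: "nat \<Rightarrow> ('f, 'r, 'k) univ"
    where "es i = U.rep (\<lambda>n. mix (case_nat undefined (E n)) p i)" for i
  define D where "D = {x \<in> Dom ?U. sat ?U (es(0 := x)) \<phi>}"
  have rep_Dom: "U.rep s \<in> Dom ?U" for s by (simp add: U.UP_def)
  have es_Dom: "range es \<subseteq> Dom ?U" by (auto simp: es_def rep_Dom)
  have sat_es: "sat ?U (es(0 := U.rep s)) \<phi> \<longleftrightarrow> (\<forall>\<^sub>F n in F. Q (s n) (E n))" for s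
    unfolding Q
  proof (rule U.sat_UP_pr)
    show "range (es(0 := U.rep s)) \<subseteq> Dom ?U" using es_Dom rep_Dom by auto
    show "\<forall>\<^sub>F n in F. U.pr ((es(0 := U.rep s)) i) n = mix (case_nat (s n) (E n)) p i" for i
    proof (cases "i = 0")
      case True
      then show ?thesis using U.pr_rep[of s] by (simp add: mix_def)
    next
      case False
      then have "mix (case_nat undefined (E n)) p i = mix (case_nat (s n) (E n)) p i" for n
        by (auto simp: mix_def split: nat.splits elim!: evenE)
      then show ?thesis
        using False U.pr_rep[of "\<lambda>n. mix (case_nat undefined (E n)) p i"] by (simp add: es_def)
    qed
  qed
  have "definable L ?U 1 ((\<lambda>x. [x]) ` D)"
    unfolding definable_def
  proof (intro exI[of _ \<phi>] exI[of _ es] conjI \<phi>(1) es_Dom)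
    have 1: "(\<lambda>i. if i < 1 then [x] ! i else es i) = es(0 := x)" for x
      by (auto simp: fun_eq_iff)
    show "(\<lambda>x. [x]) ` D = {xs. length xs = 1 \<and> set xs \<subseteq> Dom ?U \<and>
        sat ?U (\<lambda>i. if i < 1 then xs ! i else es i) \<phi>}"
      unfolding D_def by (auto simp: length_Suc_conv 1[simplified] image_iff)
  qed
  then have "D \<in> bool_comb (Dom ?U) (Collect (struct_ball ?U))"
    using Cmin U.is_struct_UP U.elem_equiv_UP unfolding C_minimal_def by blast
  then obtain N where "dep ?U N D" using dep_bool_comb U.is_struct_UP by blast
  then obtain a r where ar: "range a \<subseteq> Dom ?U" "range r \<subseteq> Dom ?U"
    and D: "\<And>x y. x \<in> Dom ?U \<Longrightarrow> y \<in> Dom ?U \<Longrightarrow>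
       (\<And>i. i < N \<Longrightarrow> ball_type ?U (a i) (r i) x = ball_type ?U (a i) (r i) y) \<Longrightarrow>
       x \<in> D \<longleftrightarrow> y \<in> D"
    by (elim depE) blast
  \<comment> \<open>In each coordinate from \<open>N\<close> on, two points of equal type are
    separated by \<open>Q\<close>. They form two elements of the ultrapower with equal types,
    exactly one of which lies in \<open>D\<close>.\<close>
  have "\<exists>x y. (\<forall>i<N. ball_type K (U.pr (a i) n) (U.pr (r i) n) x =
      ball_type K (U.pr (a i) n) (U.pr (r i) n) y) \<and> Q x (E n) \<and> \<not> Q y (E n)" if "N \<le> n" for n
  proof (rule ccontr)
    assume *: "\<not> ?thesis"
    have "dep K N {x. Q x (E n)}"
    proof (rule depI[of "\<lambda>i. U.pr (a i) n" _ "\<lambda>i. U.pr (r i) n"])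
      fix x y
      assume "\<And>i. i < N \<Longrightarrow> ball_type K (U.pr (a i) n) (U.pr (r i) n) x =
          ball_type K (U.pr (a i) n) (U.pr (r i) n) y" "x \<in> {x. Q x (E n)}"
      then show "y \<in> {x. Q x (E n)}" using * by blast
    qed (simp_all add: Dom_K)
    then show False using dep_mono[OF _ that] E by blast
  qed
  then obtain x y where xy:
    "\<And>n i. N \<le> n \<Longrightarrow> i < N \<Longrightarrow> ball_type K (U.pr (a i) n) (U.pr (r i) n) (x n) =
      ball_type K (U.pr (a i) n) (U.pr (r i) n) (y n)"
    "\<And>n. N \<le> n \<Longrightarrow> Q (x n) (E n)" "\<And>n. N \<le> n \<Longrightarrow> \<not> Q (y n) (E n)" by metis
  have large: "\<forall>\<^sub>F n in F. N \<le> n"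
    using F(2) eventually_ge_at_top[of N] by (rule filter_leD)
  have bt: "ball_type ?U (a i) (r i) (U.rep s) =
     ((\<forall>\<^sub>F n in F. fst (ball_type K (U.pr (a i) n) (U.pr (r i) n) (s n))),
      (\<forall>\<^sub>F n in F. snd (ball_type K (U.pr (a i) n) (U.pr (r i) n) (s n))))" for s i
  proof -
    let ?t = "\<lambda>n. U.pr (U.rep s :: ('f, 'r, 'k) univ) n - U.pr (a i) n"
    have ev: "\<forall>\<^sub>F n in F. U.pr (U.rep ?t :: ('f, 'r, 'k) univ) n = s n - U.pr (a i) n"
      using U.pr_rep[of ?t, where 'a='f and 'b='r] U.pr_rep[of s, where 'a='f and 'b='r]
      by eventually_elim simp
    have "(\<forall>\<^sub>F n in F. v (U.pr (r i) n) \<le> v (U.pr (U.rep ?t :: ('f, 'r, 'k) univ) n)) =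
        (\<forall>\<^sub>F n in F. v (U.pr (r i) n) \<le> v (s n - U.pr (a i) n))"
      by (rule eventually_subst) (use ev in eventually_elim, simp)
    moreover have "(\<forall>\<^sub>F n in F. v (U.pr (U.rep ?t :: ('f, 'r, 'k) univ) n) \<le> v (U.pr (r i) n)) =
        (\<forall>\<^sub>F n in F. v (s n - U.pr (a i) n) \<le> v (U.pr (r i) n))"
      by (rule eventually_subst) (use ev in eventually_elim, simp)
    ultimately show ?thesis
      unfolding ball_type_K fst_conv snd_conv by (simp add: ball_type_def U.UP_def K_simps)
  qed
  have "U.rep x \<in> D \<longleftrightarrow> U.rep y \<in> D"
  proof (rule D[OF rep_Dom rep_Dom])
    fix i assume i: "i < N"
    have "\<forall>\<^sub>F n in F. ball_type K (U.pr (a i) n) (U.pr (r i) n) (x n) =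
      ball_type K (U.pr (a i) n) (U.pr (r i) n) (y n)"
      using large by eventually_elim (rule xy(1)[OF _ i])
    then have "(\<forall>\<^sub>F n in F. g (ball_type K (U.pr (a i) n) (U.pr (r i) n) (x n))) =
        (\<forall>\<^sub>F n in F. g (ball_type K (U.pr (a i) n) (U.pr (r i) n) (y n)))" for g :: "_ \<Rightarrow> bool"
      by (intro eventually_subst) (elim eventually_mono, simp)
    then show "ball_type ?U (a i) (r i) (U.rep x) = ball_type ?U (a i) (r i) (U.rep y)"
      unfolding bt by simp
  qed
  moreover have "U.rep x \<in> D"
  proof -
    have "\<forall>\<^sub>F n in F. Q (x n) (E n)" using large by eventually_elim (rule xy(2))
    then show ?thesis using sat_es[of x] rep_Dom by (simp add: D_def)
  qed
  moreover have "U.rep y \<notin> D"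
  proof -
    have "\<forall>\<^sub>F n in F. \<not> Q (y n) (E n)" using large by eventually_elim (rule xy(3))
    then show ?thesis using sat_es[of y] U.ev_not by (simp add: D_def)
  qed
  ultimately show False by blast
qed

end

section \<open>Definable sets and functions at infinity\<close>

context C_min_vf
begin

lemma Dp_ev [intro]:
  assumes "Dp (\<lambda>e. P (e 0) (\<lambda>i. e (Suc i)))"
  shows "Dp (\<lambda>e. \<forall>\<^sub>F x in at_inf. P x e)"
proof -
  have "Dp (\<lambda>e. P (e 0) (\<lambda>i. e (Suc (Suc i))))"
    using Dp_rename[OF assms, of "\<lambda>i. if i = 0 then 0 else Suc i"] by (simp add: inj_def)
  then show ?thesis
    unfolding eventually_at_inf by (intro Dp_rules) simp_all
qed

abbreviation dfn :: "('k \<Rightarrow> 'k) \<Rightarrow> bool" where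
  "dfn g \<equiv> Df (\<lambda>e. g (e 0))"

lemma uniform_dep1:
  assumes "Dp (\<lambda>e. P (e 0) (e (Suc 0)))"
  shows "\<exists>N. \<forall>c. dep K N {x. P x c}"
proof -
  have "\<exists>N. \<forall>e :: nat \<Rightarrow> 'k. dep K N {x. P x (e 0)}"
    by (rule uniform_dep[of "\<lambda>x e. P x (e 0)"]) (use assms in simp)
  then obtain N where N: "\<forall>e :: nat \<Rightarrow> 'k. dep K N {x. P x (e 0)}" by blast
  have "dep K N {x. P x c}" for c using N[rule_format, of "\<lambda>_. c"] .
  then show ?thesis by blast
qed

lemma dep_pred: "Dp (\<lambda>e. P (e 0)) \<Longrightarrow> \<exists>N. dep K N {x. P x}"
  using uniform_dep[of "\<lambda>x e. P x"] by blast

section \<open>Definable sets of values and of residue classes\<close>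

text \<open>Take the non-zero centers and radii as \<open>E\<close>. If neither point has the value
  of a center \<open>a\<close>, then \<open>v (x - a)\<close> is the smaller of \<open>v x\<close>
  and \<open>v a\<close>, so points on the same side of all elements of \<open>E\<close> have the
  same ball types.\<close>

lemma definable_interval:
  assumes "Dp (\<lambda>e. P (e 0))"
  obtains E where "finite E" "0 \<notin> E"
    "\<And>x y. x \<noteq> 0 \<Longrightarrow> y \<noteq> 0 \<Longrightarrow>
      (\<And>e. e \<in> E \<Longrightarrow> (v x < v e \<and> v y < v e) \<or> (v e < v x \<and> v e < v y)) \<Longrightarrow> P x \<longleftrightarrow> P y"
proof -
  obtain N where "dep K N {x. P x}" using dep_pred[OF assms] by blast
  then obtain a r where ar: "\<And>x y. (\<forall>i<N. ball_type K (a i) (r i) x = ball_type K (a i) (r i) y) \<Longrightarrow>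
      x \<in> {x. P x} \<longleftrightarrow> y \<in> {x. P x}"
    unfolding dep_K_iff by blast
  define E where "E = (a ` {..<N} \<union> r ` {..<N}) - {0}"
  show thesis
  proof (rule that[of E])
    fix x y
    assume xy: "x \<noteq> 0" "y \<noteq> 0"
      and E: "\<And>e. e \<in> E \<Longrightarrow> (v x < v e \<and> v y < v e) \<or> (v e < v x \<and> v e < v y)"
    show "P x \<longleftrightarrow> P y"
    proof (rule ar[unfolded mem_Collect_eq], intro allI impI)
      fix i assume i: "i < N"
      have "v (x - a i) = v (y - a i) \<or> v (x - a i) = v x \<and> v (y - a i) = v y"
      proof (cases "a i = 0")
        case False
        then have "a i \<in> E" using i by (simp add: E_def)
        from E[OF this] show ?thesis by (auto simp: v_diff_left v_diff_right)
      qed simp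
      then show "ball_type K (a i) (r i) x = ball_type K (a i) (r i) y"
      proof
        assume *: "v (x - a i) = v x \<and> v (y - a i) = v y"
        show ?thesis
        proof (cases "r i = 0")
          case True
          then show ?thesis using * xy by (simp add: ball_type_K)
        next
          case False
          then have "r i \<in> E" using i by (simp add: E_def)
          from E[OF this] show ?thesis using * by (auto simp: ball_type_K)
        qed
      qed (simp add: ball_type_K)
    qed
  qed (simp_all add: E_def)
qed

text \<open>If neither point is closer to a center than \<open>v d\<close>, while their mutual
  distance is at least \<open>v d\<close>, then by the ultrametric inequality both have the same
  distance to the center. Since \<open>d\<close> is arbitrary, the same centers serve for residue
  classes at every radius.\<close>

lemma dep_classes:
  assumes "dep K N D"
  obtains A where "finite A" "card A \<le> N"
    "\<And>x y d. v d \<le> v (x - y) \<Longrightarrow> (\<And>a. a \<in> A \<Longrightarrow> v (x - a) \<le> v d) \<Longrightarrow>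
      (\<And>a. a \<in> A \<Longrightarrow> v (y - a) \<le> v d) \<Longrightarrow> x \<in> D \<longleftrightarrow> y \<in> D"
proof -
  obtain a r where ar: "\<And>x y. (\<forall>i<N. ball_type K (a i) (r i) x = ball_type K (a i) (r i) y) \<Longrightarrow>
      x \<in> D \<longleftrightarrow> y \<in> D"
    using assms unfolding dep_K_iff by blast
  show thesis
  proof (rule that[of "a ` {..<N}"])
    fix x y d
    assume d: "v d \<le> v (x - y)" and x: "\<And>b. b \<in> a ` {..<N} \<Longrightarrow> v (x - b) \<le> v d"
      and y: "\<And>b. b \<in> a ` {..<N} \<Longrightarrow> v (y - b) \<le> v d"
    show "x \<in> D \<longleftrightarrow> y \<in> D"
    proof (rule ar, intro allI impI)
      fix i assume "i < N"
      then have le: "v (x - a i) \<le> v d" "v (y - a i) \<le> v d" using x y by auto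
      have "v (x - a i) = v (y - a i)"
      proof (cases "v (x - a i) = v d \<and> v (y - a i) = v d")
        case False
        then have "v (x - a i) < v (x - y) \<or> v (y - a i) < v (y - x)"
          using le d by (auto simp: v_diff_commute)
        then show ?thesis
          using v_diff_left[of "x - a i" "x - y"] v_diff_left[of "y - a i" "y - x"] by auto
      qed simp
      then show "ball_type K (a i) (r i) x = ball_type K (a i) (r i) y" by (simp add: ball_type_K)
    qed
  qed (use card_image_le[of "{..<N}" a] in simp_all)
qed

text \<open>Beyond the last of the finitely many endpoints nothing changes; the element 1 only
  provides a threshold when there are no endpoints. This replaces the failure of an eventual
  statement by its eventual negation.\<close>

lemma eventually_dichotomy:
  assumes "Dp (\<lambda>e. P (e 0))"
  shows "eventually P at_inf \<or> (\<forall>\<^sub>F x in at_inf. \<not> P x)"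
proof -
  obtain E where E: "finite E" "0 \<notin> E"
    "\<And>x y. x \<noteq> 0 \<Longrightarrow> y \<noteq> 0 \<Longrightarrow>
      (\<And>e. e \<in> E \<Longrightarrow> (v x < v e \<and> v y < v e) \<or> (v e < v x \<and> v e < v y)) \<Longrightarrow> P x \<longleftrightarrow> P y"
    using assms by (rule definable_interval) blast
  obtain c where c: "c \<in> insert 1 E" "\<And>e. e \<in> insert 1 E \<Longrightarrow> v c \<le> v e"
    using ex_min_v[of "insert 1 E"] E(1) by blast
  have c0: "c \<noteq> 0" using c(1) E(2) by auto
  have const: "P x \<longleftrightarrow> P y" if "v x < v c" "v y < v c" for x y
  proof -
    have "v x < v e \<and> v y < v e" if "e \<in> E" for e
      using c(2)[of e] that \<open>v x < v c\<close> \<open>v y < v c\<close> by auto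
    then show ?thesis using E(3)[of x y] v_less_nonzero that by blast
  qed
  obtain x where x: "v x < v c" using v_unbounded_below by blast
  show ?thesis
  proof (cases "P x")
    case True
    then have "eventually P at_inf" using const[OF _ x] by (intro eventually_at_infI[OF c0]) blast
    then show ?thesis ..
  next
    case False
    then have "\<forall>\<^sub>F x in at_inf. \<not> P x" using const[OF _ x] by (intro eventually_at_infI[OF c0]) blast
    then show ?thesis ..
  qed
qed

lemma constant_right_of:
  assumes "Dp (\<lambda>e. P (e 0))" "r \<noteq> 0"
  obtains s where "s \<noteq> 0" "v r < v s"
    "\<And>x y. v r < v x \<Longrightarrow> v x < v s \<Longrightarrow> v r < v y \<Longrightarrow> v y < v s \<Longrightarrow> P x \<longleftrightarrow> P y"
proof -
  obtain E where E: "finite E" "0 \<notin> E"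
    "\<And>x y. x \<noteq> 0 \<Longrightarrow> y \<noteq> 0 \<Longrightarrow>
      (\<And>e. e \<in> E \<Longrightarrow> (v x < v e \<and> v y < v e) \<or> (v e < v x \<and> v e < v y)) \<Longrightarrow> P x \<longleftrightarrow> P y"
    using assms(1) by (rule definable_interval) blast
  obtain b where b: "b \<noteq> 0" "v r < v b" by (rule v_unbounded_above[OF assms(2)])
  obtain s where s: "s \<in> insert b {e \<in> E. v r < v e}"
    "\<And>e. e \<in> insert b {e \<in> E. v r < v e} \<Longrightarrow> v s \<le> v e"
    using ex_min_v[of "insert b {e \<in> E. v r < v e}"] E(1) by auto
  show thesis
  proof (rule that[of s])
    show "s \<noteq> 0" "v r < v s" using s(1) b E(2) by auto
    fix x y assume xy: "v r < v x" "v x < v s" "v r < v y" "v y < v s"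
    have "(v x < v e \<and> v y < v e) \<or> (v e < v x \<and> v e < v y)" if "e \<in> E" for e
    proof (cases "v r < v e")
      case True
      then have "v s \<le> v e" using s(2) that by blast
      then show ?thesis using xy by auto
    next
      case False
      then show ?thesis using xy by auto
    qed
    then show "P x \<longleftrightarrow> P y" using E(3)[of x y] xy v_less_nonzero by blast
  qed
qed

text \<open>Compare the largest endpoint inside the cut with the smallest one outside it. Between
  them \<open>P\<close> is constant, and its value there decides which of the two bounds the
  cut.\<close>

lemma definable_cut:
  assumes "Dp (\<lambda>e. P (e 0))"
    and down: "\<And>b c. P c \<Longrightarrow> b \<noteq> 0 \<Longrightarrow> v b \<le> v c \<Longrightarrow> P b"
    and c1: "c1 \<noteq> 0" "P c1" and c2: "c2 \<noteq> 0" "\<not> P c2"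
  obtains (closed) e where "e \<noteq> 0" "\<And>b. b \<noteq> 0 \<Longrightarrow> P b \<longleftrightarrow> v b \<le> v e"
  | (opened) e where "e \<noteq> 0" "\<And>b. b \<noteq> 0 \<Longrightarrow> P b \<longleftrightarrow> v b < v e"
proof -
  obtain E where E: "finite E" "0 \<notin> E"
    "\<And>x y. x \<noteq> 0 \<Longrightarrow> y \<noteq> 0 \<Longrightarrow>
      (\<And>e. e \<in> E \<Longrightarrow> (v x < v e \<and> v y < v e) \<or> (v e < v x \<and> v e < v y)) \<Longrightarrow> P x \<longleftrightarrow> P y"
    using assms(1) by (rule definable_interval) blast
  obtain p where p: "p \<in> insert c1 {e \<in> E. P e}"
    "\<And>e. e \<in> insert c1 {e \<in> E. P e} \<Longrightarrow> v e \<le> v p"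
    using ex_max_v[of "insert c1 {e \<in> E. P e}"] E(1) by auto
  obtain q where q: "q \<in> insert c2 {e \<in> E. \<not> P e}"
    "\<And>e. e \<in> insert c2 {e \<in> E. \<not> P e} \<Longrightarrow> v q \<le> v e"
    using ex_min_v[of "insert c2 {e \<in> E. \<not> P e}"] E(1) by auto
  have pq: "p \<noteq> 0" "P p" "q \<noteq> 0" "\<not> P q" using p(1) q(1) c1 c2 E(2) by auto
  then have less: "v p < v q" using down[of p q] by force
  have const: "P x \<longleftrightarrow> P y" if "v p < v x" "v x < v q" "v p < v y" "v y < v q" for x y
  proof -
    have "(v x < v e \<and> v y < v e) \<or> (v e < v x \<and> v e < v y)" if "e \<in> E" for e
      using p(2)[of e] q(2)[of e] that \<open>v p < v x\<close> \<open>v x < v q\<close> \<open>v p < v y\<close> \<open>v y < v q\<close>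
      by (cases "P e") auto
    then show ?thesis using E(3)[of x y] that v_less_nonzero by blast
  qed
  obtain m where m: "v p < v m" "v m < v q" using v_dense[OF less] by blast
  show thesis
  proof (cases "P m")
    case True
    have "P b \<longleftrightarrow> v b < v q" if "b \<noteq> 0" for b
    proof
      show "P b \<Longrightarrow> v b < v q" using down[of b q] pq by force
      assume b: "v b < v q"
      show "P b"
      proof (cases "v b \<le> v p")
        case True
        then show ?thesis using down[of p b] pq that by blast
      next
        case False
        then show ?thesis using const[of b m] b m True by auto
      qed
    qed
    then show thesis using opened pq by blast
  next
    case False
    have "P b \<longleftrightarrow> v b \<le> v p" if "b \<noteq> 0" for b
    proof
      show "v b \<le> v p \<Longrightarrow> P b" using down[of p b] pq that by blast
      assume b: "P b"
      show "v b \<le> v p"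
      proof (rule ccontr)
        assume "\<not> v b \<le> v p"
        then have "v p < v b" by simp
        moreover have "v b < v q" using down[of b q] pq b by force
        ultimately show False using const[of b m] b m False by auto
      qed
    qed
    then show thesis using closed pq by blast
  qed
qed

text \<open>
  If all residue classes were left eventually, then for \<open>c\<close> far out some classes out of \<open>N + 1\<close> are
  not hit beyond \<open>c\<close>, so all but finitely many are not hit; and these finitely many are also left.
\<close>

lemma residue_limit_0:
  assumes g: "dfn g" and "d \<noteq> 0" and int: "\<forall>\<^sub>F x in at_inf. v d \<le> v (g x)"
  shows "\<exists>b. \<forall>\<^sub>F x in at_inf. v d < v (g x - b)"
proof (rule ccontr)
  assume *: "\<not> ?thesis"
  have leave: "\<forall>\<^sub>F x in at_inf. \<not> v d < v (g x - z)" for z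
  proof -
    have "Dp (\<lambda>e. v d < v (g (e 0) - z))" by (intro Dp_rules g)
    from eventually_dichotomy[OF this] show ?thesis using * by blast
  qed
  define H where "H z c \<longleftrightarrow> (\<exists>x. v x < v c \<and> v d < v (g x - z))" for z c
  have "Dp (\<lambda>e. H (e 0) (e (Suc 0)))"
    unfolding H_def by (intro Dp_rules Df_fun[OF g])
  then obtain N where N: "\<And>c. dep K N {z. H z c}" using uniform_dep1 by blast
  obtain Z where Z: "finite Z" "card Z = Suc N" "\<forall>z\<in>Z. v z = v d"
    "\<forall>z\<in>Z. \<forall>z'\<in>Z. z \<noteq> z' \<longrightarrow> v (z - z') \<le> v d" using ex_inequivalent[OF assms(2)] by blast
  have "\<forall>\<^sub>F x in at_inf. (\<forall>z\<in>Z. \<not> v d < v (g x - z)) \<and> v d \<le> v (g x)"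
    using leave int Z(1) by (simp add: eventually_conj_iff eventually_ball_finite_distrib)
  then obtain c where c: "c \<noteq> 0" "\<And>x z. v x < v c \<Longrightarrow> z \<in> Z \<Longrightarrow> \<not> v d < v (g x - z)"
    "\<And>x. v x < v c \<Longrightarrow> v d \<le> v (g x)"
    unfolding eventually_at_inf by blast
  obtain A where A: "finite A" "card A \<le> N"
    "\<And>x y d. v d \<le> v (x - y) \<Longrightarrow> (\<And>a. a \<in> A \<Longrightarrow> v (x - a) \<le> v d) \<Longrightarrow>
      (\<And>a. a \<in> A \<Longrightarrow> v (y - a) \<le> v d) \<Longrightarrow> x \<in> {z. H z c} \<longleftrightarrow> y \<in> {z. H z c}"
    using N[of c] by (rule dep_classes) blast
  obtain z where z: "z \<in> Z" "\<And>a. a \<in> A \<Longrightarrow> v (z - a) \<le> v d"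
    using ex_unhit[OF A(1) Z(1), of d] Z(2,4) A(2) by auto
  have nz: "\<not> H z c" using c(2) z(1) unfolding H_def by blast
  \<comment> \<open>\<open>g x\<close> hits its own class. If it were far from \<open>A\<close>, the
    class of \<open>z\<close> would be hit as well.\<close>
  have "\<exists>a\<in>A. v d < v (g x - a)" if "v x < v c" for x
  proof (rule ccontr)
    assume "\<not> ?thesis"
    moreover have "v d \<le> v (g x - z)" by (rule v_diff_ge) (use c(3)[OF that] Z(3) z(1) in auto)
    moreover have "v d < v (g x - g x)" using v_fin[OF assms(2)] by auto
    then have "H (g x) c" unfolding H_def using that by blast
    ultimately show False using A(3)[of d "g x" z] z(2) nz by force
  qed
  then have "\<forall>\<^sub>F x in at_inf. \<exists>a\<in>A. v d < v (g x - a)" by (intro eventually_at_infI[OF c(1)])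
  moreover have "\<forall>\<^sub>F x in at_inf. \<forall>a\<in>A. \<not> v d < v (g x - a)"
    using leave A(1) by (simp add: eventually_ball_finite_distrib)
  ultimately have "\<forall>\<^sub>F x in at_inf. False" by eventually_elim blast
  then show False using at_inf_neq_bot by simp
qed

lemma residue_limit:
  assumes g: "dfn g" and "d \<noteq> 0" and "\<forall>\<^sub>F x in at_inf. v d \<le> v (g x - b)"
  shows "\<exists>b. \<forall>\<^sub>F x in at_inf. v d < v (g x - b)"
proof -
  have "dfn (\<lambda>x. g x - b)" by (intro Dp_rules g)
  from residue_limit_0[OF this assms(2,3)] obtain b' where
    "\<forall>\<^sub>F x in at_inf. v d < v (g x - b - b')" by blast
  then show ?thesis by (intro exI[of _ "b + b'"]) (simp add: algebra_simps)
qed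

section \<open>Invariance under multiplication by units\<close>

text \<open>By the dichotomy each unit or its inverse satisfies \<open>P\<close>. Generic units all
  behave alike, so they all satisfy \<open>P\<close>, and multiplicativity extends this to every
  unit. The opposite inequality is \<open>P\<close> for the inverse unit.\<close>

lemma unit_scale_v:
  assumes k: "dfn k" and t: "v t = v 1"
  shows "\<forall>\<^sub>F x in at_inf. v (k (t * x)) = v (k x)"
proof -
  define P where "P t \<longleftrightarrow> (\<forall>\<^sub>F x in at_inf. v (k x) \<le> v (k (t * x)))" for t
  have "Dp (\<lambda>e. P (e 0))" unfolding P_def by (intro Dp_rules Dp_ev Df_fun[OF k])
  then obtain N where N: "dep K N {t. P t}" using dep_pred by blast
  obtain A where A: "finite A"
    "\<And>x y d. v d \<le> v (x - y) \<Longrightarrow> (\<And>a. a \<in> A \<Longrightarrow> v (x - a) \<le> v d) \<Longrightarrow>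
      (\<And>a. a \<in> A \<Longrightarrow> v (y - a) \<le> v d) \<Longrightarrow> x \<in> {t. P t} \<longleftrightarrow> y \<in> {t. P t}"
    using N by (rule dep_classes) blast
  have nz: "s \<noteq> 0" if "v s = v 1" for s using that v_eq_Pinf[of s] v_1 by auto
  have alt: "P s \<or> P (1 / s)" if s: "v s = v 1" for s
  proof -
    have "Dp (\<lambda>e. v (k (e 0)) \<le> v (k (s * e 0)))" by (intro Dp_rules Df_fun[OF k])
    from eventually_dichotomy[OF this] show ?thesis
    proof
      assume "\<forall>\<^sub>F x in at_inf. \<not> v (k x) \<le> v (k (s * x))"
      then have "\<forall>\<^sub>F x in at_inf. \<not> v (k (1 / s * x)) \<le> v (k (s * (1 / s * x)))"
        by (rule at_inf_scale) (use nz[OF s] in simp)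
      then have "P (1 / s)" unfolding P_def
        by (rule eventually_mono) (use nz[OF s] in auto)
      then show ?thesis ..
    qed (simp add: P_def)
  qed
  have mult: "P (s * t)" if "P s" "P t" "v t = v 1" for s t
    using that(2) at_inf_scale[OF that(1)[unfolded P_def] nz[OF that(3)]] unfolding P_def
    by eventually_elim (auto simp: mult.assoc)
  \<comment> \<open>Factoring 1 gives a generic unit whose inverse is generic too, so one of the two
    is a generic unit with \<open>P\<close>.\<close>
  obtain s where s: "v s = v 1" "v (1 / s) = v 1" "\<And>a. a \<in> A \<Longrightarrow> v (s - a) \<le> v 1"
    "\<And>a. a \<in> A \<Longrightarrow> v (1 / s - a) \<le> v 1"
    using unit_factor[OF A(1), of 1] by blast
  obtain s0 where s0: "P s0" "v s0 = v 1" "\<And>a. a \<in> A \<Longrightarrow> v (s0 - a) \<le> v 1"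
    using alt[OF s(1)] s by blast
  have "P r" if "v r = v 1" "\<And>a. a \<in> A \<Longrightarrow> v (r - a) \<le> v 1" for r
    using A(2)[of 1 s0 r] s0 that v_diff_ge[of "v 1" s0 r] by simp
  then have P: "P r" if "v r = v 1" for r
    by (rule units_generate[OF A(1)]) (use mult that in blast)+
  have "v (1 / t) = v 1" using v_divide_eq_iff[OF nz[OF t], of 1 1] t by simp
  from at_inf_scale[OF P[OF this, unfolded P_def] nz[OF t]]
  have "\<forall>\<^sub>F x in at_inf. v (k (t * x)) \<le> v (k x)" using nz[OF t] by simp
  with P[OF t, unfolded P_def] show ?thesis by eventually_elim (rule antisym)
qed

lemma unit_scale_req:
  assumes k: "dfn k" and nz: "\<forall>\<^sub>F x in at_inf. k x \<noteq> 0" and t: "v t = v 1"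
  obtains b where "b \<noteq> 0" "\<forall>\<^sub>F x in at_inf. req (k (t * x)) (b * k x)"
proof -
  have ev: "\<forall>\<^sub>F x in at_inf. v (k (t * x) / k x) = v 1"
    using unit_scale_v[OF k t] nz
  proof eventually_elim
    case (elim x)
    then show ?case using v_divide_eq_iff[OF elim(2), of "k (t * x)" 1] by simp
  qed
  have "dfn (\<lambda>x. k (t * x) / k x)" by (intro Dp_rules Df_fun[OF k])
  from residue_limit_0[OF this, of 1] obtain b where
    b: "\<forall>\<^sub>F x in at_inf. v 1 < v (k (t * x) / k x - b)"
    using ev eventually_mono[OF ev] by fastforce
  have req: "\<forall>\<^sub>F x in at_inf. req (k (t * x) / k x) b"
    using b ev
  proof eventually_elim
    case (elim x)
    then have "v b = v 1"
      using v_diff_left[of "k (t * x) / k x" b] v_diff_right[of b "k (t * x) / k x"]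
      by (metis linorder_neqE order.irrefl)
    then show ?case using elim by (simp add: req_def)
  qed
  then have b0: "b \<noteq> 0" using at_inf_ex req_nonzero by blast
  have "\<forall>\<^sub>F x in at_inf. req (k (t * x)) (b * k x)"
    using req nz
  proof eventually_elim
    case (elim x)
    have "req (k x * (k (t * x) / k x)) (k x * b)"
      unfolding req_mult_left[OF elim(2)] by (rule elim(1))
    then show ?case using elim(2) by (simp add: mult.commute)
  qed
  then show thesis using that b0 by blast
qed

text \<open>If scaling by \<open>t\<close> multiplies the class of \<open>k\<close> by
  \<open>b\<close>, then numerator and denominator both acquire the factor \<open>b^2\<close>: the
  numerator because \<open>t^2\<close> scales in two steps, the denominator by squaring.\<close>

lemma square_ratio_req:
  assumes k: "dfn k" and nz: "\<forall>\<^sub>F x in at_inf. k x \<noteq> 0" and t: "v t = v 1"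
  shows "\<forall>\<^sub>F x in at_inf. req (k ((t * x) ^ 2) / k (t * x) ^ 2) (k (x ^ 2) / k x ^ 2)"
proof -
  have t0: "t \<noteq> 0" using t v_eq_Pinf[of t] v_1 by auto
  obtain b where b: "b \<noteq> 0" "\<forall>\<^sub>F x in at_inf. req (k (t * x)) (b * k x)"
    by (rule unit_scale_req[OF k nz t])
  have 1: "\<forall>\<^sub>F x in at_inf. req (k (t * x ^ 2)) (b * k (x ^ 2))"
    by (subst at_inf_power_iff) (simp, rule b(2))
  have 2: "\<forall>\<^sub>F x in at_inf. req (k (t * (t * x ^ 2))) (b * k (t * x ^ 2))"
    by (subst at_inf_power_iff) (simp, rule at_inf_scale[OF b(2) t0])
  show ?thesis
    using b(2) 1 2
  proof eventually_elim
    case (elim x)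
    have "req (b * k (t * x ^ 2)) (b * (b * k (x ^ 2)))"
      using elim(2) req_mult_left[OF b(1)] by simp
    from req_trans[OF elim(3) this]
    have "req (k (t * (t * x ^ 2))) (b * (b * k (x ^ 2)))" .
    from req_divide[OF this req_power[OF elim(1), of 2]]
    show ?case using b(1) by (simp add: power_mult_distrib power2_eq_square mult_ac)
  qed
qed

text \<open>One threshold for all units. \<open>Suc N\<close> inequivalent units have a common
  threshold \<open>c\<close>, and one of them is generic for the set of units that are bad beyond
  \<open>c\<close>; so all generic units are good there. Goodness beyond a fixed \<open>c\<close> is
  multiplicative, as \<open>t * x\<close> has the value of \<open>x\<close>.\<close>

lemma unit_invariant_uniform:
  assumes u: "dfn u" and inv: "\<And>t. v t = v 1 \<Longrightarrow> \<forall>\<^sub>F x in at_inf. req (u (t * x)) (u x)"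
  obtains c where "c \<noteq> 0" "\<And>t x. v t = v 1 \<Longrightarrow> v x < v c \<Longrightarrow> req (u (t * x)) (u x)"
proof -
  define H where "H t c \<longleftrightarrow> (\<exists>x. v x < v c \<and> \<not> req (u (t * x)) (u x))" for t c
  have "Dp (\<lambda>e. H (e 0) (e (Suc 0)))"
    unfolding H_def req_def by (intro Dp_rules Df_fun[OF u])
  then obtain N where N: "\<And>c. dep K N {z. H z c}" using uniform_dep1 by blast
  obtain Z where Z: "finite Z" "card Z = Suc N" "\<forall>z\<in>Z. v z = v 1"
    "\<forall>z\<in>Z. \<forall>z'\<in>Z. z \<noteq> z' \<longrightarrow> v (z - z') \<le> v 1" using ex_inequivalent[OF one_neq_zero, of "Suc N"] by blast
  have "\<forall>\<^sub>F x in at_inf. \<forall>z\<in>Z. req (u (z * x)) (u x)"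
    using inv Z(1,3) by (simp add: eventually_ball_finite_distrib)
  then obtain c where c: "c \<noteq> 0" "\<And>x z. v x < v c \<Longrightarrow> z \<in> Z \<Longrightarrow> req (u (z * x)) (u x)"
    unfolding eventually_at_inf by blast
  obtain A where A: "finite A" "card A \<le> N"
    "\<And>x y d. v d \<le> v (x - y) \<Longrightarrow> (\<And>a. a \<in> A \<Longrightarrow> v (x - a) \<le> v d) \<Longrightarrow>
      (\<And>a. a \<in> A \<Longrightarrow> v (y - a) \<le> v d) \<Longrightarrow> x \<in> {z. H z c} \<longleftrightarrow> y \<in> {z. H z c}"
    using N[of c] by (rule dep_classes) blast
  obtain z where z: "z \<in> Z" "\<And>a. a \<in> A \<Longrightarrow> v (z - a) \<le> v 1"
    using ex_unhit[OF A(1) Z(1), of 1] Z(2,4) A(2) by auto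
  have nz: "\<not> H z c" using c(2) z(1) unfolding H_def by blast
  have "\<not> H t c" if "v t = v 1" "\<And>a. a \<in> A \<Longrightarrow> v (t - a) \<le> v 1" for t
    using A(3)[of 1 t z] that z nz Z(3) v_diff_ge[of "v 1" t z] by simp
  moreover have "\<not> H (s * t) c" if st: "v s = v 1" "v t = v 1" "\<not> H s c" "\<not> H t c" for s t
  proof -
    have "req (u (s * t * x)) (u x)" if x: "v x < v c" for x
    proof -
      have "v (t * x) = v (1 * x)" using st(2) by (simp only: v_mult)
      then have "req (u (s * (t * x))) (u (t * x))" using st(3) x unfolding H_def by auto
      moreover have "req (u (t * x)) (u x)" using st(4) x unfolding H_def by auto
      ultimately show ?thesis using req_trans by (simp add: mult.assoc)
    qed
    then show ?thesis unfolding H_def by blast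
  qed
  ultimately have "\<not> H t c" if "v t = v 1" for t
    by (rule units_generate[OF A(1)]) (use that in blast)+
  then show thesis using that[of c] c(1) unfolding H_def by blast
qed

text \<open>
  The value of \<open>u x\<close> cannot tend to \<open>v r\<close> from above when \<open>rv (u x)\<close> only depends on \<open>v x\<close>.
  Otherwise \<open>u\<close> hits every class of some annulus \<open>v z = v d\<close>. Each class is hit by a union of
  annuli, bounded below; a counting argument yields three classes whose hitting sets have the same
  infimum, which two of them do not attain. But then both are hit by all annuli just above it.
\<close>

lemma no_limit_above:
  assumes u: "dfn u" and c0: "c0 \<noteq> 0"
    and inv: "\<And>t x. v t = v 1 \<Longrightarrow> v x < v c0 \<Longrightarrow> req (u (t * x)) (u x)"
    and r: "r \<noteq> 0" and above: "\<And>x. v x < v c0 \<Longrightarrow> v r < v (u x)"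
    and lim: "\<And>z. z \<noteq> 0 \<Longrightarrow> v r < v z \<Longrightarrow> \<forall>\<^sub>F x in at_inf. v (u x) < v z"
  shows False
proof -
  have same: "req (u x) (u y)" if "v x = v y" "v y < v c0" for x y
  proof -
    have y: "y \<noteq> 0" using that v_less_nonzero by blast
    have "v (x / y) = v 1" using v_divide_eq_iff[OF y, of x 1] that by simp
    from inv[OF this that(2)] show ?thesis using y by simp
  qed
  define H where "H b z \<longleftrightarrow> (\<exists>x. v x < v b \<and> v x < v c0 \<and> req (u x) z)" for b z
  have defH: "Dp (\<lambda>e. H b (e 0))" "Dp (\<lambda>e. H (e 0) z)" "Dp (\<lambda>e. H (e (Suc 0)) (e 0))" for b z
    unfolding H_def req_def by (intro Dp_rules Df_fun[OF u])+
  \<comment> \<open>Just above \<open>v r\<close> either all values are hit beyond \<open>c0\<close>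
    or none; as \<open>u x\<close> approaches \<open>v r\<close> from above, all are.\<close>
  obtain s where s: "s \<noteq> 0" "v r < v s"
    "\<And>x y. v r < v x \<Longrightarrow> v x < v s \<Longrightarrow> v r < v y \<Longrightarrow> v y < v s \<Longrightarrow> H c0 x \<longleftrightarrow> H c0 y"
    using constant_right_of[OF defH(1) r] by blast
  obtain c1 where c1: "c1 \<noteq> 0" "\<And>x. v x < v c1 \<Longrightarrow> v (u x) < v s"
    using lim[OF s(1,2)] unfolding eventually_at_inf by blast
  obtain x1 where x1: "v x1 < v c0" "v x1 < v c1"
  proof (cases "v c0 \<le> v c1")
    case True
    obtain x where "v x < v c0" by (rule v_unbounded_below)
    then show thesis using that less_le_trans True by blast
  next
    case False
    then have "v c1 \<le> v c0" by simp
    obtain x where "v x < v c1" by (rule v_unbounded_below)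
    then show thesis using that less_le_trans \<open>v c1 \<le> v c0\<close> by blast
  qed
  have "u x1 \<noteq> 0" using c1(2)[OF x1(2)] v_less_nonzero by blast
  then have "H c0 (u x1)" unfolding H_def using x1 req_refl by blast
  then have full: "H c0 z" if "v r < v z" "v z < v s" for z
    using s(3)[of "u x1" z] above[OF x1(1)] c1(2)[OF x1(2)] that by blast
  obtain d where d: "d \<noteq> 0" "v r < v d" "v d < v s" by (rule v_dense[OF s(2)])
  obtain N where N: "\<And>c. dep K N {z. H c z}" using uniform_dep1[of "\<lambda>z c. H c z"] defH(3) by blast
  obtain Z where Z: "finite Z" "card Z = 2 * N + 3" "\<forall>z\<in>Z. v z = v d"
    "\<forall>z\<in>Z. \<forall>z'\<in>Z. z \<noteq> z' \<longrightarrow> v (z - z') \<le> v d" using ex_inequivalent[OF d(1)] by blast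
  have mono: "H b' z" if "H b z" "v b \<le> v b'" for b b' z
    using that unfolding H_def by (meson less_le_trans)
  \<comment> \<open>Points of \<open>Z\<close> that are far from the at most \<open>N\<close>
    centers are all hit or all missed, so the exceptions to the majority number at most
    \<open>N\<close>.\<close>
  have dich: "card {z \<in> Z. H b z} \<le> N \<or> card {z \<in> Z. \<not> H b z} \<le> N" for b
  proof -
    obtain A where A: "finite A" "card A \<le> N"
      "\<And>x y d. v d \<le> v (x - y) \<Longrightarrow> (\<And>a. a \<in> A \<Longrightarrow> v (x - a) \<le> v d) \<Longrightarrow>
        (\<And>a. a \<in> A \<Longrightarrow> v (y - a) \<le> v d) \<Longrightarrow> x \<in> {z. H b z} \<longleftrightarrow> y \<in> {z. H b z}"
      using N[of b] by (rule dep_classes) blast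
    let ?S = "{z \<in> Z. \<exists>a\<in>A. v d < v (z - a)}"
    have S: "card ?S \<le> N" using card_hits[OF A(1) Z(1), of d] Z(4) A(2) by force
    have eq: "H b z \<longleftrightarrow> H b z'" if "z \<in> Z - ?S" "z' \<in> Z - ?S" for z z'
    proof -
      have "v d \<le> v (z - z')" by (rule v_diff_ge) (use Z(3) that in auto)
      moreover have "v (z - a) \<le> v d" "v (z' - a) \<le> v d" if "a \<in> A" for a
        using \<open>z \<in> Z - ?S\<close> \<open>z' \<in> Z - ?S\<close> that by (auto simp: not_less[symmetric])
      ultimately show ?thesis using A(3)[of d z z'] by simp
    qed
    have "{z \<in> Z. H b z} \<subseteq> ?S \<or> {z \<in> Z. \<not> H b z} \<subseteq> ?S" using eq by blast
    then show ?thesis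
    proof
      assume "{z \<in> Z. H b z} \<subseteq> ?S"
      then have "card {z \<in> Z. H b z} \<le> card ?S" using Z(1) by (intro card_mono) auto
      then show ?thesis using S by simp
    next
      assume "{z \<in> Z. \<not> H b z} \<subseteq> ?S"
      then have "card {z \<in> Z. \<not> H b z} \<le> card ?S" using Z(1) by (intro card_mono) auto
      then show ?thesis using S by simp
    qed
  qed
  have "\<exists>T\<subseteq>Z. card T = 3 \<and> (\<forall>z\<in>T. \<forall>z'\<in>T. \<forall>b. H b z \<longleftrightarrow> H b z')"
  proof (rule chain_middle[OF Z(1,2)])
    show "(\<forall>z. H b z \<longrightarrow> H b' z) \<or> (\<forall>z. H b' z \<longrightarrow> H b z)" for b b'
      using mono linear[of "v b" "v b'"] by blast
  qed (fact dich)
  then obtain T where T: "T \<subseteq> Z" "card T = 3" "\<forall>z\<in>T. \<forall>z'\<in>T. \<forall>b. H b z \<longleftrightarrow> H b z'"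
    by (elim exE conjE) (rule that)
  obtain z1 z2 z3 where z: "T = {z1, z2, z3}" "z1 \<noteq> z2" "z1 \<noteq> z3" "z2 \<noteq> z3"
    using T(2) by (auto simp: card_3_iff)
  have vT: "v z = v d" if "z \<in> T" for z using T(1) Z(3) that by blast
  obtain c2 where c2: "c2 \<noteq> 0" "\<And>x. v x < v c2 \<Longrightarrow> v (u x) < v d"
    using lim[OF d(1,2)] unfolding eventually_at_inf by blast
  have c2z: "\<not> H c2 z1"
    unfolding H_def using c2(2) req_v vT[of z1] z(1) by force
  have c0z: "H c0 z1" using full[of z1] vT[of z1] z(1) d by simp
  have "Dp (\<lambda>e. \<not> H (e 0) z1)" by (intro Dp_not defH)
  then have "\<exists>\<beta>. \<beta> \<noteq> 0 \<and> ((\<forall>b. b \<noteq> 0 \<longrightarrow> (\<not> H b z1 \<longleftrightarrow> v b \<le> v \<beta>)) \<or>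
      (\<forall>b. b \<noteq> 0 \<longrightarrow> (\<not> H b z1 \<longleftrightarrow> v b < v \<beta>)))"
  proof (rule definable_cut[of "\<lambda>b. \<not> H b z1" c2 c0])
    show "\<not> H b z1" if "\<not> H c z1" "v b \<le> v c" for b c using mono[of b z1 c] that by blast
  qed (use c2z c0z c2(1) c0 in blast)+
  then obtain \<beta> where \<beta>: "\<beta> \<noteq> 0" and
    cut: "(\<forall>b. b \<noteq> 0 \<longrightarrow> (\<not> H b z1 \<longleftrightarrow> v b \<le> v \<beta>)) \<or> (\<forall>b. b \<noteq> 0 \<longrightarrow> (\<not> H b z1 \<longleftrightarrow> v b < v \<beta>))"
    by blast
  \<comment> \<open>Some \<open>b\<close> would lie strictly between \<open>v x\<close> and the
    endpoint, on the side of the cut where nothing is hit. Hence the endpoint itself belongs to that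
    side, and the cut is closed.\<close>
  have not_below: "\<not> v x < v \<beta>" if x: "v x < v c0" "req (u x) z1" for x
  proof
    assume "v x < v \<beta>"
    then obtain b where b: "b \<noteq> 0" "v x < v b" "v b < v \<beta>" by (rule v_dense)
    then have "\<not> H b z1" using cut by auto
    then show False using b(2) x unfolding H_def by blast
  qed
  have le: "\<not> H b z1 \<longleftrightarrow> v b \<le> v \<beta>" if "b \<noteq> 0" for b
  proof -
    have "\<not> H \<beta> z1" using not_below unfolding H_def by blast
    then show ?thesis using cut \<beta> that by blast
  qed
  \<comment> \<open>\<open>att z\<close> says that the infimum is attained. All points of that value
    have the same class under \<open>u\<close>, so at most one of the three classes attains
    it.\<close>
  define att where "att z \<longleftrightarrow> (\<exists>x. v x = v \<beta> \<and> v x < v c0 \<and> req (u x) z)" for z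
  have ineq: "\<not> req z z'" if "z \<in> T" "z' \<in> T" "z \<noteq> z'" for z z'
  proof -
    have "v (z - z') \<le> v z'" using Z(4) T(1) vT[OF that(2)] that by (simp add: subset_iff)
    then show ?thesis by (simp add: req_def not_less)
  qed
  have att_unique: "z = z'" if at: "att z" "att z'" "z \<in> T" "z' \<in> T" for z z'
  proof (rule ccontr)
    assume "z \<noteq> z'"
    obtain x where x: "v x = v \<beta>" "v x < v c0" "req (u x) z"
      using at(1) unfolding att_def by (elim exE conjE) (rule that)
    obtain y where y: "v y = v \<beta>" "v y < v c0" "req (u y) z'"
      using at(2) unfolding att_def by (elim exE conjE) (rule that)
    have "req (u x) (u y)" by (rule same) (use x y in simp_all)
    from req_trans[OF req_trans[OF req_sym[OF x(3)] this] y(3)] have "req z z'" .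
    then show False using ineq[OF at(3,4) \<open>z \<noteq> z'\<close>] by blast
  qed
  \<comment> \<open>A class that does not attain the infimum is hit arbitrarily close above it; by
    definability it is then hit by all values just above.\<close>
  have germ: "\<exists>s. s \<noteq> 0 \<and> v \<beta> < v s \<and> (\<forall>x. v \<beta> < v x \<and> v x < v s \<longrightarrow> req (u x) z)"
    if zT: "z \<in> T" "\<not> att z" for z
  proof -
    have "Dp (\<lambda>e. v (e 0) < v c0 \<and> req (u (e 0)) z)"
      unfolding req_def by (intro Dp_rules Df_fun[OF u])
    from constant_right_of[OF this \<beta>] obtain s where s: "s \<noteq> 0" "v \<beta> < v s"
      "\<And>x y. v \<beta> < v x \<Longrightarrow> v x < v s \<Longrightarrow> v \<beta> < v y \<Longrightarrow> v y < v s \<Longrightarrow>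
        (v x < v c0 \<and> req (u x) z) \<longleftrightarrow> (v y < v c0 \<and> req (u y) z)" by blast
    have Hz: "H b z \<longleftrightarrow> H b z1" for b
      by (rule T(3)[rule_format]) (use zT(1) z(1) in auto)
    have "\<not> v s \<le> v \<beta>" using s(2) by simp
    then have "H s z" using le[OF s(1)] Hz[of s] by blast
    then obtain x where x: "v x < v s" "v x < v c0" "req (u x) z"
      unfolding H_def by (elim exE conjE) (rule that)
    have "\<not> v x < v \<beta>"
    proof
      assume "v x < v \<beta>"
      then have "H \<beta> z" using x unfolding H_def by blast
      then show False using le[OF \<beta>] Hz[of \<beta>] by simp
    qed
    moreover have "v x \<noteq> v \<beta>" using zT(2) x unfolding att_def by blast
    ultimately have "v \<beta> < v x" by auto
    then show ?thesis using s x by blast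
  qed
  obtain z z' where zz: "z \<in> T" "z' \<in> T" "z \<noteq> z'" "\<not> att z" "\<not> att z'"
  proof (cases "att z1")
    case True
    then show thesis using that[of z2 z3] att_unique z by blast
  next
    case False
    then show thesis using that[of z1 z2] that[of z1 z3] att_unique[of z2 z3] z by blast
  qed
  obtain s1 where s1: "s1 \<noteq> 0" "v \<beta> < v s1" "\<And>x. v \<beta> < v x \<Longrightarrow> v x < v s1 \<Longrightarrow> req (u x) z"
    using germ[OF zz(1,4)] by blast
  obtain s2 where s2: "s2 \<noteq> 0" "v \<beta> < v s2" "\<And>x. v \<beta> < v x \<Longrightarrow> v x < v s2 \<Longrightarrow> req (u x) z'"
    using germ[OF zz(2,5)] by blast
  have "v \<beta> < v (if v s1 \<le> v s2 then s1 else s2)" using s1(2) s2(2) by simp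
  then obtain x where "v \<beta> < v x" "v x < v (if v s1 \<le> v s2 then s1 else s2)" by (rule v_dense)
  then have "req (u x) z" "req (u x) z'" using s1(3)[of x] s2(3)[of x] by (auto split: if_splits)
  then have "req z z'" using req_sym req_trans by blast
  then show False using ineq zz by blast
qed

text \<open>Otherwise no value is taken eventually, and \<open>v (u x)\<close> approaches the
  endpoint of the cut of its eventual lower bounds: from above if the cut is closed, from below if
  it is open. The second case is the first one for \<open>1 / u\<close>.\<close>

lemma unit_invariant_const:
  assumes u: "dfn u" and inv: "\<And>t. v t = v 1 \<Longrightarrow> \<forall>\<^sub>F x in at_inf. req (u (t * x)) (u x)"
    and a: "a \<noteq> 0" "\<forall>\<^sub>F x in at_inf. v a \<le> v (u x)"
    and b: "b \<noteq> 0" "\<forall>\<^sub>F x in at_inf. v (u x) \<le> v b"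
  shows "\<exists>z. z \<noteq> 0 \<and> (\<forall>\<^sub>F x in at_inf. v (u x) = v z)"
proof (rule ccontr)
  assume *: "\<not> ?thesis"
  have ne: "\<forall>\<^sub>F x in at_inf. v (u x) \<noteq> v z" if "z \<noteq> 0" for z
  proof -
    have "Dp (\<lambda>e. v (u (e 0)) = v z)" by (intro Dp_rules u)
    from eventually_dichotomy[OF this] show ?thesis using * that by blast
  qed
  have less: "\<forall>\<^sub>F x in at_inf. v (u x) < v z" if "\<not> (\<forall>\<^sub>F x in at_inf. v z \<le> v (u x))" for z
  proof -
    have "Dp (\<lambda>e. v z \<le> v (u (e 0)))" by (intro Dp_rules u)
    from eventually_dichotomy[OF this] show ?thesis using that by (simp add: not_le)
  qed
  obtain c where c: "c \<noteq> 0" "\<And>t x. v t = v 1 \<Longrightarrow> v x < v c \<Longrightarrow> req (u (t * x)) (u x)"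
    using unit_invariant_uniform[OF u inv] by blast
  obtain b' where b': "b' \<noteq> 0" "v b < v b'" by (rule v_unbounded_above[OF b(1)])
  have nb: "\<not> (\<forall>\<^sub>F x in at_inf. v b' \<le> v (u x))"
  proof
    assume "\<forall>\<^sub>F x in at_inf. v b' \<le> v (u x)"
    with b(2) have "\<forall>\<^sub>F x in at_inf. False" by eventually_elim (use b' in auto)
    then show False using at_inf_neq_bot by simp
  qed
  have "Dp (\<lambda>e. \<forall>\<^sub>F x in at_inf. v (e 0) \<le> v (u x))" by (intro Dp_rules Dp_ev Df_fun[OF u])
  then show False
  proof (rule definable_cut[of _ a b'])
    show "\<forall>\<^sub>F x in at_inf. v b \<le> v (u x)" if "\<forall>\<^sub>F x in at_inf. v c \<le> v (u x)" "v b \<le> v c" for b c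
      using that(1) by eventually_elim (use that(2) in auto)
    fix e assume e: "e \<noteq> 0" "\<And>b. b \<noteq> 0 \<Longrightarrow> (\<forall>\<^sub>F x in at_inf. v b \<le> v (u x)) \<longleftrightarrow> v b \<le> v e"
    have "\<forall>\<^sub>F x in at_inf. v e \<le> v (u x)" using e by simp
    with ne[OF e(1)] have "\<forall>\<^sub>F x in at_inf. v e < v (u x) \<and> v x < v c"
      using eventually_at_inf_less[OF c(1)] by eventually_elim auto
    then obtain c0 where c0: "c0 \<noteq> 0" "\<And>x. v x < v c0 \<Longrightarrow> v e < v (u x) \<and> v x < v c"
      unfolding eventually_at_inf by blast
    show False
    proof (rule no_limit_above[OF u c0(1) _ e(1)])
      show "\<forall>\<^sub>F x in at_inf. v (u x) < v z" if "z \<noteq> 0" "v e < v z" for z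
        by (rule less) (use e(2)[OF that(1)] that(2) in auto)
    qed (use c0(2) c(2) in auto)
  next
    fix e assume e: "e \<noteq> 0" "\<And>b. b \<noteq> 0 \<Longrightarrow> (\<forall>\<^sub>F x in at_inf. v b \<le> v (u x)) \<longleftrightarrow> v b < v e"
    have "\<forall>\<^sub>F x in at_inf. v (u x) < v e" by (rule less) (use e(2)[OF e(1)] in simp)
    then have "\<forall>\<^sub>F x in at_inf. v (u x) < v e \<and> v x < v c"
      using eventually_at_inf_less[OF c(1)] by eventually_elim auto
    then obtain c0 where c0: "c0 \<noteq> 0" "\<And>x. v x < v c0 \<Longrightarrow> v (u x) < v e \<and> v x < v c"
      unfolding eventually_at_inf by blast
    have u0: "u x \<noteq> 0" if "v x < v c0" for x using c0(2)[OF that] v_less_nonzero by blast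
    show False
    proof (rule no_limit_above[of "\<lambda>x. 1 / u x" c0 "1 / e"])
      show "dfn (\<lambda>x. 1 / u x)" by (intro Dp_rules u)
      show "req (1 / u (t * x)) (1 / u x)" if "v t = v 1" "v x < v c0" for t x
        using req_inverse[OF c(2)[OF that(1)]] c0(2)[OF that(2)] by (simp add: inverse_eq_divide)
      show "v (1 / e) < v (1 / u x)" if "v x < v c0" for x
        using v_inverse_less_iff[OF e(1) u0[OF that]] c0(2)[OF that] by (simp add: inverse_eq_divide)
      show "\<forall>\<^sub>F x in at_inf. v (1 / u x) < v z" if z: "z \<noteq> 0" "v (1 / e) < v z" for z
      proof -
        have "v (1 / z) < v e"
          using v_inverse_less_iff[of z "1 / e"] z e(1) by (simp add: inverse_eq_divide)
        then have "\<forall>\<^sub>F x in at_inf. v (1 / z) \<le> v (u x)" using e(2)[of "1 / z"] z(1) by simp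
        moreover have "\<forall>\<^sub>F x in at_inf. v (u x) \<noteq> v (1 / z)" using ne z(1) by simp
        moreover have "\<forall>\<^sub>F x in at_inf. u x \<noteq> 0" by (rule eventually_at_infI[OF c0(1) u0])
        ultimately show ?thesis
        proof eventually_elim
          case (elim x)
          then have "v (1 / z) < v (u x)" by auto
          then show ?case using v_inverse_less_iff[of "u x" "1 / z"] z(1) elim(3)
            by (simp add: inverse_eq_divide)
        qed
      qed
    qed (use c0(1) e(1) in simp_all)
  qed (use a b' nb in auto)
qed

section \<open>Sets closed under squaring and functions of bounded value\<close>

text \<open>The values on \<open>D\<close> are negative and bounded below, and squaring doubles
  them. If the lower bounds have a greatest element, its half is a larger lower bound. If they form
  an open cut, some \<open>y\<close> in \<open>D\<close> lies below the endpoint and so is a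
  minimum, but its square lies lower still.\<close>

lemma square_closed_empty:
  assumes D: "Dp (\<lambda>e. D (e 0))" and sq: "\<And>x. D x \<Longrightarrow> v x < v 1 \<and> D (x ^ 2)"
    and ev: "\<forall>\<^sub>F x in at_inf. \<not> D x"
  shows "\<not> D x"
proof
  assume x: "D x"
  obtain c where c: "c \<noteq> 0" "\<And>x. v x < v c \<Longrightarrow> \<not> D x" using ev unfolding eventually_at_inf by blast
  obtain b where b: "b \<noteq> 0" "v x < v b"
    using v_unbounded_above[of x] sq[OF x] v_less_nonzero by blast
  have "Dp (\<lambda>e. \<forall>y. D y \<longrightarrow> v (e 0) \<le> v y)"
    by (intro Dp_rules Dp_app1[OF D])
  then show False
  proof (rule definable_cut[of _ c b])
    show "\<forall>y. D y \<longrightarrow> v c \<le> v y" using c(2) by force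
    show "\<not> (\<forall>y. D y \<longrightarrow> v b \<le> v y)" using b(2) x by force
    show "\<forall>y. D y \<longrightarrow> v b' \<le> v y" if "\<forall>y. D y \<longrightarrow> v c' \<le> v y" "v b' \<le> v c'" for b' c'
      using that by force
    fix e assume e: "e \<noteq> 0" "\<And>b. b \<noteq> 0 \<Longrightarrow> (\<forall>y. D y \<longrightarrow> v b \<le> v y) \<longleftrightarrow> v b \<le> v e"
    obtain s where s: "s ^ 2 = e" using nth_root[of 2 e] by auto
    have s0: "s \<noteq> 0" using s e(1) by auto
    have low: "\<forall>y. D y \<longrightarrow> v e \<le> v y" using e by simp
    then have "v s \<le> v y" if "D y" for y
      using sq[OF that] s v_power_le_iff[of 2 s y] by auto
    then have "v s \<le> v e" using e(2)[OF s0] by blast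
    moreover have "v e < v 1" using low x sq[OF x] by force
    then have "v (s ^ 2) < v (1 ^ 2)" using s by simp
    then have "v s < v 1" unfolding v_power_less_iff[of 2, OF zero_less_numeral] .
    then have "v (s * s) < v (s * 1)" using v_mult_less_iff[OF s0] by blast
    ultimately show False using s by (simp add: power2_eq_square)
  next
    fix e assume e: "e \<noteq> 0" "\<And>b. b \<noteq> 0 \<Longrightarrow> (\<forall>y. D y \<longrightarrow> v b \<le> v y) \<longleftrightarrow> v b < v e"
    obtain y where y: "D y" "v y < v e" using e(2)[OF e(1)] by force
    have y0: "y \<noteq> 0" using y v_less_nonzero by blast
    have "\<forall>y'. D y' \<longrightarrow> v y \<le> v y'" using e(2)[OF y0] y(2) by blast
    then have "v y \<le> v (y ^ 2)" using sq[OF y(1)] by blast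
    moreover have "v (y * y) < v (y * 1)" using v_mult_less_iff[OF y0] sq[OF y(1)] by blast
    ultimately show False by (simp add: power2_eq_square)
  qed (use b c in auto)
qed

text \<open>Replacing \<open>x\<close> by \<open>x^2\<close> shows that eventual lower bounds of
  \<open>v (k x)\<close> can be doubled, so their cut has no positive endpoint. A positive eventual
  lower bound exists because the points with \<open>v (k x0) <= v (k x)\<close> are closed under
  squaring and therefore cannot stay away from infinity.\<close>

lemma no_doubling:
  assumes k: "dfn k" and dbl: "\<forall>\<^sub>F x in at_inf. v (k (x ^ 2)) = v (k x ^ 2)"
    and pos: "\<forall>\<^sub>F x in at_inf. v 1 < v (k x)" and b: "b \<noteq> 0" "\<forall>\<^sub>F x in at_inf. v (k x) \<le> v b"
  shows False
proof -
  have "\<forall>\<^sub>F x in at_inf. v (k (x ^ 2)) = v (k x ^ 2) \<and> v 1 < v (k x) \<and> v (k x) \<le> v b \<and> v x < v 1"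
    using dbl pos b(2) eventually_at_inf_less[OF one_neq_zero] by eventually_elim simp
  then obtain c where c: "c \<noteq> 0"
    "\<And>x. v x < v c \<Longrightarrow> v (k (x ^ 2)) = v (k x ^ 2) \<and> v 1 < v (k x) \<and> v (k x) \<le> v b \<and> v x < v 1"
    unfolding eventually_at_inf by blast
  obtain x0 where x0: "v x0 < v c" using v_unbounded_below by blast
  define D where "D x \<longleftrightarrow> v x < v c \<and> v (k x0) \<le> v (k x)" for x
  have D: "Dp (\<lambda>e. D (e 0))" unfolding D_def by (intro Dp_rules k)
  have sq: "v x < v 1 \<and> D (x ^ 2)" if "D x" for x
  proof -
    have x: "v x < v c" "v (k x0) \<le> v (k x)" using that by (simp_all add: D_def)
    have x_nz: "x \<noteq> 0" using x v_less_nonzero by blast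
    have "v (x * x) < v (x * 1)" using v_mult_less_iff[OF x_nz] c(2)[OF x(1)] by blast
    then have 1: "v (x ^ 2) < v c" using x(1) by (simp add: power2_eq_square)
    have "v (k x * 1) \<le> v (k x * k x)" by (rule v_mult_mono) (use c(2)[OF x(1)] in auto)
    then have "v (k x0) \<le> v (k (x ^ 2))"
      using x(2) c(2)[OF x(1)] by (simp add: power2_eq_square)
    then show ?thesis using c(2)[OF x(1)] 1 by (simp add: D_def)
  qed
  have Dx0: "D x0" using x0 by (simp add: D_def)
  have k0: "k x0 \<noteq> 0" using c(2)[OF x0] b(1) by auto
  from eventually_dichotomy[OF D] show False
  proof
    assume "\<forall>\<^sub>F x in at_inf. \<not> D x"
    then show False using square_closed_empty[OF D sq] Dx0 by blast
  next
    assume "eventually D at_inf"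
    then have unb: "\<forall>\<^sub>F x in at_inf. v (k x0) \<le> v (k x)" by eventually_elim (simp add: D_def)
    obtain b' where b': "b' \<noteq> 0" "v b < v b'" by (rule v_unbounded_above[OF b(1)])
    have "Dp (\<lambda>e. \<forall>\<^sub>F x in at_inf. v (e 0) \<le> v (k x))" by (intro Dp_rules Dp_ev Df_fun[OF k])
    then show False
    proof (rule definable_cut[of _ "k x0" b'])
      show "\<not> (\<forall>\<^sub>F x in at_inf. v b' \<le> v (k x))"
      proof
        assume "\<forall>\<^sub>F x in at_inf. v b' \<le> v (k x)"
        with b(2) have "\<forall>\<^sub>F x in at_inf. False" by eventually_elim (use b' in auto)
        then show False using at_inf_neq_bot by simp
      qed
      show "\<forall>\<^sub>F x in at_inf. v b \<le> v (k x)" if "\<forall>\<^sub>F x in at_inf. v c \<le> v (k x)" "v b \<le> v c" for b c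
        using that(1) by eventually_elim (use that(2) in auto)
      have square: "\<forall>\<^sub>F x in at_inf. v (e ^ 2) \<le> v (k x)" if "\<forall>\<^sub>F x in at_inf. v e \<le> v (k x)" for e
      proof -
        have "\<forall>\<^sub>F x in at_inf. v (e ^ 2) \<le> v (k (x ^ 2))"
          using that dbl by eventually_elim (simp add: v_power_mono)
        then show ?thesis by (rule at_inf_powerD[of 2, rotated]) simp
      qed
      fix e
      {
        assume e: "e \<noteq> 0" "\<And>b. b \<noteq> 0 \<Longrightarrow> (\<forall>\<^sub>F x in at_inf. v b \<le> v (k x)) \<longleftrightarrow> v b \<le> v e"
        have "v (e ^ 2) \<le> v e" using square[of e] e(2)[OF e(1)] e(2)[of "e ^ 2"] e(1) by simp
        then have "v (e * e) \<le> v (e * 1)" by (simp add: power2_eq_square)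
        then have "v e \<le> v 1" unfolding v_mult_le_iff[OF e(1)] .
        moreover have "v (k x0) \<le> v e" using e(2)[OF k0] unb by simp
        ultimately show False using c(2)[OF x0] by auto
      next
        assume e: "e \<noteq> 0" "\<And>b. b \<noteq> 0 \<Longrightarrow> (\<forall>\<^sub>F x in at_inf. v b \<le> v (k x)) \<longleftrightarrow> v b < v e"
        obtain s where s: "s ^ 2 = e" using nth_root[of 2 e] by auto
        have s0: "s \<noteq> 0" using s e(1) by auto
        have "v (k x0) < v e" using e(2)[OF k0] unb by simp
        then have "v 1 < v e" using c(2)[OF x0] less_trans by blast
        then have "v (1 ^ 2) < v (s ^ 2)" using s by simp
        then have "v 1 < v s" unfolding v_power_less_iff[of 2, OF zero_less_numeral] .
        then have "v (s * 1) < v (s * s)" using v_mult_less_iff[OF s0] by blast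
        then have "v s < v e" using s by (simp add: power2_eq_square)
        then have "\<forall>\<^sub>F x in at_inf. v (s ^ 2) \<le> v (k x)" using square e(2)[OF s0] by blast
        then show False using e(2)[OF e(1)] s by simp
      }
    qed (use unb b' k0 in auto)
  qed
qed

lemma bounded_const:
  assumes k: "dfn k" and a: "a \<noteq> 0" "\<forall>\<^sub>F x in at_inf. v a \<le> v (k x)"
    and b: "b \<noteq> 0" "\<forall>\<^sub>F x in at_inf. v (k x) \<le> v b"
  shows "\<exists>z. z \<noteq> 0 \<and> (\<forall>\<^sub>F x in at_inf. v (k x) = v z)"
proof -
  define u where "u x = k (x ^ 2) / k x ^ 2" for x
  have nz: "\<forall>\<^sub>F x in at_inf. k x \<noteq> 0" using b(2) by eventually_elim (use b(1) in auto)
  have u: "dfn u" unfolding u_def by (intro Dp_rules Df_fun[OF k])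
  have a2: "\<forall>\<^sub>F x in at_inf. v a \<le> v (k (x ^ 2))" and b2: "\<forall>\<^sub>F x in at_inf. v (k (x ^ 2)) \<le> v b"
    using at_inf_powerI[OF _ a(2), of 2] at_inf_powerI[OF _ b(2), of 2] by simp_all
  have "\<exists>z. z \<noteq> 0 \<and> (\<forall>\<^sub>F x in at_inf. v (u x) = v z)"
  proof (rule unit_invariant_const[OF u])
    show "\<forall>\<^sub>F x in at_inf. req (u (t * x)) (u x)" if "v t = v 1" for t
      unfolding u_def by (rule square_ratio_req[OF k nz that])
    show "\<forall>\<^sub>F x in at_inf. v (a / b ^ 2) \<le> v (u x)"
      using a2 b(2) nz
    proof eventually_elim
      case (elim x)
      have "v (a * k x ^ 2) \<le> v (k (x ^ 2) * b ^ 2)"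
        by (rule v_mult_mono) (use elim in \<open>auto intro: v_power_mono\<close>)
      then have "v (a * k x ^ 2 / b ^ 2) \<le> v (k (x ^ 2))"
        using v_divide_le_iff[of "b ^ 2" "a * k x ^ 2" "k (x ^ 2)"] b(1) by simp
      then have "v (a / b ^ 2 * k x ^ 2) \<le> v (k (x ^ 2))" by simp
      then show ?case
        unfolding u_def using v_le_divide_iff[of "k x ^ 2" "a / b ^ 2" "k (x ^ 2)"] elim(3) by simp
    qed
    show "\<forall>\<^sub>F x in at_inf. v (u x) \<le> v (b / a ^ 2)"
      using b2 a(2) nz
    proof eventually_elim
      case (elim x)
      have "v (k (x ^ 2) * a ^ 2) \<le> v (b * k x ^ 2)"
        by (rule v_mult_mono) (use elim in \<open>auto intro: v_power_mono\<close>)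
      then have "v (k (x ^ 2)) \<le> v (b * k x ^ 2 / a ^ 2)"
        using v_le_divide_iff[of "a ^ 2" "k (x ^ 2)" "b * k x ^ 2"] a(1) by simp
      then have "v (k (x ^ 2)) \<le> v (b / a ^ 2 * k x ^ 2)" by simp
      then show ?case
        unfolding u_def using v_divide_le_iff[of "k x ^ 2" "k (x ^ 2)" "b / a ^ 2"] elim(3) by simp
    qed
  qed (use a b in simp_all)
  then obtain z where z: "z \<noteq> 0" "\<forall>\<^sub>F x in at_inf. v (u x) = v z" by blast
  \<comment> \<open>\<open>v (k (x^2))\<close> is \<open>2 v (k x)\<close> plus \<open>v z\<close>;
    multiplying \<open>k\<close> by \<open>z\<close> absorbs the constant and leaves exact
    doubling.\<close>
  define k' where "k' x = z * k x" for x
  have k': "dfn k'" unfolding k'_def by (intro Dp_rules k)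
  have dbl: "\<forall>\<^sub>F x in at_inf. v (k' (x ^ 2)) = v (k' x ^ 2)"
    using z(2) nz
  proof eventually_elim
    case (elim x)
    have "v (k (x ^ 2)) = v (z * k x ^ 2)"
      using elim v_divide_eq_iff[of "k x ^ 2" "k (x ^ 2)" z] by (simp add: u_def)
    then have "v (z * k (x ^ 2)) = v (z * (z * k x ^ 2))" by (simp only: v_mult)
    then show ?case by (simp add: k'_def power_mult_distrib power2_eq_square mult_ac)
  qed
  have ak': "\<forall>\<^sub>F x in at_inf. v (z * a) \<le> v (k' x)" and bk': "\<forall>\<^sub>F x in at_inf. v (k' x) \<le> v (z * b)"
    using a(2) b(2) unfolding k'_def v_mult_le_iff[OF z(1)] by simp_all
  have "\<forall>\<^sub>F x in at_inf. v (k' x) = v 1"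
  proof (rule ccontr)
    assume "\<not> ?thesis"
    moreover have "Dp (\<lambda>e. v (k' (e 0)) = v 1)" "Dp (\<lambda>e. v (k' (e 0)) < v 1)"
      by (intro Dp_rules k')+
    ultimately have ne: "\<forall>\<^sub>F x in at_inf. v (k' x) \<noteq> v 1"
      and "(\<forall>\<^sub>F x in at_inf. v (k' x) < v 1) \<or> (\<forall>\<^sub>F x in at_inf. \<not> v (k' x) < v 1)"
      using eventually_dichotomy[of "\<lambda>x. v (k' x) = v 1"]
        eventually_dichotomy[of "\<lambda>x. v (k' x) < v 1"] by blast+
    from this(2) show False
    proof
      assume "\<forall>\<^sub>F x in at_inf. \<not> v (k' x) < v 1"
      with ne have "\<forall>\<^sub>F x in at_inf. v 1 < v (k' x)" by eventually_elim auto
      then show False using no_doubling[OF k' dbl _ _ bk'] z(1) b(1) by simp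
    next
      assume neg: "\<forall>\<^sub>F x in at_inf. v (k' x) < v 1"
      show False
      proof (rule no_doubling[of "\<lambda>x. 1 / k' x" "1 / (z * a)"])
        show "dfn (\<lambda>x. 1 / k' x)" by (intro Dp_rules k')
        have nz2: "\<forall>\<^sub>F x in at_inf. k (x ^ 2) \<noteq> 0" using at_inf_powerI[OF _ nz, of 2] by simp
        show "\<forall>\<^sub>F x in at_inf. v (1 / k' (x ^ 2)) = v ((1 / k' x) ^ 2)"
          using dbl nz nz2
        proof eventually_elim
          case (elim x)
          then have "k' x \<noteq> 0" "k' (x ^ 2) \<noteq> 0" using z(1) by (simp_all add: k'_def)
          then show ?case
            using elim(1) v_inverse_le_iff[of "k' (x ^ 2)" "k' x ^ 2"]
              v_inverse_le_iff[of "k' x ^ 2" "k' (x ^ 2)"]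
            by (simp add: inverse_eq_divide power_divide antisym)
        qed
        show "\<forall>\<^sub>F x in at_inf. v 1 < v (1 / k' x)"
          using neg
        proof eventually_elim
          case (elim x)
          then show ?case using v_inverse_less_iff[of 1 "k' x"] v_less_nonzero[OF elim]
            by (simp add: inverse_eq_divide)
        qed
        show "\<forall>\<^sub>F x in at_inf. v (1 / k' x) \<le> v (1 / (z * a))"
          using ak' nz
        proof eventually_elim
          case (elim x)
          then show ?case using v_inverse_le_iff[of "k' x" "z * a"] z(1) a(1)
            by (simp add: inverse_eq_divide k'_def)
        qed
      qed (use z a in simp)
    qed
  qed
  then have "\<forall>\<^sub>F x in at_inf. v (k x) = v (1 / z)"
  proof eventually_elim
    case (elim x)
    then show ?case using v_mult_eq_iff[OF z(1), of "k x" "1 / z"] z(1) by (simp add: k'_def)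
  qed
  then show ?thesis using z(1) by (intro exI[of _ "1 / z"]) simp
qed

text \<open>
  A bounded definable function is Cauchy at infinity. The radii of the balls that eventually
  contain \<open>g x\<close> form a definable cut; its endpoint is excluded by the fact that bounded functions
  such as \<open>g x - b\<close> have eventually constant value. If the balls had no common point \<open>b\<close>, consider
  \<open>g (x\<^sup>2) - g x\<close>: the points \<open>x\<close> with \<open>g x\<close> outside a given ball are then closed under squaring.
\<close>

theorem cauchy_at_inf:
  assumes g: "dfn g" and a: "a \<noteq> 0" "\<forall>\<^sub>F x in at_inf. v a \<le> v (g x)" and s: "s \<noteq> 0"
  shows "\<exists>b. \<forall>\<^sub>F x in at_inf. v s \<le> v (g x - b)"
proof (rule ccontr)
  assume not_s: "\<not> ?thesis"
  define T where "T d \<longleftrightarrow> (\<exists>b. \<forall>\<^sub>F x in at_inf. v d \<le> v (g x - b))" for d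
  have less: "\<forall>\<^sub>F x in at_inf. v (k x) < v d" if "dfn k" "\<not> (\<forall>\<^sub>F x in at_inf. v d \<le> v (k x))" for k d
  proof -
    have "Dp (\<lambda>e. v d \<le> v (k (e 0)))" by (intro Dp_rules that)
    from eventually_dichotomy[OF this] show ?thesis using that(2) by (simp add: not_le)
  qed
  have gb: "dfn (\<lambda>x. g x - b)" for b by (intro Dp_rules g)
  have "Dp (\<lambda>e. T (e 0))" unfolding T_def by (intro Dp_rules Dp_ev Df_fun[OF g])
  then show False
  proof (rule definable_cut[of T a s])
    show "T a" unfolding T_def using a(2) by (intro exI[of _ 0]) simp
    show "\<not> T s" using not_s by (simp add: T_def)
    show "T b" if "T c" "v b \<le> v c" for b c
      using that unfolding T_def by (meson eventually_mono order_trans)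
    fix e assume e: "e \<noteq> 0" "\<And>b. b \<noteq> 0 \<Longrightarrow> T b \<longleftrightarrow> v b \<le> v e"
    obtain b where "\<forall>\<^sub>F x in at_inf. v e \<le> v (g x - b)" using e unfolding T_def by blast
    from residue_limit[OF g e(1) this] obtain b where b: "\<forall>\<^sub>F x in at_inf. v e < v (g x - b)"
      by blast
    have "\<not> (\<forall>\<^sub>F x in at_inf. v s \<le> v (g x - b))" using not_s by blast
    from less[OF gb this] have bs: "\<forall>\<^sub>F x in at_inf. v (g x - b) \<le> v s" by eventually_elim simp
    have be: "\<forall>\<^sub>F x in at_inf. v e \<le> v (g x - b)" using b by eventually_elim simp
    obtain z where z: "z \<noteq> 0" "\<forall>\<^sub>F x in at_inf. v (g x - b) = v z"
      using bounded_const[OF gb e(1) be s bs] by blast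
    have "T z" unfolding T_def by (rule exI[of _ b]) (use z(2) in eventually_elim, simp)
    then have "v z \<le> v e" using e(2)[OF z(1)] by blast
    moreover have "\<forall>\<^sub>F x in at_inf. v e < v z" using b z(2) by eventually_elim simp
    then have "v e < v z" using at_inf_ex by blast
    ultimately show False by simp
  next
    fix e assume e: "e \<noteq> 0" "\<And>b. b \<noteq> 0 \<Longrightarrow> T b \<longleftrightarrow> v b < v e"
    \<comment> \<open>If the radius \<open>v e\<close> were missed, \<open>v (k x)\<close> would
      eventually be a constant below \<open>v e\<close>, and a radius between the two would be
      missed as well.\<close>
    have attain: "\<forall>\<^sub>F x in at_inf. v e \<le> v (k x)"
      if k: "dfn k" and ge: "\<And>d. d \<noteq> 0 \<Longrightarrow> v d < v e \<Longrightarrow> \<forall>\<^sub>F x in at_inf. v d \<le> v (k x)" for k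
    proof (rule ccontr)
      assume "\<not> ?thesis"
      from less[OF k this] have lt: "\<forall>\<^sub>F x in at_inf. v (k x) < v e" .
      then have le: "\<forall>\<^sub>F x in at_inf. v (k x) \<le> v e" by eventually_elim simp
      obtain d where d: "d \<noteq> 0" "v d < v e" by (rule v_unbounded_below)
      obtain z where z: "z \<noteq> 0" "\<forall>\<^sub>F x in at_inf. v (k x) = v z"
        using bounded_const[OF k d(1) ge[OF d] e(1) le] by blast
      have "\<forall>\<^sub>F x in at_inf. v z < v e" using lt z(2) by eventually_elim simp
      then have "v z < v e" using at_inf_ex by blast
      then obtain d where d: "d \<noteq> 0" "v z < v d" "v d < v e" by (rule v_dense)
      have "\<forall>\<^sub>F x in at_inf. False" using ge[OF d(1,3)] z(2) by eventually_elim (use d(2) in auto)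
      then show False using at_inf_neq_bot by simp
    qed
    have "\<forall>\<^sub>F x in at_inf. v e \<le> v (g (x ^ 2) - g x)"
    proof (rule attain)
      show "dfn (\<lambda>x. g (x ^ 2) - g x)" by (intro Dp_rules Df_fun[OF g])
      fix d assume d: "d \<noteq> 0" "v d < v e"
      then obtain b where b: "\<forall>\<^sub>F x in at_inf. v d \<le> v (g x - b)" using e(2) unfolding T_def by blast
      have "\<forall>\<^sub>F x in at_inf. v d \<le> v (g (x ^ 2) - b)" using at_inf_powerI[OF _ b, of 2] by simp
      with b show "\<forall>\<^sub>F x in at_inf. v d \<le> v (g (x ^ 2) - g x)"
      proof eventually_elim
        case (elim x)
        then show ?case
          using v_triangle[of "v d" "g (x ^ 2)" b "g x"] by (simp add: v_diff_commute[of b "g x"])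
      qed
    qed
    then have "\<forall>\<^sub>F x in at_inf. v e \<le> v (g (x ^ 2) - g x) \<and> v x < v 1"
      using eventually_at_inf_less[OF one_neq_zero] by eventually_elim simp
    then obtain c where c: "c \<noteq> 0" "\<And>x. v x < v c \<Longrightarrow> v e \<le> v (g (x ^ 2) - g x) \<and> v x < v 1"
      unfolding eventually_at_inf by blast
    obtain x0 where x0: "v x0 < v c" using v_unbounded_below by blast
    \<comment> \<open>The point \<open>x0\<close> is chosen before \<open>d\<close>, so
      \<open>g x0\<close> is a common point of the balls of all radii below
      \<open>v e\<close>.\<close>
    have "\<forall>\<^sub>F x in at_inf. v e \<le> v (g x - g x0)"
    proof (rule attain[OF gb])
      fix d assume d: "d \<noteq> 0" "v d < v e"
      then obtain b where b: "\<forall>\<^sub>F x in at_inf. v d \<le> v (g x - b)" using e(2) unfolding T_def by blast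
      define D where "D x \<longleftrightarrow> v x < v c \<and> \<not> v d \<le> v (g x - b)" for x
      have "\<not> D x0"
      proof (rule square_closed_empty)
        show "Dp (\<lambda>e. D (e 0))" unfolding D_def by (intro Dp_rules g)
        show "\<forall>\<^sub>F x in at_inf. \<not> D x" using b by eventually_elim (simp add: D_def)
        fix x assume x: "D x"
        then have xc: "v x < v c" by (simp add: D_def)
        have x_nz: "x \<noteq> 0" using xc v_less_nonzero by blast
        have "v (x * x) < v (x * 1)" using v_mult_less_iff[OF x_nz] c(2)[OF xc] by blast
        then have "v (x ^ 2) < v c" using xc by (simp add: power2_eq_square)
        moreover have "\<not> v d \<le> v (g (x ^ 2) - b)"
        proof
          assume "v d \<le> v (g (x ^ 2) - b)"
          moreover have "v d \<le> v (g (x ^ 2) - g x)"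
            using c(2)[OF xc] d(2) order_trans less_imp_le by blast
          ultimately have "v d \<le> v (g x - b)"
            using v_triangle[of "v d" "g x" "g (x ^ 2)" b] by (simp add: v_diff_commute[of "g x"])
          then show False using x by (simp add: D_def)
        qed
        ultimately show "v x < v 1 \<and> D (x ^ 2)" using c(2)[OF xc] by (simp add: D_def)
      qed
      then have "v d \<le> v (b - g x0)" using x0 by (simp add: D_def v_diff_commute)
      with b show "\<forall>\<^sub>F x in at_inf. v d \<le> v (g x - g x0)"
        by (auto elim!: eventually_mono intro: v_triangle)
    qed
    then have "T e" unfolding T_def by blast
    then show False using e by blast
  qed (use a s in auto)
qed

section \<open>The denominator of the slope\<close>

lemma Df_powi [intro]: "Df A \<Longrightarrow> Df (\<lambda>e. A e powi k)"
proof (cases "0 \<le> k")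
  case True
  assume "Df A"
  then have "Df (\<lambda>e. A e ^ nat k)" by (rule Df_power)
  then show ?thesis using True by (simp add: power_int_def)
next
  case False
  assume "Df A"
  then have "Df (\<lambda>e. 1 / A e ^ nat (- k))" by (intro Df_divide Df_power Df_const)
  then show ?thesis using False by (simp add: power_int_def inverse_eq_divide power_divide)
qed

text \<open>At \<open>x = y^b\<close> both sides are values of \<open>b\<close>-th powers, and the
  value group is torsion-free.\<close>

lemma ratio_v:
  assumes "0 < b" and ev: "\<forall>\<^sub>F x in at_inf. v (g x ^ b) = v (x powi a * z ^ b)"
  shows "\<forall>\<^sub>F y in at_inf. v (g (y ^ b) / y powi a) = v z"
  using at_inf_powerI[OF assms] eventually_at_inf_nonzero
proof eventually_elim
  case (elim y)
  have "(y ^ b) powi a * z ^ b = (y powi a * z) ^ b"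
    by (simp add: power_mult_distrib power_int_power power_int_power' mult.commute)
  then have "v (g (y ^ b)) = v (y powi a * z)"
    using elim(1) v_power_eq_iff[OF assms(1)] by simp
  then show ?case
    using v_divide_eq_iff[of "y powi a" "g (y ^ b)" z] elim(2) by (simp add: mult.commute)
qed

text \<open>
  A root of unity \<open>\<zeta>\<close> of prime order \<open>q\<close> dividing \<open>b\<close> acts on \<open>G y = g (y\<^sup>b) / y\<^sup>a\<close> by
  \<open>G (\<zeta> y) = G y / \<zeta>\<^sup>a\<close>, which is incompatible with \<open>G\<close> being Cauchy at infinity. This also
  covers the case where \<open>q\<close> is the residue characteristic, when \<open>\<zeta>\<close> is not visible in \<open>RV\<close>.
\<close>

lemma slope_denominator:
  assumes g: "dfn g" and z: "z \<noteq> 0" and b: "0 < b" and cop: "coprime a (int b)"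
    and ev: "\<forall>\<^sub>F x in at_inf. v (g x ^ b) = v (x powi a * z ^ b)"
  shows "\<exists>m. b = char_exp TYPE('k) ^ m"
proof -
  define G where "G y = g (y ^ b) / y powi a" for y
  have G: "dfn G" unfolding G_def by (intro Dp_rules Df_powi Df_fun[OF g])
  have vG: "\<forall>\<^sub>F y in at_inf. v (G y) = v z" unfolding G_def by (rule ratio_v[OF b ev])
  have char: "q = CHAR('k)" if q: "prime q" "q dvd b" for q
  proof (rule ccontr)
    assume "q \<noteq> CHAR('k)"
    then obtain \<zeta> :: 'k where \<zeta>: "\<zeta> ^ q = 1" "\<zeta> \<noteq> 1"
      using nontrivial_root_of_unity[OF q(1)] by blast
    have q0: "0 < q" using q(1) prime_gt_0_nat by blast
    have \<zeta>0: "\<zeta> \<noteq> 0" using \<zeta>(1) q0 by (auto simp: power_0_left)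
    obtain k where "b = q * k" using q(2) by (rule dvdE)
    then have \<zeta>b: "\<zeta> ^ b = 1" using \<zeta>(1) by (simp add: power_mult)
    define \<omega> where "\<omega> = \<zeta> powi a"
    \<comment> \<open>Both the \<open>a\<close>-th and the \<open>q\<close>-th power of the root of
      unity would be 1, and by Bezout so would the root itself.\<close>
    have "\<omega> \<noteq> 1"
    proof
      assume \<omega>: "\<omega> = 1"
      have "coprime a (int q)" using cop q(2) by (meson coprime_divisors dvd_refl int_dvd_int_iff)
      then obtain s t where st: "s * a + t * int q = 1"
        using bezout_int[of a "int q"] by (auto simp: coprime_iff_gcd_eq_1)
      have "\<zeta> = \<zeta> powi (a * s + int q * t)" using st by (simp add: mult.commute)
      also have "\<dots> = (\<zeta> powi a) powi s * (\<zeta> powi int q) powi t"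
        using \<zeta>0 by (simp only: power_int_add power_int_mult disj_imp simp_thms not_False_eq_True)
      also have "\<dots> = 1" using \<omega> \<zeta>(1) by (simp add: \<omega>_def)
      finally show False using \<zeta>(2) by simp
    qed
    have \<omega>0: "\<omega> \<noteq> 0" using \<zeta>0 by (simp add: \<omega>_def)
    have G\<zeta>: "G (\<zeta> * y) = G y / \<omega>" for y
      unfolding G_def \<omega>_def using \<zeta>b
      by (simp add: power_mult_distrib power_int_mult_distrib mult.commute)
    have "(1 - 1 / \<omega>) * z \<noteq> 0" using \<open>\<omega> \<noteq> 1\<close> \<omega>0 z by (simp add: field_simps)
    \<comment> \<open>The radius is chosen beyond the eventual value of \<open>G y\<close> minus its
      rotated copy, so that no ball of this radius contains both.\<close>
    then obtain s where s: "s \<noteq> 0" "v ((1 - 1 / \<omega>) * z) < v s" by (rule v_unbounded_above)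
    have "\<forall>\<^sub>F y in at_inf. v z \<le> v (G y)" using vG by eventually_elim simp
    from cauchy_at_inf[OF G z this s(1)] obtain c where c: "\<forall>\<^sub>F y in at_inf. v s \<le> v (G y - c)"
      by blast
    from c at_inf_scale[OF c \<zeta>0] vG have "\<forall>\<^sub>F y in at_inf. False"
    proof eventually_elim
      case (elim y)
      have "v s \<le> v (G y - G y / \<omega>)"
        using v_triangle[of "v s" "G y" c "G (\<zeta> * y)"] elim(1,2) G\<zeta>
        by (simp add: v_diff_commute[of c])
      also have "G y - G y / \<omega> = (1 - 1 / \<omega>) * G y" by (simp add: algebra_simps)
      also have "v \<dots> = v ((1 - 1 / \<omega>) * z)" using elim(3) by (simp only: v_mult)
      finally show False using s(2) by simp
    qed
    then show False using at_inf_neq_bot by simp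
  qed
  show ?thesis
  proof (cases "CHAR('k) = 0")
    case True
    have "b = 1"
    proof (rule ccontr)
      assume "b \<noteq> 1"
      then obtain q where q: "prime q" "q dvd b" using prime_factor_nat by blast
      then show False using char[OF q] True by simp
    qed
    then show ?thesis by (intro exI[of _ 0]) simp
  next
    case False
    then have "prime CHAR('k)" by (intro prime_CHAR_semidom) simp
    then show ?thesis
      using prime_power_if_unique_prime[OF b _ char] False by (simp add: char_exp_def)
  qed
qed

end

section \<open>Definable families of functions\<close>

locale C_min_family = C_min_vf v L K
  for v :: "'k::alg_closed_field \<Rightarrow> 'g::linordered_ab_group_add extended"
    and L :: "('f vfun, 'r vrel) language" and K :: "('f vfun, 'r vrel, 'k) fo_struct" +
  fixes d :: nat and W :: "'k list set" and X :: "('k list \<times> 'k) set" and f :: "'k list \<Rightarrow> 'k \<Rightarrow> 'k"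
  assumes definable_f: "definable_fun_family L K d W X f"
    and f_nonzero: "\<forall>(w, x)\<in>X. f w x \<noteq> 0"
    and X_nbhd: "\<forall>w\<in>W. \<exists>N. nbhd_inf v N \<and> N \<subseteq> X `` {w}"
begin

lemma definable_W: "definable L K d W"
  using definable_f by (simp add: definable_fun_family_def definable_family_def)

lemma length_W: "w \<in> W \<Longrightarrow> length w = d"
  using definable_W unfolding definable_def by auto

text \<open>A total, nowhere vanishing extension, so that the results on total definable functions
  apply; near infinity it agrees with \<open>f w\<close>.\<close>

definition ft :: "'k list \<Rightarrow> 'k \<Rightarrow> 'k" where
  "ft w x = (if (w, x) \<in> X then f w x else 1)"

lemma ft_nonzero: "ft w x \<noteq> 0"
  using f_nonzero by (auto simp: ft_def)

lemma Dp_X: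
  assumes "\<And>i. i < d \<Longrightarrow> Df (T i)" "Df S"
  shows "Dp (\<lambda>e. (map (\<lambda>i. T i e) [0..<d], S e) \<in> X)"
proof -
  have "definable L K (d + 1) {w @ [x] |w x. (w, x) \<in> X}"
    using definable_f by (simp add: definable_fun_family_def definable_family_def)
  from Dp_of_definable[OF this] have "Dp (\<lambda>e. (map e [0..<d], e d) \<in> X)" by simp
  from Dp_subst[OF this, of "Suc d" "\<lambda>i. if i < d then T i else S"] assms
  have "Dp (\<lambda>e. (map (\<lambda>i. if i < Suc d then (if i < d then T i else S) e else e (i - Suc d)) [0..<d], S e) \<in> X)"
    by simp
  moreover have "map (\<lambda>i. if i < Suc d then (if i < d then T i else S) e else e (i - Suc d)) [0..<d] =
      map (\<lambda>i. T i e) [0..<d]" for e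
    by simp
  ultimately show ?thesis by simp
qed

lemma Df_ft:
  assumes "\<And>i. i < d \<Longrightarrow> Df (T i)" "Df S"
  shows "Df (\<lambda>e. ft (map (\<lambda>i. T i e) [0..<d]) (S e))"
proof -
  have "definable L K (d + 2) {w @ [x, f w x] |w x. (w, x) \<in> X}"
    using definable_f by (simp add: definable_fun_family_def)
  from Dp_of_definable[OF this]
  have "Dp (\<lambda>e. map e [0..<d + 2] \<in> {w @ [x, f w x] |w x. (w, x) \<in> X})" .
  moreover have "map e [0..<d + 2] \<in> {w @ [x, f w x] |w x. (w, x) \<in> X} \<longleftrightarrow>
      (map e [0..<d], e d) \<in> X \<and> e (Suc d) = f (map e [0..<d]) (e d)" for e :: "nat \<Rightarrow> 'k"
  proof -
    have "map e [0..<d + 2] = map e [0..<d] @ [e d, e (Suc d)]" by (simp add: numeral_2_eq_2)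
    then show ?thesis by auto
  qed
  ultimately have base:
    "Dp (\<lambda>e. (map e [0..<d], e d) \<in> X \<and> e (Suc d) = f (map e [0..<d]) (e d))" by simp
  let ?T = "\<lambda>i e. if i < d then T i (\<lambda>i. e (Suc i)) else if i = d then S (\<lambda>i. e (Suc i)) else e 0"
  have T: "Df (?T i)" if "i < Suc (Suc d)" for i
  proof (cases "i < d")
    case True
    then show ?thesis using Df_shift[OF assms(1)] by simp
  next
    case False
    then show ?thesis using Df_shift[OF assms(2)] that by (cases "i = d") (auto simp: Df_var)
  qed
  have map: "map (\<lambda>i. if i < Suc (Suc d) then ?T i e else e (i - Suc (Suc d))) [0..<d] =
      map (\<lambda>i. T i (\<lambda>i. e (Suc i))) [0..<d]" for e
    by (rule map_cong[OF refl]) simp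
  from Dp_subst[OF base, of "Suc (Suc d)" ?T, OF T]
  have graph: "Dp (\<lambda>e. (map (\<lambda>i. T i (\<lambda>i. e (Suc i))) [0..<d], S (\<lambda>i. e (Suc i))) \<in> X \<and>
      e 0 = f (map (\<lambda>i. T i (\<lambda>i. e (Suc i))) [0..<d]) (S (\<lambda>i. e (Suc i))))"
    unfolding map by simp
  have "Dp (\<lambda>e. (map (\<lambda>i. T i (\<lambda>i. e (Suc i))) [0..<d], S (\<lambda>i. e (Suc i))) \<in> X)"
    using Dp_X[of "\<lambda>i e. T i (\<lambda>i. e (Suc i))" "\<lambda>e. S (\<lambda>i. e (Suc i))"] Df_shift assms by simp
  from Dp_disj[OF graph Dp_conj[OF Dp_not[OF this] Dp_eq[OF Df_var Df_const]], of 0 1]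
  have "Dp (\<lambda>e.
      ((map (\<lambda>i. T i (\<lambda>i. e (Suc i))) [0..<d], S (\<lambda>i. e (Suc i))) \<in> X \<and>
        e 0 = f (map (\<lambda>i. T i (\<lambda>i. e (Suc i))) [0..<d]) (S (\<lambda>i. e (Suc i)))) \<or>
      (\<not> (map (\<lambda>i. T i (\<lambda>i. e (Suc i))) [0..<d], S (\<lambda>i. e (Suc i))) \<in> X \<and> e 0 = 1))" .
  then show ?thesis
    unfolding Df_def ft_def by (rule back_subst[of Dp]) (auto simp: fun_eq_iff)
qed

lemma dfn_ft: "w \<in> W \<Longrightarrow> dfn (ft w)"
  using Df_ft[of "\<lambda>i e. w ! i" "\<lambda>e. e 0"] map_nth[of w] length_W[of w] by (simp add: Df_const Df_var)

lemma eventually_X: "w \<in> W \<Longrightarrow> \<forall>\<^sub>F x in at_inf. (w, x) \<in> X"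
proof -
  assume "w \<in> W"
  then obtain \<gamma> where \<gamma>: "- cball v 0 (Fin \<gamma>) \<subseteq> X `` {w}"
    using X_nbhd unfolding nbhd_inf_def by blast
  obtain c where c: "c \<noteq> 0" "v c = Fin \<gamma>" using v_surj by blast
  show ?thesis
  proof (rule eventually_at_infI[OF c(1)])
    fix x assume "v x < v c"
    then have "x \<in> - cball v 0 (Fin \<gamma>)" by (simp add: cball_def c(2) not_le)
    then show "(w, x) \<in> X" using \<gamma> by blast
  qed
qed

section \<open>Slopes and limit classes in the family\<close>

text \<open>This is \<open>v (f x) = (a / b) v x + v z\<close> with denominators cleared and the
  constant represented by a field element, hence a definable condition on \<open>w\<close>.\<close>

definition slope :: "int \<Rightarrow> nat \<Rightarrow> 'k list \<Rightarrow> bool" where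
  "slope a b w \<longleftrightarrow> (\<exists>z. z \<noteq> 0 \<and> (\<forall>\<^sub>F x in at_inf. v (ft w x ^ b) = v (x powi a * z ^ b)))"

definition ratio :: "int \<Rightarrow> nat \<Rightarrow> 'k list \<Rightarrow> 'k \<Rightarrow> 'k" where
  "ratio a b w y = ft w (y ^ b) / y powi a"

text \<open>Raising the two relations to the powers \<open>b'\<close> and \<open>b\<close> and
  dividing shows that \<open>x\<close> to the power \<open>a b' - a' b\<close> has constant value
  near infinity.\<close>

lemma slope_unique:
  assumes "slope a b w" "slope a' b' w"
  shows "a * int b' = a' * int b"
proof -
  obtain z where z: "z \<noteq> 0" "\<forall>\<^sub>F x in at_inf. v (ft w x ^ b) = v (x powi a * z ^ b)"
    using assms(1) unfolding slope_def by blast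
  obtain z' where z': "z' \<noteq> 0" "\<forall>\<^sub>F x in at_inf. v (ft w x ^ b') = v (x powi a' * z' ^ b')"
    using assms(2) unfolding slope_def by blast
  have pow: "v (s ^ n) = v (t ^ n)" if "v s = v t" for s t n
    using that v_power_mono[of s t n] v_power_mono[of t s n] by simp
  have "\<forall>\<^sub>F x in at_inf. v (x powi (a * int b' - a' * int b)) = v (z' ^ (b * b') / z ^ (b * b'))"
    using z(2) z'(2) eventually_at_inf_nonzero
  proof eventually_elim
    case (elim x)
    have "v ((x powi a * z ^ b) ^ b') = v ((ft w x ^ b) ^ b')" by (rule pow[OF elim(1)[symmetric]])
    also have "(ft w x ^ b) ^ b' = (ft w x ^ b') ^ b" by (simp add: power_mult[symmetric] mult.commute)
    also have "v \<dots> = v ((x powi a' * z' ^ b') ^ b)" by (rule pow[OF elim(2)])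
    finally have "v (x powi (a * int b') * z ^ (b * b')) = v (x powi (a' * int b) * z' ^ (b * b'))"
      by (simp add: power_mult_distrib power_int_power' power_mult[symmetric] mult.commute[of b' b])
    moreover have "x powi (a * int b' - a' * int b) * (x powi (a' * int b) * z ^ (b * b')) =
        x powi (a * int b') * z ^ (b * b')"
    proof -
      have "x powi (a * int b') = x powi (a * int b' - a' * int b) * x powi (a' * int b)"
        using elim(3) power_int_add[of x "a * int b' - a' * int b" "a' * int b"] by simp
      then show ?thesis by (simp only: mult.assoc)
    qed
    moreover have "z' ^ (b * b') / z ^ (b * b') * (x powi (a' * int b) * z ^ (b * b')) =
        x powi (a' * int b) * z' ^ (b * b')" using z(1) by simp
    ultimately have "v ((x powi (a' * int b) * z ^ (b * b')) * x powi (a * int b' - a' * int b)) =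
        v ((x powi (a' * int b) * z ^ (b * b')) * (z' ^ (b * b') / z ^ (b * b')))"
      by (simp only: mult.commute)
    moreover have "x powi (a' * int b) * z ^ (b * b') \<noteq> 0" using elim(3) z(1) by simp
    ultimately show ?case by (simp only: v_mult_eq_iff not_False_eq_True)
  qed
  then have "a * int b' - a' * int b = 0" by (rule powi_not_const)
  then show ?thesis by simp
qed

lemma slope_of_factorization:
  assumes w: "w \<in> W" and fac: "factorizes_at_inf v (X `` {w}) (f w) D h"
    and lin: "eventually_Q_linear_on at_bot D h r"
  shows "slope (fst (quotient_of r)) (nat (snd (quotient_of r))) w"
proof -
  let ?a = "fst (quotient_of r)" and ?b = "snd (quotient_of r)"
  have b: "0 < ?b" using quotient_of_denom_pos' by blast
  obtain lam \<alpha> where rat: "is_rat_mult r lam"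
    and "\<forall>\<^sub>F \<gamma> in at_bot. \<gamma> \<in> D \<and> h \<gamma> = lam \<gamma> + \<alpha>"
    using lin unfolding eventually_Q_linear_on_def by blast
  then obtain \<gamma>1 where \<gamma>1: "\<And>\<gamma>. \<gamma> \<le> \<gamma>1 \<Longrightarrow> h \<gamma> = lam \<gamma> + \<alpha>"
    unfolding eventually_at_bot_linorder by blast
  obtain \<gamma>0 where \<gamma>0: "\<And>x. x \<in> X `` {w} - cball v 0 (Fin \<gamma>0) \<Longrightarrow> \<exists>\<gamma>\<in>D. v x = Fin \<gamma> \<and> v (f w x) = Fin (h \<gamma>)"
    using fac unfolding factorizes_at_inf_def by blast
  obtain z where z: "z \<noteq> 0" "v z = Fin \<alpha>" using v_surj by blast
  obtain c0 where c0: "c0 \<noteq> 0" "v c0 = Fin \<gamma>0" using v_surj by blast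
  obtain c1 where c1: "c1 \<noteq> 0" "v c1 = Fin \<gamma>1" using v_surj by blast
  have "\<forall>\<^sub>F x in at_inf. v (ft w x ^ nat ?b) = v (x powi ?a * z ^ nat ?b)"
    using eventually_X[OF w] eventually_at_inf_less[OF c0(1)] eventually_at_inf_less[OF c1(1)]
      eventually_at_inf_nonzero
  proof eventually_elim
    case (elim x)
    have "x \<in> X `` {w} - cball v 0 (Fin \<gamma>0)" using elim(1,2) c0(2) by (simp add: cball_def not_le)
    then obtain \<gamma> where \<gamma>: "v x = Fin \<gamma>" "v (f w x) = Fin (h \<gamma>)" using \<gamma>0 by blast
    have h: "h \<gamma> = lam \<gamma> + \<alpha>" using \<gamma>1[of \<gamma>] elim(3) c1(2) \<gamma>(1) by simp
    have vf: "v (ft w x) = Fin (lam \<gamma> + \<alpha>)" using \<gamma>(2) h elim(1) by (simp add: ft_def)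
    have "v (ft w x ^ nat ?b) = v (ft w x powi ?b)" using b by (simp add: power_int_def)
    also have "\<dots> = Fin (zmult ?b (lam \<gamma> + \<alpha>))" by (rule v_powi[OF ft_nonzero vf])
    also have "zmult ?b (lam \<gamma> + \<alpha>) = zmult ?b (lam \<gamma>) + zmult ?b \<alpha>"
      using b by (simp add: zmult_def sum.distrib)
    also have "zmult ?b (lam \<gamma>) = zmult ?a \<gamma>" using rat by (simp add: is_rat_mult_def)
    also have "Fin (zmult ?a \<gamma> + zmult ?b \<alpha>) = v (x powi ?a) + v (z powi ?b)"
      using v_powi[OF elim(4) \<gamma>(1), of ?a] v_powi[OF z, of ?b] by simp
    also have "\<dots> = v (x powi ?a * z ^ nat ?b)" using b by (simp add: v_mult power_int_def)
    finally show ?case .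
  qed
  then show ?thesis using z(1) unfolding slope_def by blast
qed

lemma Dp_slope: "Dp (\<lambda>e. slope a b (map e [0..<d]))"
  unfolding slope_def by (intro Dp_rules Dp_ev Df_powi Df_ft)

lemma Dp_ratio: "Dp (\<lambda>e. \<forall>\<^sub>F y in at_inf. req (ratio a b (map e [0..<d]) y) (e d))"
  unfolding ratio_def req_def by (intro Dp_rules Dp_ev Df_powi Df_ft)

lemma Dp_W: "Dp (\<lambda>e. map e [0..<d] \<in> W)"
  by (rule Dp_of_definable[OF definable_W])

lemma definable_slope: "definable L K d {w \<in> W. slope a b w}"
proof -
  have "definable L K d {xs. length xs = d \<and>
      (map (\<lambda>i. xs ! i) [0..<d] \<in> W \<and> slope a b (map (\<lambda>i. xs ! i) [0..<d]))}"
  proof (rule definable_of_Dp)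
    show "Dp (\<lambda>e. map e [0..<d] \<in> W \<and> slope a b (map e [0..<d]))"
      by (intro Dp_conj Dp_W Dp_slope)
    fix e e' :: "nat \<Rightarrow> 'k"
    assume "\<And>i. i < d \<Longrightarrow> e i = e' i"
    then have eq: "map e [0..<d] = map e' [0..<d]" by simp
    show "(map e [0..<d] \<in> W \<and> slope a b (map e [0..<d])) =
        (map e' [0..<d] \<in> W \<and> slope a b (map e' [0..<d]))" unfolding eq by (rule refl)
  qed
  also have "{xs. length xs = d \<and>
      (map (\<lambda>i. xs ! i) [0..<d] \<in> W \<and> slope a b (map (\<lambda>i. xs ! i) [0..<d]))} = {w \<in> W. slope a b w}"
    using length_W map_nth by (metis (no_types, lifting))
  finally show ?thesis .
qed

text \<open>The exponents depend on \<open>w\<close>, but a finite disjunction over the possible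
  slopes gives a single definition of the preimage of the graph of \<open>c\<close>.\<close>

lemma definable_ratio_class:
  assumes "finite R"
  shows "definable L K (d + 1) {w @ [x] |w x. w \<in> W \<and> x \<noteq> 0 \<and>
    (\<exists>(a, b)\<in>R. slope a b w \<and> (\<forall>\<^sub>F y in at_inf. req (ratio a b w y) x))}"
proof -
  let ?Q = "\<lambda>w x. w \<in> W \<and> x \<noteq> 0 \<and>
    (\<exists>ab\<in>R. slope (fst ab) (snd ab) w \<and> (\<forall>\<^sub>F y in at_inf. req (ratio (fst ab) (snd ab) w y) x))"
  have "definable L K (d + 1) {xs. length xs = d + 1 \<and> ?Q (map (\<lambda>i. xs ! i) [0..<d]) (xs ! d)}"
  proof (rule definable_of_Dp[of "\<lambda>e. ?Q (map e [0..<d]) (e d)"])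
    show "Dp (\<lambda>e. ?Q (map e [0..<d]) (e d))"
      by (intro Dp_conj Dp_not Dp_eq Df_var Df_const Dp_W Dp_slope Dp_ratio Dp_bex_finite assms)
    fix e e' :: "nat \<Rightarrow> 'k"
    assume *: "\<And>i. i < d + 1 \<Longrightarrow> e i = e' i"
    then have eq: "map e [0..<d] = map e' [0..<d]" "e d = e' d" by simp_all
    show "?Q (map e [0..<d]) (e d) = ?Q (map e' [0..<d]) (e' d)" unfolding eq by (rule refl)
  qed
  also have "{xs. length xs = d + 1 \<and> ?Q (map (\<lambda>i. xs ! i) [0..<d]) (xs ! d)} =
      {w @ [x] |w x. ?Q w x}"
  proof (intro equalityI subsetI)
    fix xs assume "xs \<in> {xs. length xs = d + 1 \<and> ?Q (map (\<lambda>i. xs ! i) [0..<d]) (xs ! d)}"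
    then have len: "length xs = d + 1" and Q: "?Q (map (\<lambda>i. xs ! i) [0..<d]) (xs ! d)"
      unfolding mem_Collect_eq by (rule conjunct1, rule conjunct2)
    have "xs = map (\<lambda>i. xs ! i) [0..<d + 1]" using map_nth[of xs] len by simp
    then have "xs = map (\<lambda>i. xs ! i) [0..<d] @ [xs ! d]" by simp
    then show "xs \<in> {w @ [x] |w x. ?Q w x}" using Q by blast
  next
    fix xs assume "xs \<in> {w @ [x] |w x. ?Q w x}"
    then obtain w x where xs: "xs = w @ [x]" and Q: "?Q w x" by blast
    have len: "length w = d" using Q length_W by blast
    have "map (\<lambda>i. xs ! i) [0..<d] = map (\<lambda>i. w ! i) [0..<d]" using len by (simp add: xs nth_append)
    also have "\<dots> = w" using map_nth[of w] len by simp
    finally have 1: "map (\<lambda>i. xs ! i) [0..<d] = w" .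
    have 2: "xs ! d = x" "length xs = d + 1" using len by (simp_all add: xs nth_append)
    show "xs \<in> {xs. length xs = d + 1 \<and> ?Q (map (\<lambda>i. xs ! i) [0..<d]) (xs ! d)}"
      unfolding mem_Collect_eq 1 2 using Q by blast
  qed
  finally show ?thesis by (simp add: case_prod_beta)
qed

lemma dfn_ratio: "w \<in> W \<Longrightarrow> dfn (ratio a b w)"
  unfolding ratio_def by (intro Dp_rules Df_powi Df_fun[OF dfn_ft])

lemma slope_ratio_v:
  assumes "0 < b" "slope a b w"
  shows "\<exists>z. z \<noteq> 0 \<and> (\<forall>\<^sub>F y in at_inf. v (ratio a b w y) = v z)"
  using assms(2) ratio_v[OF assms(1)] unfolding slope_def ratio_def by blast

lemma slope_rv_limit:
  assumes w: "w \<in> W" and b: "0 < b" and s: "slope a b w"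
  shows "\<exists>c. c \<noteq> 0 \<and> (\<forall>\<^sub>F y in at_inf. req (ratio a b w y) c)"
proof -
  obtain z where z: "z \<noteq> 0" "\<forall>\<^sub>F y in at_inf. v (ratio a b w y) = v z"
    using slope_ratio_v[OF b s] by blast
  have "\<forall>\<^sub>F y in at_inf. v z \<le> v (ratio a b w y)" using z(2) by eventually_elim simp
  from residue_limit_0[OF dfn_ratio[OF w] z(1) this] obtain c
    where "\<forall>\<^sub>F y in at_inf. v z < v (ratio a b w y - c)" by blast
  with z(2) have req: "\<forall>\<^sub>F y in at_inf. req (ratio a b w y) c"
  proof eventually_elim
    case (elim y)
    then have "req c (ratio a b w y)" by (simp add: req_def v_diff_commute)
    then show ?case by (rule req_sym)
  qed
  then show ?thesis using at_inf_ex req_nonzero by blast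
qed

text \<open>Every \<open>x\<close> is \<open>y^b\<close>, and then its power with exponent
  \<open>a / b\<close> is represented by \<open>y^a\<close>, the denominator of the ratio.\<close>

lemma rv_at_inf:
  assumes w: "w \<in> W" and b: "b = char_exp TYPE('k) ^ m" and c: "c \<noteq> 0"
    and ev: "\<forall>\<^sub>F y in at_inf. req (ratio a b w y) c"
  shows "\<exists>N. nbhd_inf v N \<and> N \<subseteq> X `` {w} \<and>
    (\<forall>x\<in>N. rv v (f w x) =
      frac_pow (RVs v) (char_exp TYPE('k)) (rv v x) a (int m) \<otimes>\<^bsub>RVs v\<^esub> rv v c)"
proof -
  have b0: "0 < b" using b char_exp_pos by simp
  have "\<forall>\<^sub>F y in at_inf. rv v (ft w (y ^ b)) =
      frac_pow (RVs v) (char_exp TYPE('k)) (rv v (y ^ b)) a (int m) \<otimes>\<^bsub>RVs v\<^esub> rv v c"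
    using ev eventually_at_inf_nonzero
  proof eventually_elim
    case (elim y)
    define u where "u = y powi a"
    have nz: "u \<noteq> 0" using elim(2) by (simp add: u_def)
    have "req (u * ratio a b w y) (u * c)" using elim(1) req_mult_left[OF nz] by blast
    then have "req (ft w (y ^ b)) (u * c)" using nz by (simp add: ratio_def u_def[symmetric])
    then have "rv v (ft w (y ^ b)) = rv v (u * c)"
      using rv_eq_iff[of "ft w (y ^ b)" "u * c"] ft_nonzero nz c by simp
    also have "\<dots> = rv v u \<otimes>\<^bsub>RVs v\<^esub> rv v c" using nz c by (simp add: RVs_mult)
    finally show ?case using frac_pow_RVs[OF elim(2), of m a] by (simp add: b u_def)
  qed
  from at_inf_powerD[OF b0 this] eventually_X[OF w]
  have "\<forall>\<^sub>F x in at_inf. rv v (ft w x) =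
      frac_pow (RVs v) (char_exp TYPE('k)) (rv v x) a (int m) \<otimes>\<^bsub>RVs v\<^esub> rv v c \<and> (w, x) \<in> X"
    by (rule eventually_conj)
  then obtain e where e: "e \<noteq> 0" "\<And>x. v x < v e \<Longrightarrow> rv v (ft w x) =
      frac_pow (RVs v) (char_exp TYPE('k)) (rv v x) a (int m) \<otimes>\<^bsub>RVs v\<^esub> rv v c \<and> (w, x) \<in> X"
    unfolding eventually_at_inf by blast
  obtain \<gamma> where \<gamma>: "v e = Fin \<gamma>" using v_fin[OF e(1)] by blast
  have far: "v x < v e" if "x \<in> - cball v 0 (Fin \<gamma>)" for x
    using that by (simp add: cball_def \<gamma> not_le)
  show ?thesis
  proof (intro exI[of _ "- cball v 0 (Fin \<gamma>)"] conjI ballI subsetI)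
    show "nbhd_inf v (- cball v 0 (Fin \<gamma>))" by (auto simp: nbhd_inf_def)
    show "x \<in> X `` {w}" if "x \<in> - cball v 0 (Fin \<gamma>)" for x
      using e(2)[OF far[OF that]] by simp
    show "rv v (f w x) = frac_pow (RVs v) (char_exp TYPE('k)) (rv v x) a (int m) \<otimes>\<^bsub>RVs v\<^esub> rv v c"
      if "x \<in> - cball v 0 (Fin \<gamma>)" for x
    proof -
      have "(w, x) \<in> X" using e(2)[OF far[OF that]] by blast
      then have "ft w x = f w x" by (simp add: ft_def)
      then show ?thesis using e(2)[OF far[OF that]] by simp
    qed
  qed
qed

section \<open>Limits under definable completeness\<close>

text \<open>The centers admissible for the radius \<open>v s\<close> form a closed ball of exactly
  that radius, definably in \<open>s\<close>. Taking all of them avoids a choice of centers, and any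
  point common to these nested balls is a limit.\<close>

lemma complete_limit:
  assumes g: "dfn g" and a: "a \<noteq> 0" "\<forall>\<^sub>F x in at_inf. v a \<le> v (g x)"
    and complete: "definably_complete v L K"
  shows "\<exists>l. \<forall>s. s \<noteq> 0 \<longrightarrow> (\<forall>\<^sub>F x in at_inf. v s \<le> v (g x - l))"
proof -
  define B where "B s = {z. \<forall>\<^sub>F x in at_inf. v s \<le> v (g x - z)}" for s
  \<comment> \<open>The parameter 0 is excluded: it would ask for the radius infinity, that is, for
    \<open>g\<close> to be eventually constant.\<close>
  define I where "I = {xs. length xs = 1 \<and> xs ! 0 \<noteq> (0::'k)}"
  define Y where "Y = {(xs, z). xs \<in> I \<and> z \<in> B (xs ! 0)}"
  have I: "[s] \<in> I \<longleftrightarrow> s \<noteq> 0" for s by (simp add: I_def)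
  have I_cases: "\<exists>s. xs = [s] \<and> s \<noteq> 0" if "xs \<in> I" for xs
    using that by (cases xs) (auto simp: I_def)
  have Y_img: "Y `` {[s]} = B s" if "s \<noteq> 0" for s
    using that by (simp add: Y_def I Image_def)
  have B_ne: "B s \<noteq> {}" if "s \<noteq> 0" for s
    using cauchy_at_inf[OF g a that] unfolding B_def by blast
  have B_mono: "B s \<subseteq> B s'" if "v s' \<le> v s" for s s'
    unfolding B_def using that order_trans by (blast intro: eventually_mono)
  have ball: "is_ball_of_radius v (v s) (B s)" if s: "s \<noteq> 0" for s
  proof -
    obtain z where z: "z \<in> B s" using B_ne[OF s] by blast
    have ev: "\<forall>\<^sub>F x in at_inf. v s \<le> v (g x - z)" using z by (simp add: B_def)
    have "B s = cball v z (v s)"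
    proof (intro equalityI subsetI)
      fix y assume "y \<in> B s"
      then have "\<forall>\<^sub>F x in at_inf. v s \<le> v (g x - y)" by (simp add: B_def)
      with ev have "\<forall>\<^sub>F x in at_inf. v s \<le> v (y - z)"
        by eventually_elim (metis v_triangle v_diff_commute)
      then show "y \<in> cball v z (v s)" using at_inf_ex by (auto simp: cball_def)
    next
      fix y assume "y \<in> cball v z (v s)"
      then have "v s \<le> v (z - y)" by (simp add: cball_def v_diff_commute)
      with ev show "y \<in> B s" unfolding B_def mem_Collect_eq
        by (auto elim!: eventually_mono intro: v_triangle)
    qed
    moreover have "v s \<noteq> Minf" using v_fin[OF s] by auto
    ultimately show ?thesis by (auto simp: is_ball_of_radius_def)
  qed
  have "definable_family L K 1 I Y"
    unfolding definable_family_def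
  proof (intro conjI)
    show "definable L K 1 I"
      unfolding I_def
    proof (rule definable_of_Dp[of "\<lambda>e. e 0 \<noteq> 0"])
      show "Dp (\<lambda>e. e 0 \<noteq> 0)" by (intro Dp_not Dp_eq Df_var Df_const)
    qed simp
    show "fst ` Y = I"
    proof (intro equalityI subsetI)
      fix w assume "w \<in> I"
      then obtain s where s: "w = [s]" "s \<noteq> 0" using I_cases by blast
      obtain z where "z \<in> B s" using B_ne[OF s(2)] by blast
      then have "(w, z) \<in> Y" using s I by (simp add: Y_def)
      then show "w \<in> fst ` Y" by force
    qed (auto simp: Y_def)
    have "definable L K 2 {xs. length xs = 2 \<and> (xs ! 0 \<noteq> 0 \<and> xs ! 1 \<in> B (xs ! 0))}"
    proof (rule definable_of_Dp[of "\<lambda>e. e 0 \<noteq> 0 \<and> e 1 \<in> B (e 0)"])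
      show "Dp (\<lambda>e. e 0 \<noteq> 0 \<and> e 1 \<in> B (e 0))"
        unfolding B_def mem_Collect_eq by (intro Dp_rules Dp_ev Df_fun[OF g])
    qed simp
    also have "{xs. length xs = 2 \<and> (xs ! 0 \<noteq> 0 \<and> xs ! 1 \<in> B (xs ! 0))} =
        {w @ [x] |w x. (w, x) \<in> Y}"
      unfolding Y_def I_def by (auto simp: length_Suc_conv numeral_2_eq_2)
    finally show "definable L K (1 + 1) {w @ [x] |w x. (w, x) \<in> Y}" by (simp add: numeral_2_eq_2)
  qed
  moreover have "\<forall>w\<in>I. \<exists>\<rho>. is_ball_of_radius v \<rho> (Y `` {w})"
  proof
    fix w assume "w \<in> I"
    then obtain s where "w = [s]" "s \<noteq> 0" using I_cases by blast
    then show "\<exists>\<rho>. is_ball_of_radius v \<rho> (Y `` {w})" using ball[of s] Y_img[of s] by auto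
  qed
  moreover have "\<forall>w\<in>I. \<forall>w'\<in>I. Y `` {w} \<subseteq> Y `` {w'} \<or> Y `` {w'} \<subseteq> Y `` {w}"
  proof (intro ballI)
    fix w w' assume "w \<in> I" "w' \<in> I"
    then obtain s s' where s: "w = [s]" "s \<noteq> 0" "w' = [s']" "s' \<noteq> 0" using I_cases by blast
    show "Y `` {w} \<subseteq> Y `` {w'} \<or> Y `` {w'} \<subseteq> Y `` {w}"
      using B_mono[of s s'] B_mono[of s' s] linear[of "v s" "v s'"] s Y_img by auto
  qed
  moreover have "\<forall>\<gamma>. \<exists>w\<in>I. \<exists>\<rho>. Fin \<gamma> < \<rho> \<and> is_ball_of_radius v \<rho> (Y `` {w})"
  proof
    fix \<gamma>
    obtain t where t: "t \<noteq> 0" "v t = Fin \<gamma>" using v_surj by blast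
    obtain s where s: "s \<noteq> 0" "v t < v s" by (rule v_unbounded_above[OF t(1)])
    then show "\<exists>w\<in>I. \<exists>\<rho>. Fin \<gamma> < \<rho> \<and> is_ball_of_radius v \<rho> (Y `` {w})"
      using ball[OF s(1)] Y_img[OF s(1)] t(2) I[of s] by (intro bexI[of _ "[s]"] exI[of _ "v s"]) auto
  qed
  ultimately have "(\<Inter>w\<in>I. Y `` {w}) \<noteq> {}"
    using complete unfolding definably_complete_def by blast
  then obtain l where l: "\<And>w. w \<in> I \<Longrightarrow> l \<in> Y `` {w}" by blast
  have "\<forall>\<^sub>F x in at_inf. v s \<le> v (g x - l)" if "s \<noteq> 0" for s
    using l[of "[s]"] Y_img[OF that] I that by (simp add: B_def)
  then show ?thesis by blast
qed

lemma limit_at_inf: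
  assumes w: "w \<in> W" and b: "b = char_exp TYPE('k) ^ m" and c: "c \<noteq> 0"
    and ev: "\<forall>\<^sub>F y in at_inf. req (ratio a b w y) c"
    and complete: "definably_complete v L K"
  shows "\<exists>l. lim_inf v (\<lambda>x. f w x / frac_pow mult_grp (char_exp TYPE('k)) x a (int m)) l \<and>
    rv v c = rv v l"
proof -
  have b0: "0 < b" using b char_exp_pos by simp
  have "\<forall>\<^sub>F y in at_inf. v c \<le> v (ratio a b w y)" using ev by eventually_elim (simp add: req_v)
  from complete_limit[OF dfn_ratio[OF w] c this complete] obtain l where
    l: "\<And>s. s \<noteq> 0 \<Longrightarrow> \<forall>\<^sub>F y in at_inf. v s \<le> v (ratio a b w y - l)" by blast
  have "lim_inf v (\<lambda>x. f w x / frac_pow mult_grp (char_exp TYPE('k)) x a (int m)) l"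
    unfolding lim_inf_def
  proof
    fix \<gamma>
    obtain t where t: "t \<noteq> 0" "v t = Fin \<gamma>" using v_surj by blast
    obtain s where s: "s \<noteq> 0" "v t < v s" by (rule v_unbounded_above[OF t(1)])
    have "\<forall>\<^sub>F y in at_inf. Fin \<gamma> <
        v (f w (y ^ b) / frac_pow mult_grp (char_exp TYPE('k)) (y ^ b) a (int m) - l)"
      using l[OF s(1)] at_inf_powerI[OF b0 eventually_X[OF w]] eventually_at_inf_nonzero
    proof eventually_elim
      case (elim y)
      have "frac_pow mult_grp (char_exp TYPE('k)) (y ^ b) a (int m) = y powi a"
        unfolding b by (rule frac_pow_mult_grp[OF elim(3)])
      then show ?case using elim(1,2) s(2) t(2) by (simp add: ratio_def ft_def)
    qed
    from at_inf_powerD[OF b0 this] obtain e where e: "e \<noteq> 0" "\<And>x. v x < v e \<Longrightarrow> Fin \<gamma> <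
        v (f w x / frac_pow mult_grp (char_exp TYPE('k)) x a (int m) - l)"
      unfolding eventually_at_inf by blast
    obtain \<delta> where "v e = Fin \<delta>" using v_fin[OF e(1)] by blast
    then show "\<exists>\<delta>. \<forall>x. v x < Fin \<delta> \<longrightarrow> Fin \<gamma> <
        v (f w x / frac_pow mult_grp (char_exp TYPE('k)) x a (int m) - l)"
      using e(2) by (intro exI[of _ \<delta>]) simp
  qed
  moreover have "req c l"
  proof -
    \<comment> \<open>At a radius beyond \<open>v c\<close> the limit is so close to the ratio that
      both have the same class as \<open>c\<close>.\<close>
    obtain s where s: "s \<noteq> 0" "v c < v s" by (rule v_unbounded_above[OF c])
    from ev l[OF s(1)] have "\<forall>\<^sub>F y in at_inf. req l c"
    proof eventually_elim
      case (elim y)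
      then have "v c < v (l - c)"
        using v_triangle_less[of "v c" l "ratio a b w y" c] s(2)
        by (simp add: req_def v_diff_commute[of l])
      then show ?case by (simp add: req_def)
    qed
    then show ?thesis using at_inf_ex req_sym by blast
  qed
  ultimately show ?thesis using rv_eq_iff req_nonzero by blast
qed

end

theorem theorem5p4:
  fixes v :: "'k::alg_closed_field \<Rightarrow> 'g::linordered_ab_group_add extended"
    and L :: "('f vfun, 'r vrel) language"
    and K :: "('f vfun, 'r vrel, 'k) fo_struct"
    and d p :: nat
    and W :: "'k list set"
    and X :: "('k list \<times> 'k) set"
    and f :: "'k list \<Rightarrow> 'k \<Rightarrow> 'k"
    and Y :: "('k list \<times> 'g) set"
    and h :: "'k list \<Rightarrow> 'g \<Rightarrow> 'g"
  assumes "valued_field v"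
    and "expands_valued_field v L K"
    and "C_minimal L K"
    and "p = char_exp TYPE('k)"
    and "definable L K d W"
    and "definable_fun_family L K d W X f"
    and "\<forall>(w, x)\<in>X. f w x \<noteq> 0"
    and "\<forall>w\<in>W. \<exists>N. nbhd_inf v N \<and> N \<subseteq> X `` {w}"
    and "definable_\<Gamma>_fun_family v L K d W Y h"
    and "\<forall>w\<in>W. factorizes_at_inf v (X `` {w}) (f w) (Y `` {w}) (h w)"
    and "eventually_Q_linear_family at_bot W Y h"
  shows "\<exists>(l::nat) (Wi :: nat \<Rightarrow> 'k list set) (n :: nat \<Rightarrow> int) (m :: nat \<Rightarrow> int) (c :: 'k list \<Rightarrow> 'k set).
      (\<Union>i<l. Wi i) = W \<and> disjoint_family_on Wi {..<l} \<and>
      (\<forall>i<l. Wi i \<noteq> {} \<and> definable L K d (Wi i)) \<and>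
      definable_RVs_fun v L K d W c \<and>
      (\<forall>i<l. \<forall>w\<in>Wi i. \<exists>N. nbhd_inf v N \<and> N \<subseteq> X `` {w} \<and>
         (\<forall>x\<in>N. rv v (f w x) = frac_pow (RVs v) p (rv v x) (n i) (m i) \<otimes>\<^bsub>RVs v\<^esub> c w)) \<and>
      (definably_complete v L K \<and>
       (\<forall>g. definable_unary_\<Gamma>_fun v L K g \<longrightarrow> eventually_linear at_top g) \<longrightarrow>
       (\<forall>i<l. \<forall>w\<in>Wi i. \<exists>a.
          lim_inf v (\<lambda>x. f w x / frac_pow mult_grp p x (n i) (m i)) a \<and> c w = rv v a))"
proof -
  interpret C_min_family v L K d W X f
    by unfold_locales (use assms in simp_all)
  let ?a = "\<lambda>r. fst (quotient_of r)" and ?b = "\<lambda>r. nat (snd (quotient_of r))"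
  have b_pos: "0 < ?b r" for r using quotient_of_denom_pos'[of r] by simp
  define Wr where "Wr r = {w \<in> W. slope (?a r) (?b r) w}" for r
  obtain Z where Z: "finite Z" "\<forall>w\<in>W. \<exists>r\<in>Z. eventually_Q_linear_on at_bot (Y `` {w}) (h w) r"
    using assms(11) unfolding eventually_Q_linear_family_def by blast
  \<comment> \<open>Slopes that do not occur are discarded, because the pieces of the partition have
    to be non-empty.\<close>
  define R where "R = {r \<in> Z. Wr r \<noteq> {}}"
  have finR: "finite R" using Z(1) by (simp add: R_def)
  have cover: "\<exists>r\<in>R. w \<in> Wr r" if w: "w \<in> W" for w
  proof -
    obtain r where r: "r \<in> Z" "eventually_Q_linear_on at_bot (Y `` {w}) (h w) r" using Z(2) w by blast
    have "slope (?a r) (?b r) w" using slope_of_factorization[OF w _ r(2)] assms(10) w by blast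
    then show ?thesis using w r(1) unfolding R_def Wr_def by blast
  qed
  \<comment> \<open>Distinct rationals give disjoint pieces: two slopes at the same \<open>w\<close>
    agree as fractions.\<close>
  have unique: "r = r'" if "w \<in> Wr r" "w \<in> Wr r'" for w r r'
  proof -
    have "?a r * int (?b r') = ?a r' * int (?b r)"
      using slope_unique that unfolding Wr_def by blast
    moreover have "int (?b q) = snd (quotient_of q)" for q using quotient_of_denom_pos'[of q] by simp
    ultimately have "?a r * snd (quotient_of r') = ?a r' * snd (quotient_of r)" by (simp only:)
    then have "rat_of_int (?a r) * rat_of_int (snd (quotient_of r')) =
        rat_of_int (?a r') * rat_of_int (snd (quotient_of r))"
      by (metis of_int_mult)
    moreover have "rat_of_int (snd (quotient_of q)) \<noteq> 0" for q
      using quotient_of_denom_pos'[of q] by simp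
    ultimately have "rat_of_int (?a r) / rat_of_int (snd (quotient_of r)) =
        rat_of_int (?a r') / rat_of_int (snd (quotient_of r'))"
      by (simp add: frac_eq_eq)
    moreover have "q = rat_of_int (?a q) / rat_of_int (snd (quotient_of q))" for q
      by (rule quotient_of_div) simp
    ultimately show ?thesis by metis
  qed
  have denom: "\<exists>m. ?b r = p ^ m" if w: "w \<in> Wr r" for w r
  proof -
    obtain z where "z \<noteq> 0" "\<forall>\<^sub>F x in at_inf. v (ft w x ^ ?b r) = v (x powi ?a r * z ^ ?b r)"
      using w unfolding Wr_def slope_def by blast
    moreover have "coprime (?a r) (int (?b r))"
      using quotient_of_coprime[of r "?a r" "snd (quotient_of r)"] quotient_of_denom_pos'[of r] by simp
    moreover have "dfn (ft w)" using dfn_ft w unfolding Wr_def by blast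
    ultimately show ?thesis using slope_denominator b_pos assms(4) by blast
  qed
  define M where "M r = (SOME m. ?b r = p ^ m)" for r
  have M: "?b r = p ^ M r" if "r \<in> R" for r
  proof -
    have "\<exists>m. ?b r = p ^ m" using that denom unfolding R_def by blast
    then show ?thesis unfolding M_def by (rule someI_ex)
  qed
  \<comment> \<open>\<open>Q w x\<close> says that \<open>x\<close> represents the limit class at
    \<open>w\<close>. The slope condition selects the right member of \<open>R\<close>, so no case
    distinction on \<open>w\<close> enters the definition.\<close>
  define Q where "Q w x \<longleftrightarrow> w \<in> W \<and> x \<noteq> 0 \<and>
      (\<exists>(a, b)\<in>(\<lambda>r. (?a r, ?b r)) ` R. slope a b w \<and> (\<forall>\<^sub>F y in at_inf. req (ratio a b w y) x))"
    for w x
  have Q_iff: "Q w x \<longleftrightarrow> x \<noteq> 0 \<and> (\<forall>\<^sub>F y in at_inf. req (ratio (?a r) (?b r) w y) x)"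
    if "w \<in> Wr r" "r \<in> R" for w x r
  proof -
    have "Q w x \<longleftrightarrow> x \<noteq> 0 \<and> (\<exists>r'\<in>R. w \<in> Wr r' \<and> (\<forall>\<^sub>F y in at_inf. req (ratio (?a r') (?b r') w y) x))"
      using that unfolding Q_def Wr_def by auto
    then show ?thesis using unique[OF that(1)] that by blast
  qed
  \<comment> \<open>The chosen representative need not depend definably on \<open>w\<close>; only
    its class in RV does.\<close>
  define C where "C w = (SOME x. Q w x)" for w
  have C: "Q w (C w)" if w: "w \<in> W" for w
  proof -
    obtain r where r: "r \<in> R" "w \<in> Wr r" using cover[OF w] by blast
    have "slope (?a r) (?b r) w" using r(2) by (simp add: Wr_def)
    from slope_rv_limit[OF w b_pos this] have "\<exists>x. Q w x" using Q_iff[OF r(2,1)] by simp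
    then show ?thesis unfolding C_def by (rule someI_ex)
  qed
  have Q_C: "Q w x \<longleftrightarrow> x \<noteq> 0 \<and> rv v x = rv v (C w)" if w: "w \<in> W" for w x
  proof -
    obtain r where r: "r \<in> R" "w \<in> Wr r" using cover[OF w] by blast
    have Cr: "C w \<noteq> 0" "\<forall>\<^sub>F y in at_inf. req (ratio (?a r) (?b r) w y) (C w)"
      using C[OF w] Q_iff[OF r(2,1)] by blast+
    show ?thesis
    proof (cases "x = 0")
      case False
      have "(\<forall>\<^sub>F y in at_inf. req (ratio (?a r) (?b r) w y) x) \<longleftrightarrow> req x (C w)"
      proof
        assume "\<forall>\<^sub>F y in at_inf. req (ratio (?a r) (?b r) w y) x"
        with Cr(2) have "\<forall>\<^sub>F y in at_inf. req x (C w)"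
          by eventually_elim (rule req_trans[OF req_sym])
        then show "req x (C w)" using at_inf_ex by blast
      next
        assume x: "req x (C w)"
        show "\<forall>\<^sub>F y in at_inf. req (ratio (?a r) (?b r) w y) x"
          using Cr(2) by eventually_elim (rule req_trans[OF _ req_sym[OF x]])
      qed
      then show ?thesis using Q_iff[OF r(2,1)] rv_eq_iff[OF False Cr(1)] False by simp
    qed (simp add: Q_def)
  qed
  have RVs_fun: "definable_RVs_fun v L K d W (\<lambda>w. rv v (C w))"
    unfolding definable_RVs_fun_def
  proof
    show "(\<lambda>w. rv v (C w)) \<in> W \<rightarrow> carrier (RVs v)"
      using C by (auto simp: carrier_RVs Q_def)
    have "definable L K (d + 1) {w @ [x] |w x. Q w x}"
      unfolding Q_def by (rule definable_ratio_class) (use finR in simp)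
    moreover have "Q w x \<longleftrightarrow> w \<in> W \<and> x \<noteq> 0 \<and> rv v x = rv v (C w)" for w x
    proof (cases "w \<in> W")
      case True
      then show ?thesis using Q_C[OF True] by simp
    qed (simp add: Q_def)
    ultimately show "definable L K (d + 1) {w @ [x] |w x. w \<in> W \<and> x \<noteq> 0 \<and> rv v x = rv v (C w)}"
      by simp
  qed
  obtain r where r: "bij_betw r {..<card R} R"
    using ex_bij_betw_nat_finite[OF finR] by (auto simp: atLeast0LessThan)
  have rR: "r i \<in> R" if "i < card R" for i using bij_betw_apply[OF r] that by simp
  have CQ: "C w \<noteq> 0" "\<forall>\<^sub>F y in at_inf. req (ratio (?a (r i)) (?b (r i)) w y) (C w)"
    "w \<in> W" "?b (r i) = char_exp TYPE('k) ^ M (r i)" if "i < card R" "w \<in> Wr (r i)" for i w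
  proof -
    show w: "w \<in> W" using that(2) by (simp add: Wr_def)
    show "C w \<noteq> 0" "\<forall>\<^sub>F y in at_inf. req (ratio (?a (r i)) (?b (r i)) w y) (C w)"
      using C[OF w] Q_iff[OF that(2) rR[OF that(1)]] by blast+
    show "?b (r i) = char_exp TYPE('k) ^ M (r i)" using M[OF rR[OF that(1)]] assms(4) by simp
  qed
  show ?thesis
  proof (rule exI[of _ "card R"], rule exI[of _ "\<lambda>i. Wr (r i)"], rule exI[of _ "\<lambda>i. ?a (r i)"],
      rule exI[of _ "\<lambda>i. int (M (r i))"], rule exI[of _ "\<lambda>w. rv v (C w)"],
      intro conjI allI impI ballI RVs_fun)
    have "(\<Union>i<card R. Wr (r i)) = (\<Union>q\<in>r ` {..<card R}. Wr q)" by simp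
    also have "r ` {..<card R} = R" by (rule bij_betw_imp_surj_on[OF r])
    also have "(\<Union>q\<in>R. Wr q) = W" using cover by (auto simp: Wr_def)
    finally show "(\<Union>i<card R. Wr (r i)) = W" .
    show "disjoint_family_on (\<lambda>i. Wr (r i)) {..<card R}"
      unfolding disjoint_family_on_def
    proof (intro ballI impI)
      fix i j assume ij: "i \<in> {..<card R}" "j \<in> {..<card R}" "i \<noteq> j"
      then have "r i \<noteq> r j" using inj_onD[OF bij_betw_imp_inj_on[OF r], of i j] by blast
      then show "Wr (r i) \<inter> Wr (r j) = {}" using unique[of _ "r i" "r j"] by blast
    qed
    show "Wr (r i) \<noteq> {}" if "i < card R" for i using rR[OF that] by (simp add: R_def)
    show "definable L K d (Wr (r i))" for i unfolding Wr_def by (rule definable_slope)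
    show "\<exists>N. nbhd_inf v N \<and> N \<subseteq> X `` {w} \<and>
        (\<forall>x\<in>N. rv v (f w x) =
          frac_pow (RVs v) p (rv v x) (?a (r i)) (int (M (r i))) \<otimes>\<^bsub>RVs v\<^esub> rv v (C w))"
      if "i < card R" "w \<in> Wr (r i)" for i w
      using rv_at_inf[OF CQ(3,4,1,2)[OF that]] assms(4) by simp
    show "\<exists>a. lim_inf v (\<lambda>x. f w x / frac_pow mult_grp p x (?a (r i)) (int (M (r i)))) a \<and>
        rv v (C w) = rv v a"
      if "definably_complete v L K \<and>
        (\<forall>g. definable_unary_\<Gamma>_fun v L K g \<longrightarrow> eventually_linear at_top g)"
        "i < card R" "w \<in> Wr (r i)" for i w
      using limit_at_inf[OF CQ(3,4,1,2)[OF that(2,3)]] that(1) assms(4) by simp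
  qed
qed

end
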